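(* Let $\theta_1,\theta_2>0$ and let $\mathcal{E}(u):=\mathcal{E}_{P(\theta_1,\theta_2)}^{\theta_1,\theta_2}(u)$. For every $u\in L(\Omega)$, if $\mathcal{E}(u)=0$, then $u\in S(\Omega)$.
   Context: Setting: $n_1,n_2\ge 1$, $n=n_1+n_2$, $\mathbf{R}^n=X_1\oplus X_2$ with $X_1\perp X_2$ and $\dim X_l=n_l$; each $x\in\mathbf{R}^n$ is written $x=x_1+x_2$ with $x_l\in X_l$. For $l=1,2$, $\Omega_l\subset X_l$ is a non-empty bounded connected open subset of $X_l$, and $\Omega:=\Omega_1+\Omega_2\subset\mathbf{R}^n$. $L(U)$ denotes the space of real-valued Lebesgue-measurable functions on a measurable set $U$. The set $S(\Omega)$ consists of all $u\in L(\Omega)$ such that for $l=1$ or $l=2$ there is $u_l\in L(\Omega_l)$ with $u(x)=u_l(x_l)$ for almost every $x\in\Omega$. Kernel: $\rho\in L^1(\mathbf{R}^n,[0,\infty))$ is a fixed radial function with $\int\rho=1$ and $\operatorname{supp}\rho\subset B_1$ (unit ball centered at $0$); $\rho_\varepsilon(z):=\varepsilon^{-n}\rho(z/\varepsilon)$ for $\varepsilon>0$. Energies: for $\varepsilon>0$, $\Omega_l^\varepsilon:=\bigcap_{z_l\in X_l,\,|z_l|<\varepsilon}(\Omega_l-z_l)$ and $\Omega^\varepsilon:=\Omega_1^\varepsilon+\Omega_2^\varepsilon$. For $p,\theta_1,\theta_2>0$ and $u\in L(\Omega)$, $$\mathcal{E}_{\varepsilon,p}^{\theta_1,\theta_2}(u):=\int_{\mathbf{R}^n}\rho_\varepsilon(z)\int_{\Omega^\varepsilon}\frac{|u(x+z_1)-u(x)|^{\theta_1}\,|u(x+z_2)-u(x)|^{\theta_2}}{|z|^p}\,dx\,dz,\qquad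 \mathcal{E}_p^{\theta_1,\theta_2}(u):=\liminf_{\varepsilon\downarrow 0}\mathcal{E}_{\varepsilon,p}^{\theta_1,\theta_2}(u)\in[0,\infty].$$ Exponent: with $\theta:=\theta_1+\theta_2$, $P(\theta_1,\theta_2):=2$ if $\theta\le 1$; $P(\theta_1,\theta_2):=1+\theta$ if $\theta\ge 1$ and $\min(\theta_1,\theta_2)\le 1$; $P(\theta_1,\theta_2):=\min(\theta_1,\theta_2)+\theta$ if $\theta_1,\theta_2>1$. *)

theory Defs
  imports "HOL-Analysis.Analysis"
begin

text \<open>The orthogonal decomposition of the ambient space is given by two subspaces \<open>X\<close>, \<open>Y\<close>;
  \<open>component X Y x\<close> is the \<open>X\<close>-part of \<open>x\<close>, and \<open>component Y X x\<close> the \<open>Y\<close>-part.\<close>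

definition component :: "'a::euclidean_space set \<Rightarrow> 'a set \<Rightarrow> 'a \<Rightarrow> 'a" where
  "component X Y x = (THE y. y \<in> X \<and> x - y \<in> Y)"

definition orthonormal_basis_of :: "'a::euclidean_space set \<Rightarrow> 'a set \<Rightarrow> bool" where
  "orthonormal_basis_of X B \<longleftrightarrow>
     pairwise orthogonal B \<and> (\<forall>b\<in>B. norm b = 1) \<and> span B = X"

text \<open>Lebesgue measure of dimension \<open>dim X\<close> on a subspace \<open>X\<close>, defined as \<^const>\<open>lborel\<close> is,
  with an orthonormal basis of \<open>X\<close> in place of \<^const>\<open>Basis\<close>. By rotation invariance the choice
  of the basis is immaterial.\<close>

definition lebesgue_subspace :: "'a::euclidean_space set \<Rightarrow> 'a measure" where
  "lebesgue_subspace X =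
     (let B = (SOME B. orthonormal_basis_of X B)
      in completion (distr (\<Pi>\<^sub>M b\<in>B. (lborel :: real measure)) (restrict_space borel X)
           (\<lambda>f. \<Sum>b\<in>B. f b *\<^sub>R b)))"

text \<open>Functions are total; membership in \<open>Lfun\<close> and \<open>Sfun\<close> only concerns the values on the
  indicated set.\<close>

definition Lfun :: "'a measure \<Rightarrow> 'a set \<Rightarrow> ('a \<Rightarrow> real) set" where
  "Lfun M U = borel_measurable (restrict_space M U)"

definition Sfun ::
  "'a::euclidean_space set \<Rightarrow> 'a set \<Rightarrow> 'a set \<Rightarrow> 'a set \<Rightarrow> ('a \<Rightarrow> real) set" where
  "Sfun X1 X2 \<Omega>1 \<Omega>2 =
     {u \<in> Lfun lebesgue (\<Omega>1 + \<Omega>2).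
        (\<exists>u1 \<in> Lfun (lebesgue_subspace X1) \<Omega>1.
           AE x in lebesgue_on (\<Omega>1 + \<Omega>2). u x = u1 (component X1 X2 x)) \<or>
        (\<exists>u2 \<in> Lfun (lebesgue_subspace X2) \<Omega>2.
           AE x in lebesgue_on (\<Omega>1 + \<Omega>2). u x = u2 (component X2 X1 x))}"

text \<open>The support of an (a.e. class of a) function: the complement of the largest open set on which
  it vanishes almost everywhere.\<close>

definition ess_support :: "('a::euclidean_space \<Rightarrow> real) \<Rightarrow> 'a set" where
  "ess_support f = {x. \<forall>r>0. \<not> (AE y in lebesgue. y \<in> ball x r \<longrightarrow> f y = 0)}"

definition scaled_kernel :: "('a::euclidean_space \<Rightarrow> real) \<Rightarrow> real \<Rightarrow> 'a \<Rightarrow> real" where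
  "scaled_kernel \<rho> \<epsilon> z = \<rho> (z /\<^sub>R \<epsilon>) / \<epsilon> ^ DIM('a)"

definition shrink :: "'a::euclidean_space set \<Rightarrow> 'a set \<Rightarrow> real \<Rightarrow> 'a set" where
  "shrink X U \<epsilon> = (\<Inter>z\<in>{z \<in> X. norm z < \<epsilon>}. (\<lambda>x. x - z) ` U)"

definition energy_eps ::
  "'a::euclidean_space set \<Rightarrow> 'a set \<Rightarrow> 'a set \<Rightarrow> 'a set \<Rightarrow> ('a \<Rightarrow> real) \<Rightarrow>
   real \<Rightarrow> real \<Rightarrow> real \<Rightarrow> ('a \<Rightarrow> real) \<Rightarrow> real \<Rightarrow> ennreal" where
  "energy_eps X1 X2 \<Omega>1 \<Omega>2 \<rho> p \<theta>1 \<theta>2 u \<epsilon> =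
     (\<integral>\<^sup>+ z. ennreal (scaled_kernel \<rho> \<epsilon> z) *
        (\<integral>\<^sup>+ x \<in> shrink X1 \<Omega>1 \<epsilon> + shrink X2 \<Omega>2 \<epsilon>.
           ennreal (\<bar>u (x + component X1 X2 z) - u x\<bar> powr \<theta>1 *
                    \<bar>u (x + component X2 X1 z) - u x\<bar> powr \<theta>2 / norm z powr p)
         \<partial>lebesgue)
      \<partial>lebesgue)"

definition energy ::
  "'a::euclidean_space set \<Rightarrow> 'a set \<Rightarrow> 'a set \<Rightarrow> 'a set \<Rightarrow> ('a \<Rightarrow> real) \<Rightarrow>
   real \<Rightarrow> real \<Rightarrow> real \<Rightarrow> ('a \<Rightarrow> real) \<Rightarrow> ennreal" where
  "energy X1 X2 \<Omega>1 \<Omega>2 \<rho> p \<theta>1 \<theta>2 u =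
     Liminf (at_right 0) (energy_eps X1 X2 \<Omega>1 \<Omega>2 \<rho> p \<theta>1 \<theta>2 u)"

definition crit_exponent :: "real \<Rightarrow> real \<Rightarrow> real" where
  "crit_exponent \<theta>1 \<theta>2 =
     (let \<theta> = \<theta>1 + \<theta>2 in
      if \<theta> \<le> 1 then 2
      else if min \<theta>1 \<theta>2 \<le> 1 then 1 + \<theta>
      else min \<theta>1 \<theta>2 + \<theta>)"

end

theory Submission
  imports Defs
begin

text \<open>
  The energy contains a product of two increments, and the proof exploits it on two levels.

  First, the directions are frozen. After the substitution \<open>z = \<epsilon> w\<close>, an energy that tends to \<open>0\<close>
  along a sequence of scales \<open>h\<close> (fast enough to be summable) gives, for almost every \<open>w\<close> with
  \<open>\<rho> w > 0\<close>, that
  \<open>\<integral> \<bar>u(x + h w\<^sub>1) - u(x)\<bar>\<^bsup>\<tau>1\<^esup> \<bar>u(x + h w\<^sub>2) - u(x)\<bar>\<^bsup>\<tau>2\<^esup> dx\<close> is \<open>o(h\<^sup>p)\<close>, locally and for all choices of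
  signs of \<open>w\<^sub>1\<close>, \<open>w\<^sub>2\<close> because \<open>\<rho>\<close> is radial (\<open>good_directions\<close>). Replacing \<open>u\<close> by \<open>arctan u / 4\<close> makes all
  increments at most \<open>1\<close>; exponents can then be enlarged, and the three cases of the critical
  exponent become one: \<open>p = \<tau>1 + \<tau>2 + q\<close> with \<open>q \<ge> 1\<close> and \<open>min \<tau>1 \<tau>2 \<le> q \<le> \<tau>1 + \<tau>2\<close> (\<open>exponents\<close>).

  Second, for such a fixed \<open>w\<close> the mixed differences of \<open>u\<close> in the directions \<open>w\<^sub>1\<close>, \<open>w\<^sub>2\<close> vanish
  (\<open>mixed_difference_zero\<close>). On a rectangle of side lengths of order \<open>h\<close>, the mixed difference is
  controlled by the product of increments at some vertex, provided that the increment along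
  \<open>w\<^sub>1\<close> exceeds \<open>c h\<close> (\<open>soft_mixed_difference_le\<close>). So the increments \<open>u(x + h w\<^sub>1) - u(x)\<close>, truncated by a
  soft threshold at level \<open>c h\<close>, change by \<open>o(h\<^sup>2)\<close> in the mean under a translation by \<open>h w\<^sub>2\<close>, hence by
  \<open>o(h)\<close> under a fixed one; the threshold itself contributes \<open>2 c h\<close>. Adding up \<open>1 / h\<close> such
  increments and letting \<open>h \<rightarrow> 0\<close>, then \<open>c \<rightarrow> 0\<close>, gives the claim, by continuity of translations in
  the mean. Since the directions \<open>w\<close> form a set that is not negligible, bilinearity extends this to
  all directions, and connectedness of the two factors to all of \<open>\<Omega>\<close>: in effect, \<open>u\<close> is a sum
  \<open>f(x\<^sub>1) + g(x\<^sub>2)\<close>.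

  For such sums the integral above essentially factorises (\<open>product_of_integrals_le\<close>). The
  increments of a function that is not invariant in a direction are at least of order \<open>h\<close> in the
  mean, so both factors being nontrivial would contradict the decay (\<open>increment_dichotomy\<close>).
  Hence \<open>u\<close> does not depend on \<open>x\<^sub>1\<close>, or does not depend on \<open>x\<^sub>2\<close> (\<open>decay_imp_one_component\<close>). Fubini is
  only applied to pairs of points and translations in the whole space, never to the two factors.
\<close>

section \<open>Translations and integrals over balls\<close>

lemma nn_integral_lborel_translate:
  fixes f :: "'a::euclidean_space \<Rightarrow> ennreal"
  assumes [measurable]: "f \<in> borel_measurable borel"
  shows "(\<integral>\<^sup>+x. f (x + y) \<partial>lborel) = (\<integral>\<^sup>+x. f x \<partial>lborel)"
proof -
  have "(\<integral>\<^sup>+x. f x \<partial>lborel) = (\<integral>\<^sup>+x. f x \<partial>distr lborel borel ((+) y))"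
    by (simp add: lborel_distr_plus)
  also have "\<dots> = (\<integral>\<^sup>+x. f (y + x) \<partial>lborel)"
    by (subst nn_integral_distr) auto
  finally show ?thesis by (simp add: add.commute)
qed

lemma integral_lborel_translate:
  fixes f :: "'a::euclidean_space \<Rightarrow> real"
  assumes [measurable]: "f \<in> borel_measurable borel"
  shows "(\<integral>x. f (x + y) \<partial>lborel) = (\<integral>x. f x \<partial>lborel)"
proof -
  have "(\<integral>x. f x \<partial>lborel) = (\<integral>x. f x \<partial>distr lborel borel ((+) y))"
    by (simp add: lborel_distr_plus)
  also have "\<dots> = (\<integral>x. f (y + x) \<partial>lborel)"
    by (subst integral_distr) auto
  finally show ?thesis by (simp add: add.commute)
qed

lemma integrable_lborel_translate:
  fixes f :: "'a::euclidean_space \<Rightarrow> real"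
  assumes "integrable lborel f"
  shows "integrable lborel (\<lambda>x. f (x + y))"
proof -
  have [measurable]: "f \<in> borel_measurable borel" using assms by auto
  show ?thesis
    using assms nn_integral_lborel_translate[of "\<lambda>x. ennreal (norm (f x))" y]
    unfolding integrable_iff_bounded by simp
qed

lemma AE_lborel_translate:
  fixes P :: "'a::euclidean_space \<Rightarrow> bool"
  assumes "AE x in lborel. P x"
  shows "AE x in lborel. P (x + y)"
proof -
  obtain N where N: "{x. \<not> P x} \<subseteq> N" "N \<in> null_sets lborel"
    using assms by (auto elim!: AE_E simp: null_sets_def)
  have "AE x in distr lborel borel ((+) y). x \<notin> N"
    using N(2) by (simp add: lborel_distr_plus AE_not_in)
  then have "AE x in lborel. y + x \<notin> N"
    using N(2) by (subst (asm) AE_distr_iff) auto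
  then show ?thesis
    using N(1) by (auto simp: add.commute elim!: eventually_mono)
qed

text \<open>The analysis is carried out for bounded Borel functions on the whole space, whose integrals over
  balls all exist.\<close>

definition bdd_borel :: "('a::euclidean_space \<Rightarrow> real) \<Rightarrow> bool" where
  "bdd_borel f \<longleftrightarrow> f \<in> borel_measurable borel \<and> (\<exists>C. \<forall>x. \<bar>f x\<bar> \<le> C)"

text \<open>The Lebesgue integral of \<open>f\<close> over the ball of radius \<open>r\<close> around \<open>p\<close>.\<close>

definition ball_int :: "'a::euclidean_space \<Rightarrow> real \<Rightarrow> ('a \<Rightarrow> real) \<Rightarrow> real" where
  "ball_int p r f = (\<integral>x. indicator (ball p r) x * f x \<partial>lborel)"

named_theorems bdd_borel_intros

lemma bdd_borel_measurable[measurable_dest]: "bdd_borel f \<Longrightarrow> f \<in> borel_measurable borel"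
  by (simp add: bdd_borel_def)

lemma bdd_borelI:
  "f \<in> borel_measurable borel \<Longrightarrow> (\<And>x. \<bar>f x\<bar> \<le> C) \<Longrightarrow> bdd_borel f"
  by (auto simp: bdd_borel_def)

lemma bdd_borel_const[bdd_borel_intros]: "bdd_borel (\<lambda>x. c)"
  by (auto simp: bdd_borel_def)

lemma bdd_borel_translate[bdd_borel_intros]: "bdd_borel f \<Longrightarrow> bdd_borel (\<lambda>x. f (x + y))"
  by (auto simp: bdd_borel_def)

lemma bdd_borel_add[bdd_borel_intros]:
  assumes "bdd_borel f" "bdd_borel g" shows "bdd_borel (\<lambda>x. f x + g x)"
proof -
  obtain C D where "\<And>x. \<bar>f x\<bar> \<le> C" "\<And>x. \<bar>g x\<bar> \<le> D"
    using assms by (auto simp: bdd_borel_def)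
  then have "\<bar>f x + g x\<bar> \<le> C + D" for x
    by (meson abs_triangle_ineq add_mono order_trans)
  then show ?thesis using assms by (intro bdd_borelI) auto
qed

lemma bdd_borel_diff[bdd_borel_intros]:
  assumes "bdd_borel f" "bdd_borel g" shows "bdd_borel (\<lambda>x. f x - g x)"
proof -
  obtain C D where "\<And>x. \<bar>f x\<bar> \<le> C" "\<And>x. \<bar>g x\<bar> \<le> D"
    using assms by (auto simp: bdd_borel_def)
  then have "\<bar>f x - g x\<bar> \<le> C + D" for x
    by (meson abs_triangle_ineq4 add_mono order_trans)
  then show ?thesis using assms by (intro bdd_borelI) auto
qed

lemma bdd_borel_mult[bdd_borel_intros]:
  assumes "bdd_borel f" "bdd_borel g" shows "bdd_borel (\<lambda>x. f x * g x)"
proof -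
  obtain C D where *: "\<And>x. \<bar>f x\<bar> \<le> C" "\<And>x. \<bar>g x\<bar> \<le> D"
    using assms by (auto simp: bdd_borel_def)
  have "\<bar>f x * g x\<bar> \<le> C * D" for x
    unfolding abs_mult using *[of x] by (intro mult_mono) auto
  then show ?thesis using assms by (intro bdd_borelI) auto
qed

lemma bdd_borel_abs[bdd_borel_intros]: "bdd_borel f \<Longrightarrow> bdd_borel (\<lambda>x. \<bar>f x\<bar>)"
  by (auto simp: bdd_borel_def)

lemma bdd_borel_powr[bdd_borel_intros]:
  assumes "bdd_borel f" "0 \<le> a" shows "bdd_borel (\<lambda>x. \<bar>f x\<bar> powr a)"
proof -
  obtain C where *: "\<And>x. \<bar>f x\<bar> \<le> C"
    using assms by (auto simp: bdd_borel_def)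
  have "\<bar>\<bar>f x\<bar> powr a\<bar> \<le> C powr a" for x
    using *[of x] assms(2) by (auto intro: powr_mono2)
  then show ?thesis using assms by (intro bdd_borelI) auto
qed

lemma bdd_borel_integrable:
  fixes f :: "'a::euclidean_space \<Rightarrow> real"
  assumes "bdd_borel f"
  shows "integrable lborel (\<lambda>x. indicator (ball p r) x * f x)"
proof -
  obtain C where *: "\<And>x. \<bar>f x\<bar> \<le> C"
    using assms by (auto simp: bdd_borel_def)
  have [measurable]: "f \<in> borel_measurable borel" using assms by (simp add: bdd_borel_def)
  have "emeasure lborel (ball p r) < \<infinity>"
    by (intro emeasure_bounded_finite) auto
  then have "integrable lborel (\<lambda>x. indicator (ball p r) x * C)"
    by (intro integrable_mult_left integrable_real_indicator) auto
  then show ?thesis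
    by (rule Bochner_Integration.integrable_bound)
       (use * in \<open>auto simp: indicator_def intro!: AE_I2 order_trans[OF *]\<close>)
qed

lemma ball_int_mono:
  assumes "bdd_borel f" "bdd_borel g" "\<And>x. x \<in> ball p r \<Longrightarrow> f x \<le> g x"
  shows "ball_int p r f \<le> ball_int p r g"
  unfolding ball_int_def
  by (intro integral_mono bdd_borel_integrable assms) (use assms(3) in \<open>auto simp: indicator_def\<close>)

lemma ball_int_nonneg: "(\<And>x. f x \<ge> 0) \<Longrightarrow> ball_int p r f \<ge> 0"
  unfolding ball_int_def by (intro integral_nonneg_AE AE_I2) (simp add: indicator_def)

lemma ball_int_add:
  "bdd_borel f \<Longrightarrow> bdd_borel g \<Longrightarrow> ball_int p r (\<lambda>x. f x + g x) = ball_int p r f + ball_int p r g"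
  unfolding ball_int_def distrib_left
  by (intro Bochner_Integration.integral_add bdd_borel_integrable)

lemma ball_int_cmult: "ball_int p r (\<lambda>x. c * f x) = c * ball_int p r f"
  unfolding ball_int_def by (subst mult.left_commute) simp

lemma ball_int_const: "ball_int p r (\<lambda>x. c) = c * ball_int p r (\<lambda>x. 1)"
  using ball_int_cmult[of p r c "\<lambda>x. 1"] by simp

lemma ball_int_enlarge:
  assumes f: "bdd_borel f" and nn: "\<And>x. f x \<ge> 0" and r: "ball p r \<subseteq> ball p' r'"
  shows "ball_int p r f \<le> ball_int p' r' f"
  unfolding ball_int_def
  by (intro integral_mono bdd_borel_integrable f) (use nn r in \<open>auto simp: indicator_def\<close>)

lemma ball_int_translate:
  "f \<in> borel_measurable borel \<Longrightarrow> ball_int p r (\<lambda>x. f (x + y)) = ball_int (p + y) r f"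
proof -
  assume [measurable]: "f \<in> borel_measurable borel"
  have [measurable]: "ball (p + y) r \<in> sets borel" by simp
  have *: "indicator (ball p r) x = (indicator (ball (p + y) r) (x + y) :: real)" for x
    by (auto simp: indicator_def dist_norm algebra_simps)
  show ?thesis
    unfolding ball_int_def *
    by (rule integral_lborel_translate[of "\<lambda>x. indicator (ball (p + y) r) x * f x" y]) auto
qed

lemma ball_int_translate_le:
  assumes f: "bdd_borel f" and nn: "\<And>x. f x \<ge> 0" and r: "r + norm y \<le> R"
  shows "ball_int p r (\<lambda>x. f (x + y)) \<le> ball_int p R f"
proof -
  have "ball (p + y) r \<subseteq> ball p R"
  proof
    fix x assume "x \<in> ball (p + y) r"
    moreover have "dist p x \<le> dist p (p + y) + dist (p + y) x" by (rule dist_triangle)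
    moreover have "dist p (p + y) = norm y" by (simp add: dist_norm)
    ultimately show "x \<in> ball p R" using r by simp
  qed
  then show ?thesis
    using ball_int_enlarge[OF f nn, of "p + y" r p R] ball_int_translate[of f p r y] f
    by (auto simp: bdd_borel_def)
qed

lemma ball_int_eq_0_iff:
  assumes f: "bdd_borel f" and nn: "\<And>x. f x \<ge> 0"
  shows "ball_int p r f = 0 \<longleftrightarrow> (AE x in lborel. x \<in> ball p r \<longrightarrow> f x = 0)"
  unfolding ball_int_def
  by (subst integral_nonneg_eq_0_iff_AE)
     (use nn bdd_borel_integrable[OF f] in \<open>auto simp: indicator_def of_bool_def\<close>)

lemma ball_int_eq_nn_integral:
  assumes f: "bdd_borel f" and nn: "\<And>x. f x \<ge> 0"
  shows "ennreal (ball_int p r f) = (\<integral>\<^sup>+x. indicator (ball p r) x * ennreal (f x) \<partial>lborel)"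
proof -
  have "ennreal (ball_int p r f) = (\<integral>\<^sup>+x. ennreal (indicator (ball p r) x * f x) \<partial>lborel)"
    unfolding ball_int_def
    by (intro nn_integral_eq_integral[symmetric] bdd_borel_integrable f) (use nn in auto)
  also have "\<dots> = (\<integral>\<^sup>+x. indicator (ball p r) x * ennreal (f x) \<partial>lborel)"
    by (intro nn_integral_cong) (auto simp: indicator_def)
  finally show ?thesis .
qed

text \<open>Splitting a translation by \<open>N h\<close> into \<open>N\<close> translations by \<open>h\<close>.\<close>

lemma ball_int_telescope:
  assumes f: "bdd_borel f" and R: "r + real N * norm y \<le> R"
  shows "ball_int p r (\<lambda>x. \<bar>f (x + real N *\<^sub>R y) - f x\<bar>) \<le> real N * ball_int p R (\<lambda>x. \<bar>f (x + y) - f x\<bar>)"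
  using R
proof (induction N)
  case 0
  then show ?case by (simp add: ball_int_def)
next
  case (Suc N)
  have IH: "ball_int p r (\<lambda>x. \<bar>f (x + real N *\<^sub>R y) - f x\<bar>) \<le> real N * ball_int p R (\<lambda>x. \<bar>f (x + y) - f x\<bar>)"
    using Suc.prems by (intro Suc.IH) (smt (verit) norm_ge_zero mult_right_mono of_nat_Suc)
  define g where "g = (\<lambda>x. \<bar>f (x + y) - f x\<bar>)"
  have g: "bdd_borel g" unfolding g_def by (intro bdd_borel_intros f)
  have "ball_int p r (\<lambda>x. \<bar>f (x + real (Suc N) *\<^sub>R y) - f x\<bar>)
     \<le> ball_int p r (\<lambda>x. \<bar>f (x + real N *\<^sub>R y) - f x\<bar> + g (x + real N *\<^sub>R y))"
    by (intro ball_int_mono bdd_borel_intros f g) (auto simp: g_def algebra_simps)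
  also have "\<dots> = ball_int p r (\<lambda>x. \<bar>f (x + real N *\<^sub>R y) - f x\<bar>) + ball_int p r (\<lambda>x. g (x + real N *\<^sub>R y))"
    by (intro ball_int_add bdd_borel_intros f g)
  also have "ball_int p r (\<lambda>x. g (x + real N *\<^sub>R y)) \<le> ball_int p R g"
    using Suc.prems
    by (intro ball_int_translate_le g) (auto simp: g_def algebra_simps intro: order_trans[rotated])
  finally show ?case using IH by (simp add: g_def algebra_simps)
qed

section \<open>Continuity of translations in the mean\<close>

lemma L1_translation_open:
  fixes U :: "'a::euclidean_space set"
  assumes U: "open U" and fin: "emeasure lborel U < \<infinity>" and y: "y \<longlonglongrightarrow> 0"
  shows "(\<lambda>k. \<integral>x. \<bar>indicator U (x + y k) - indicator U x\<bar> \<partial>lborel) \<longlonglongrightarrow> (0::real)"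
proof -
  have [measurable]: "U \<in> sets borel" using U by auto
  define f where "f = (indicator U :: 'a \<Rightarrow> real)"
  have [measurable]: "f \<in> borel_measurable borel" by (simp add: f_def)
  have fi: "integrable lborel f"
    unfolding f_def using fin by (intro integrable_real_indicator) auto
  have fy: "integrable lborel (\<lambda>x. f (x + y k))" for k
    by (rule integrable_lborel_translate[OF fi])
  \<comment> \<open>Only the loss \<open>(f - f(. + y))\<^sup>+\<close> has a pointwise limit; the gain has the same integral.\<close>
  define g where "g = (\<lambda>k x. max 0 (f x - f (x + y k)))"
  have gi: "integrable lborel (g k)" for k
    unfolding g_def by (intro integrable_max Bochner_Integration.integrable_diff fi fy) auto
  have "(\<lambda>k. \<integral>x. g k x \<partial>lborel) \<longlonglongrightarrow> (\<integral>x. 0 \<partial>(lborel :: 'a measure))"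
  proof (rule integral_dominated_convergence[where w = f])
    show "AE x in lborel. (\<lambda>k. g k x) \<longlonglongrightarrow> 0"
    proof (rule AE_I2)
      fix x
      show "(\<lambda>k. g k x) \<longlonglongrightarrow> 0"
      proof (cases "x \<in> U")
        case True
        have "(\<lambda>k. x + y k) \<longlonglongrightarrow> x" using tendsto_add[OF tendsto_const y, of x] by simp
        then have "\<forall>\<^sub>F k in sequentially. x + y k \<in> U"
          using topological_tendstoD[OF _ U True] by blast
        then have "\<forall>\<^sub>F k in sequentially. g k x = 0"
          by eventually_elim (use True in \<open>simp add: g_def f_def\<close>)
        then show ?thesis by (rule tendsto_eventually)
      next
        case False
        then have "g k x = 0" for k by (simp add: g_def f_def indicator_def)
        then show ?thesis by simp
      qed
    qed
    show "AE x in lborel. norm (g k x) \<le> f x" for k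
      by (rule AE_I2) (simp add: g_def f_def indicator_def)
  qed (use fi in \<open>auto simp: g_def\<close>)
  then have lim: "(\<lambda>k. 2 * (\<integral>x. g k x \<partial>lborel)) \<longlonglongrightarrow> 0"
    using tendsto_mult_right_zero by fastforce
  have "(\<integral>x. \<bar>f (x + y k) - f x\<bar> \<partial>lborel) = 2 * (\<integral>x. g k x \<partial>lborel)" for k
  proof -
    have "(\<integral>x. \<bar>f (x + y k) - f x\<bar> \<partial>lborel) = (\<integral>x. 2 * g k x + (f (x + y k) - f x) \<partial>lborel)"
      by (intro Bochner_Integration.integral_cong) (auto simp: g_def max_def abs_if)
    also have "\<dots> = 2 * (\<integral>x. g k x \<partial>lborel) + ((\<integral>x. f (x + y k) \<partial>lborel) - (\<integral>x. f x \<partial>lborel))"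
      using gi fi fy by simp
    also have "(\<integral>x. f (x + y k) \<partial>lborel) = (\<integral>x. f x \<partial>lborel)"
      by (rule integral_lborel_translate) auto
    finally show ?thesis by simp
  qed
  with lim show ?thesis by (simp add: f_def)
qed

text \<open>The class of integrable functions with this property is closed under approximation in \<open>L\<^sup>1\<close>
  (the local fact \<open>approx\<close>), and it contains the indicators of open sets of finite measure.\<close>

lemma L1_translation:
  fixes f :: "'a::euclidean_space \<Rightarrow> real"
  assumes "integrable lborel f" and y: "y \<longlonglongrightarrow> 0"
  shows "(\<lambda>k. \<integral>x. \<bar>f (x + y k) - f x\<bar> \<partial>lborel) \<longlonglongrightarrow> 0"
proof -
  have approx: "(\<lambda>k. \<integral>x. \<bar>f (x + y k) - f x\<bar> \<partial>lborel) \<longlonglongrightarrow> 0"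
    if fi: "integrable lborel f"
      and ap: "\<And>e. e > 0 \<Longrightarrow> \<exists>g. integrable lborel g \<and> (\<integral>x. \<bar>f x - g x\<bar> \<partial>lborel) < e
            \<and> (\<lambda>k. \<integral>x. \<bar>g (x + y k) - g x\<bar> \<partial>lborel) \<longlonglongrightarrow> 0"
    for f :: "'a \<Rightarrow> real"
  proof (rule LIMSEQ_I)
    fix e :: real assume "e > 0"
    then obtain g where gi: "integrable lborel g" and fg: "(\<integral>x. \<bar>f x - g x\<bar> \<partial>lborel) < e / 3"
        and lim: "(\<lambda>k. \<integral>x. \<bar>g (x + y k) - g x\<bar> \<partial>lborel) \<longlonglongrightarrow> 0"
      using ap[of "e / 3"] by auto
    have [measurable]: "f \<in> borel_measurable borel" "g \<in> borel_measurable borel"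
      using fi gi by auto
    obtain K where K: "\<And>k. k \<ge> K \<Longrightarrow> norm ((\<integral>x. \<bar>g (x + y k) - g x\<bar> \<partial>lborel) - 0) < e / 3"
      using LIMSEQ_D[OF lim, of "e / 3"] \<open>e > 0\<close> by auto
    have "norm ((\<integral>x. \<bar>f (x + y k) - f x\<bar> \<partial>lborel) - 0) < e" if "k \<ge> K" for k
    proof -
      have fy: "integrable lborel (\<lambda>x. f (x + y k))" "integrable lborel (\<lambda>x. g (x + y k))"
        using fi gi by (auto intro: integrable_lborel_translate)
      have "(\<integral>x. \<bar>f (x + y k) - f x\<bar> \<partial>lborel)
          \<le> (\<integral>x. \<bar>f (x + y k) - g (x + y k)\<bar> + \<bar>g (x + y k) - g x\<bar> + \<bar>f x - g x\<bar> \<partial>lborel)"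
        by (intro integral_mono) (use fi gi fy in auto)
      also have "\<dots> = (\<integral>x. \<bar>f (x + y k) - g (x + y k)\<bar> \<partial>lborel) + (\<integral>x. \<bar>g (x + y k) - g x\<bar> \<partial>lborel)
           + (\<integral>x. \<bar>f x - g x\<bar> \<partial>lborel)"
        using fi gi fy by simp
      also have "(\<integral>x. \<bar>f (x + y k) - g (x + y k)\<bar> \<partial>lborel) = (\<integral>x. \<bar>f x - g x\<bar> \<partial>lborel)"
        by (rule integral_lborel_translate[of "\<lambda>x. \<bar>f x - g x\<bar>"]) auto
      finally have "(\<integral>x. \<bar>f (x + y k) - f x\<bar> \<partial>lborel) < e"
        using fg K[OF that] by auto
      then show ?thesis by simp
    qed
    then show "\<exists>K. \<forall>k\<ge>K. norm ((\<integral>x. \<bar>f (x + y k) - f x\<bar> \<partial>lborel) - 0) < e" by blast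
  qed
  from assms(1) show ?thesis
  proof (induction f)
    case (base A c)
    have A: "A \<in> sets borel" using base by simp
    show ?case
    proof (rule approx)
      show "integrable lborel (\<lambda>x. indicator A x *\<^sub>R c)" using base by simp
      fix e :: real assume "e > 0"
      then have e': "e / (\<bar>c\<bar> + 1) > 0" by simp
      obtain U where U: "open U" "A \<subseteq> U" "emeasure lborel (U - A) < ennreal (e / (\<bar>c\<bar> + 1))"
        using outer_regular_lborel[OF A e'] by blast
      have "emeasure lborel U \<le> emeasure lborel A + emeasure lborel (U - A)"
        using emeasure_subadditive[of A lborel "U - A"] U A by (simp add: Un_absorb1)
      also have "\<dots> < \<infinity>" using base(2) U(3) by (simp add: ennreal_add_less_top) (meson ennreal_less_top less_trans)
      finally have Uf: "emeasure lborel U < \<infinity>" .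
      have Ui: "integrable lborel (indicator U :: 'a \<Rightarrow> real)"
        using U Uf by (intro integrable_real_indicator) auto
      have "(\<integral>x. \<bar>indicator A x *\<^sub>R c - indicator U x *\<^sub>R c\<bar> \<partial>lborel) = (\<integral>x. indicator (U - A) x *\<^sub>R \<bar>c\<bar> \<partial>lborel)"
        using U(2) by (intro Bochner_Integration.integral_cong) (auto simp: indicator_def)
      also have "\<dots> = measure lborel (U - A) * \<bar>c\<bar>" using U A by simp
      also have "\<dots> \<le> e / (\<bar>c\<bar> + 1) * \<bar>c\<bar>"
        unfolding measure_def using U(3) e'
        by (intro mult_right_mono enn2real_leI) (auto dest: less_imp_le)
      also have "\<dots> < e" using \<open>e > 0\<close> by (simp add: field_simps)
      finally have 1: "(\<integral>x. \<bar>indicator A x *\<^sub>R c - indicator U x *\<^sub>R c\<bar> \<partial>lborel) < e" .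
      have "(\<lambda>k. \<bar>c\<bar> * (\<integral>x. \<bar>indicator U (x + y k) - indicator U x\<bar> \<partial>lborel)) \<longlonglongrightarrow> 0"
        using L1_translation_open[OF U(1) Uf y] tendsto_mult_right_zero by blast
      also have "(\<lambda>k. \<bar>c\<bar> * (\<integral>x. \<bar>indicator U (x + y k) - indicator U x\<bar> \<partial>lborel))
         = (\<lambda>k. \<integral>x. \<bar>indicator U (x + y k) *\<^sub>R c - indicator U x *\<^sub>R c\<bar> \<partial>lborel)"
        by (simp add: right_diff_distrib[symmetric] abs_mult mult.commute[of _ c])
      finally show "\<exists>g. integrable lborel g \<and> (\<integral>x. \<bar>indicator A x *\<^sub>R c - g x\<bar> \<partial>lborel) < e
            \<and> (\<lambda>k. \<integral>x. \<bar>g (x + y k) - g x\<bar> \<partial>lborel) \<longlonglongrightarrow> 0"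
        using 1 Ui by (intro exI[of _ "\<lambda>x. indicator U x *\<^sub>R c"]) auto
    qed
  next
    case (add f g)
    have lim: "(\<lambda>k. (\<integral>x. \<bar>f (x + y k) - f x\<bar> \<partial>lborel) + (\<integral>x. \<bar>g (x + y k) - g x\<bar> \<partial>lborel)) \<longlonglongrightarrow> 0"
      using tendsto_add[OF add.IH] by simp
    have i: "integrable lborel (\<lambda>x. f (x + y k))" "integrable lborel (\<lambda>x. g (x + y k))" for k
      using add.hyps by (auto intro: integrable_lborel_translate)
    show ?case
    proof (rule tendsto_sandwich[OF _ _ tendsto_const lim])
      show "\<forall>\<^sub>F k in sequentially. (\<integral>x. \<bar>f (x + y k) + g (x + y k) - (f x + g x)\<bar> \<partial>lborel)
        \<le> (\<integral>x. \<bar>f (x + y k) - f x\<bar> \<partial>lborel) + (\<integral>x. \<bar>g (x + y k) - g x\<bar> \<partial>lborel)"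
      proof (rule always_eventually, rule allI)
        fix k
        have "(\<integral>x. \<bar>f (x + y k) + g (x + y k) - (f x + g x)\<bar> \<partial>lborel)
           \<le> (\<integral>x. \<bar>f (x + y k) - f x\<bar> + \<bar>g (x + y k) - g x\<bar> \<partial>lborel)"
          by (intro integral_mono) (use i add.hyps in auto)
        also have "\<dots> = (\<integral>x. \<bar>f (x + y k) - f x\<bar> \<partial>lborel) + (\<integral>x. \<bar>g (x + y k) - g x\<bar> \<partial>lborel)"
          using i add.hyps by simp
        finally show "(\<integral>x. \<bar>f (x + y k) + g (x + y k) - (f x + g x)\<bar> \<partial>lborel) \<le> \<dots>" .
      qed
    qed auto
  next
    case (lim f s)
    have conv: "(\<lambda>i. \<integral>x. \<bar>f x - s i x\<bar> \<partial>lborel) \<longlonglongrightarrow> (\<integral>x. 0 \<partial>(lborel :: 'a measure))"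
    proof (rule integral_dominated_convergence[where w = "\<lambda>x. 3 * \<bar>f x\<bar>"])
      show "AE x in lborel. (\<lambda>i. \<bar>f x - s i x\<bar>) \<longlonglongrightarrow> 0"
      proof (rule AE_I2)
        fix x :: 'a
        have "(\<lambda>i. \<bar>f x - s i x\<bar>) \<longlonglongrightarrow> \<bar>f x - f x\<bar>"
          using lim.hyps(2)[of x] by (intro tendsto_intros) auto
        then show "(\<lambda>i. \<bar>f x - s i x\<bar>) \<longlonglongrightarrow> 0" by simp
      qed
      show "AE x in lborel. norm \<bar>f x - s i x\<bar> \<le> 3 * \<bar>f x\<bar>" for i
      proof (rule AE_I2)
        fix x :: 'a
        show "norm \<bar>f x - s i x\<bar> \<le> 3 * \<bar>f x\<bar>"
          using lim.hyps(3)[of x i] by auto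
      qed
    qed (use lim.hyps in auto)
    show ?case
    proof (rule approx[OF lim.hyps(4)])
      fix e :: real assume "e > 0"
      then obtain i where "norm ((\<integral>x. \<bar>f x - s i x\<bar> \<partial>lborel) - (\<integral>x. 0 \<partial>(lborel :: 'a measure))) < e"
        using LIMSEQ_D[OF conv] by blast
      then show "\<exists>g. integrable lborel g \<and> (\<integral>x. \<bar>f x - g x\<bar> \<partial>lborel) < e
            \<and> (\<lambda>k. \<integral>x. \<bar>g (x + y k) - g x\<bar> \<partial>lborel) \<longlonglongrightarrow> 0"
        using lim.hyps(1) lim.IH by (intro exI[of _ "s i"]) auto
    qed
  qed
qed

lemma ball_int_translation_tendsto:
  assumes f: "bdd_borel f" and y: "y \<longlonglongrightarrow> l"
  shows "(\<lambda>k. ball_int p r (\<lambda>x. \<bar>f (x + y k) - f (x + l)\<bar>)) \<longlonglongrightarrow> 0"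
proof -
  obtain B where B: "\<And>k. norm (y k) \<le> B"
    using Bseq_eq_bounded convergent_imp_Bseq y by (metis BseqE convergentI)
  have [measurable]: "f \<in> borel_measurable borel" using f by (simp add: bdd_borel_def)
  \<comment> \<open>cut off \<open>f\<close> outside a ball that contains all the points involved\<close>
  define R where "R = \<bar>r\<bar> + B + norm l"
  define g where "g = (\<lambda>x. indicator (ball p R) x * f x)"
  have gi: "integrable lborel g" unfolding g_def by (rule bdd_borel_integrable[OF f])
  have gl: "integrable lborel (\<lambda>x. g (x + l))" by (rule integrable_lborel_translate[OF gi])
  have gk: "integrable lborel (\<lambda>x. g (x + y k))" for k by (rule integrable_lborel_translate[OF gi])
  have y': "(\<lambda>k. y k - l) \<longlonglongrightarrow> 0" using y by (simp add: LIM_zero)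
  have lim: "(\<lambda>k. \<integral>x. \<bar>g (x + l + (y k - l)) - g (x + l)\<bar> \<partial>lborel) \<longlonglongrightarrow> 0"
    using L1_translation[OF gl y'] by (simp add: algebra_simps)
  have B0: "B \<ge> 0" using B[of 0] norm_ge_zero order_trans by blast
  have inb: "x + z \<in> ball p R" if "x \<in> ball p r" "norm z \<le> B + norm l" for x z
  proof -
    have "dist p (x + z) \<le> dist p x + dist x (x + z)" by (rule dist_triangle)
    moreover have "dist x (x + z) = norm z" by (simp add: dist_norm)
    ultimately show ?thesis using that by (simp add: R_def)
  qed
  show ?thesis
  proof (rule tendsto_sandwich[OF _ _ tendsto_const lim])
    show "\<forall>\<^sub>F k in sequentially. 0 \<le> ball_int p r (\<lambda>x. \<bar>f (x + y k) - f (x + l)\<bar>)"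
      by (intro always_eventually allI ball_int_nonneg) auto
    show "\<forall>\<^sub>F k in sequentially. ball_int p r (\<lambda>x. \<bar>f (x + y k) - f (x + l)\<bar>)
       \<le> (\<integral>x. \<bar>g (x + l + (y k - l)) - g (x + l)\<bar> \<partial>lborel)"
    proof (intro always_eventually allI)
      fix k
      show "ball_int p r (\<lambda>x. \<bar>f (x + y k) - f (x + l)\<bar>)
       \<le> (\<integral>x. \<bar>g (x + l + (y k - l)) - g (x + l)\<bar> \<partial>lborel)"
        unfolding ball_int_def
      proof (intro integral_mono)
        show "integrable lborel (\<lambda>x. indicator (ball p r) x * \<bar>f (x + y k) - f (x + l)\<bar>)"
          by (intro bdd_borel_integrable bdd_borel_intros f)
        show "integrable lborel (\<lambda>x. \<bar>g (x + l + (y k - l)) - g (x + l)\<bar>)"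
          using gl gk[of k] by simp
        fix x
        show "indicator (ball p r) x * \<bar>f (x + y k) - f (x + l)\<bar> \<le> \<bar>g (x + l + (y k - l)) - g (x + l)\<bar>"
        proof (cases "x \<in> ball p r")
          case True
          have "norm (y k) \<le> B + norm l" "norm l \<le> B + norm l"
            using B[of k] B0 norm_ge_zero[of l] by linarith+
          then show ?thesis using True inb[OF True] by (simp add: g_def)
        qed simp
      qed
    qed
  qed
qed

section \<open>Mixed differences vanish\<close>

text \<open>Soft thresholding at level \<open>c\<close>: values in \<open>[-c, c]\<close> are sent to \<open>0\<close>, larger ones are moved
  towards \<open>0\<close> by \<open>c\<close>.\<close>

definition soft :: "real \<Rightarrow> real \<Rightarrow> real" where
  "soft c a = a - max (- c) (min c a)"

lemma soft_close: "c \<ge> 0 \<Longrightarrow> \<bar>a - soft c a\<bar> \<le> c"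
  by (auto simp: soft_def)

lemma soft_zero: "\<bar>a\<bar> \<le> c \<Longrightarrow> soft c a = 0"
  by (auto simp: soft_def)

lemma soft_lipschitz: "c \<ge> 0 \<Longrightarrow> \<bar>soft c a - soft c b\<bar> \<le> \<bar>a - b\<bar>"
  by (auto simp: soft_def max_def min_def)

lemma bdd_borel_soft[bdd_borel_intros]:
  assumes f: "bdd_borel f" and c: "c \<ge> 0" shows "bdd_borel (\<lambda>x. soft c (f x))"
proof -
  obtain C where C: "\<And>x. \<bar>f x\<bar> \<le> C"
    using f by (auto simp: bdd_borel_def)
  have [measurable]: "f \<in> borel_measurable borel" using f by (simp add: bdd_borel_def)
  have "\<bar>soft c (f x)\<bar> \<le> C + c" for x
    using C[of x] soft_close[OF c, of "f x"] by linarith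
  then show ?thesis by (intro bdd_borelI) (auto simp: soft_def)
qed

text \<open>Used in place of the Hoelder inequality: integrated over a ball, it shows that smallness of
  \<open>\<integral> t\<^sup>q\<close> implies smallness of \<open>\<integral> t\<close>.\<close>

lemma le_add_powr:
  fixes t d q :: real
  assumes "t \<ge> 0" "d > 0" "q \<ge> 1"
  shows "t \<le> d + d powr (1 - q) * t powr q"
proof (cases "t \<le> d")
  case False
  then have t: "t > 0" using assms by simp
  have "t = t powr (1 - q) * t powr q" using t by (simp add: powr_add[symmetric])
  also have "\<dots> \<le> d powr (1 - q) * t powr q"
    using False assms by (intro mult_right_mono powr_mono2') auto
  finally show ?thesis using assms by simp
qed (use assms in \<open>simp add: add_increasing2\<close>)

text \<open>If \<open>B \<le> h\<close>, the factor \<open>B\<^bsup>\<tau>2\<^esup>\<close> is at least \<open>B\<^sup>q h\<^bsup>\<tau>2-q\<^esup>\<close> because \<open>\<tau>2 \<le> q\<close>. Otherwise both \<open>A\<close> and \<open>B\<close> are at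
  least \<open>c h\<close>, and \<open>q \<le> \<tau>1 + \<tau>2\<close> is what counts.\<close>

lemma min_powr_le:
  fixes A B c h \<tau>1 \<tau>2 q :: real
  assumes h: "0 < h" and c: "0 < c" "c \<le> 1" and \<tau>: "0 < \<tau>1" "0 < \<tau>2" "\<tau>2 \<le> q" "q \<le> \<tau>1 + \<tau>2" "1 \<le> q"
    and A: "c * h \<le> A" and B: "0 \<le> B"
  shows "min A B powr q \<le> c powr (- (\<tau>1 + \<tau>2)) * h powr (q - (\<tau>1 + \<tau>2)) * (A powr \<tau>1 * B powr \<tau>2)"
proof -
  have ch: "c * h > 0" using h c by simp
  consider "B = 0" | "0 < B" "B \<le> h" | "h < B" using B by linarith
  then show ?thesis
  proof cases
    case 1
    then show ?thesis using A ch by (simp add: min_def)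
  next
    case 2
    have "min A B powr q \<le> B powr q"
      using A ch B \<tau> by (intro powr_mono2) auto
    also have "B powr q = B powr (q - \<tau>2) * B powr \<tau>2" using 2 by (simp add: powr_add[symmetric])
    also have "\<dots> \<le> h powr (q - \<tau>2) * B powr \<tau>2"
      using 2 \<tau> by (intro mult_right_mono powr_mono2) auto
    also have "h powr (q - \<tau>2) = c powr (- \<tau>1) * h powr (q - (\<tau>1 + \<tau>2)) * (c * h) powr \<tau>1"
      using h c by (simp add: powr_mult powr_add[symmetric] field_simps)
    also have "\<dots> * B powr \<tau>2 \<le> c powr (- (\<tau>1 + \<tau>2)) * h powr (q - (\<tau>1 + \<tau>2)) * A powr \<tau>1 * B powr \<tau>2"
      using c h \<tau> A ch by (intro mult_right_mono mult_mono powr_mono2 powr_mono') auto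
    finally show ?thesis by (simp add: mult.assoc)
  next
    case 3
    have m: "c * h \<le> min A B" using 3 A c h by (smt (verit) mult_left_le_one_le)
    have m0: "0 < min A B" using m ch by linarith
    have "min A B powr q = min A B powr (q - (\<tau>1 + \<tau>2)) * (min A B powr \<tau>1 * min A B powr \<tau>2)"
      using m0 by (simp add: powr_add[symmetric])
    also have "\<dots> \<le> (c * h) powr (q - (\<tau>1 + \<tau>2)) * (A powr \<tau>1 * B powr \<tau>2)"
      using m m0 ch \<tau> B by (intro mult_mono powr_mono2' powr_mono2) auto
    also have "(c * h) powr (q - (\<tau>1 + \<tau>2)) = c powr (q - (\<tau>1 + \<tau>2)) * h powr (q - (\<tau>1 + \<tau>2))"
      using c h by (simp add: powr_mult)
    also have "\<dots> * (A powr \<tau>1 * B powr \<tau>2) \<le> c powr (- (\<tau>1 + \<tau>2)) * h powr (q - (\<tau>1 + \<tau>2)) * (A powr \<tau>1 * B powr \<tau>2)"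
      using c \<tau> by (intro mult_right_mono powr_mono') auto
    finally show ?thesis .
  qed
qed

text \<open>The key pointwise estimate. For the four vertices of a rectangle let \<open>a, a'\<close> and \<open>b, b'\<close> be the
  increments of a function along opposite edges. The largest of \<open>\<bar>a\<bar>, \<bar>a'\<bar>\<close> and the largest of
  \<open>\<bar>b\<bar>, \<bar>b'\<bar>\<close> meet at one vertex, and both control the mixed difference \<open>a' - a = b' - b\<close>. The threshold
  is what excludes that the factor \<open>\<bar>a\<bar>\<^sup>\<tau>\<^sup>1\<close> is too small to be of use.\<close>

lemma soft_mixed_difference_le:
  fixes a a' b b' c h \<tau>1 \<tau>2 q :: real
  assumes h: "0 < h" and c: "0 < c" "c \<le> 1" and \<tau>: "0 < \<tau>1" "0 < \<tau>2" "\<tau>2 \<le> q" "q \<le> \<tau>1 + \<tau>2" "1 \<le> q"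
    and eq: "a' - a = b' - b"
  shows "\<bar>soft (c * h) a' - soft (c * h) a\<bar> powr q \<le>
    2 powr q * c powr (- (\<tau>1 + \<tau>2)) * h powr (q - (\<tau>1 + \<tau>2)) *
     (\<bar>a\<bar> powr \<tau>1 * \<bar>b\<bar> powr \<tau>2 + \<bar>a\<bar> powr \<tau>1 * \<bar>b'\<bar> powr \<tau>2
      + \<bar>a'\<bar> powr \<tau>1 * \<bar>b\<bar> powr \<tau>2 + \<bar>a'\<bar> powr \<tau>1 * \<bar>b'\<bar> powr \<tau>2)"
    (is "?L \<le> ?K * ?S")
proof (cases "\<bar>a\<bar> \<le> c * h \<and> \<bar>a'\<bar> \<le> c * h")
  case True
  then show ?thesis by (simp add: soft_zero)
next
  case False
  define A where "A = max \<bar>a\<bar> \<bar>a'\<bar>"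
  define B where "B = max \<bar>b\<bar> \<bar>b'\<bar>"
  have ch: "c * h > 0" using h c by simp
  have A: "c * h \<le> A" using False by (auto simp: A_def)
  have B: "0 \<le> B" by (auto simp: B_def)
  have "\<bar>soft (c * h) a' - soft (c * h) a\<bar> \<le> \<bar>a' - a\<bar>" using ch by (intro soft_lipschitz) auto
  also have "\<dots> \<le> 2 * min A B" using eq unfolding A_def B_def by linarith
  finally have "?L \<le> (2 * min A B) powr q" using \<tau> by (intro powr_mono2) auto
  also have "\<dots> = 2 powr q * min A B powr q" using A B ch by (simp add: powr_mult)
  also have "\<dots> \<le> 2 powr q * (c powr (- (\<tau>1 + \<tau>2)) * h powr (q - (\<tau>1 + \<tau>2)) * (A powr \<tau>1 * B powr \<tau>2))"
    by (intro mult_left_mono min_powr_le h c \<tau> A B) auto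
  also have "\<dots> = ?K * (A powr \<tau>1 * B powr \<tau>2)" by (simp add: mult.assoc)
  also have "\<dots> \<le> ?K * ?S"
  proof (intro mult_left_mono)
    have "A = \<bar>a\<bar> \<or> A = \<bar>a'\<bar>" "B = \<bar>b\<bar> \<or> B = \<bar>b'\<bar>" by (auto simp: A_def B_def max_def)
    then show "A powr \<tau>1 * B powr \<tau>2 \<le> ?S" by auto
  qed simp
  finally show ?thesis .
qed

text \<open>The information extracted from the energy: along the sequence \<open>h\<close> of scales, the integral of the
  product of the two increments is \<open>o(h\<^sup>m)\<close> near \<open>p\<close>, for all choices of signs of the directions.\<close>

definition box_decay ::
  "('a::euclidean_space \<Rightarrow> real) \<Rightarrow> 'a \<Rightarrow> 'a \<Rightarrow> real \<Rightarrow> real \<Rightarrow> real \<Rightarrow> (nat \<Rightarrow> real) \<Rightarrow> 'a \<Rightarrow> real \<Rightarrow> bool" where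
  "box_decay u e1 e2 \<tau>1 \<tau>2 m h p R \<longleftrightarrow> (\<forall>s\<in>{- 1, 1}. \<forall>t\<in>{- 1, 1}.
     (\<lambda>k. ball_int p R (\<lambda>x. \<bar>u (x + (s * h k) *\<^sub>R e1) - u x\<bar> powr \<tau>1 * \<bar>u (x + (t * h k) *\<^sub>R e2) - u x\<bar> powr \<tau>2)
        / h k powr m) \<longlonglongrightarrow> 0)"

lemma box_decay_swap: "box_decay u e1 e2 \<tau>1 \<tau>2 m h p R \<Longrightarrow> box_decay u e2 e1 \<tau>2 \<tau>1 m h p R"
  by (auto simp: box_decay_def mult.commute)

lemma box_decay_uminus1: "box_decay u e1 e2 \<tau>1 \<tau>2 m h p R \<Longrightarrow> box_decay u (- e1) e2 \<tau>1 \<tau>2 m h p R"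
  by (auto simp: box_decay_def)

lemma box_decay_uminus2: "box_decay u e1 e2 \<tau>1 \<tau>2 m h p R \<Longrightarrow> box_decay u e1 (- e2) \<tau>1 \<tau>2 m h p R"
  by (auto simp: box_decay_def)

lemma box_decayD:
  assumes "box_decay u e1 e2 \<tau>1 \<tau>2 m h p R"
  shows "(\<lambda>k. ball_int p R (\<lambda>x. \<bar>u (x + h k *\<^sub>R e1) - u x\<bar> powr \<tau>1 * \<bar>u (x + h k *\<^sub>R e2) - u x\<bar> powr \<tau>2)
        / h k powr m) \<longlonglongrightarrow> 0"
proof -
  have "\<forall>s\<in>{- 1, 1}. \<forall>t\<in>{- 1, 1}.
     (\<lambda>k. ball_int p R (\<lambda>x. \<bar>u (x + (s * h k) *\<^sub>R e1) - u x\<bar> powr \<tau>1 * \<bar>u (x + (t * h k) *\<^sub>R e2) - u x\<bar> powr \<tau>2)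
        / h k powr m) \<longlonglongrightarrow> 0"
    using assms by (simp only: box_decay_def)
  from this[THEN bspec, of 1, THEN bspec, of 1] show ?thesis by simp
qed

text \<open>The thresholded increments \<open>V\<close> in direction \<open>e\<^sub>1\<close> change by \<open>o(h\<^sup>2)\<close> in the mean under a translation by
  \<open>h e\<^sub>2\<close>. The exponent \<open>\<tau>1 + \<tau>2 + q\<close> is exactly what turns the bound on \<open>\<integral> \<bar>\<Delta>V\<bar>\<^sup>q\<close> into \<open>o(h\<^sup>2\<^sup>q)\<close>.\<close>

lemma soft_increment_small:
  fixes u :: "'a::euclidean_space \<Rightarrow> real"
  assumes u: "bdd_borel u" and h: "\<And>k. h k > 0" "h \<longlonglongrightarrow> 0"
    and \<tau>: "0 < \<tau>1" "0 < \<tau>2" "\<tau>2 \<le> q" "q \<le> \<tau>1 + \<tau>2" "1 \<le> q"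
    and bd: "box_decay u e1 e2 \<tau>1 \<tau>2 (\<tau>1 + \<tau>2 + q) h p R"
    and c: "0 < c" "c \<le> 1" and r: "r < R" and \<eta>: "\<eta> > 0"
  shows "\<forall>\<^sub>F k in sequentially. ball_int p r (\<lambda>x.
     \<bar>soft (c * h k) (u (x + h k *\<^sub>R e2 + h k *\<^sub>R e1) - u (x + h k *\<^sub>R e2)) - soft (c * h k) (u (x + h k *\<^sub>R e1) - u x)\<bar>)
     \<le> \<eta> * (h k)\<^sup>2"
proof -
  define vol where "vol = ball_int p r (\<lambda>x. 1)"
  have vol: "vol \<ge> 0" unfolding vol_def by (intro ball_int_nonneg) auto
  define d where "d = \<eta> / (2 * (vol + 1))"
  have d: "d > 0" using \<eta> vol by (simp add: d_def)
  define K where "K = d powr (1 - q) * (2 powr q * c powr (- (\<tau>1 + \<tau>2)))"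
  have K: "K \<ge> 0" by (simp add: K_def)
  define m where "m = \<tau>1 + \<tau>2 + q"
  \<comment> \<open>\<open>G s t\<close> is the product of increments at a vertex from which the edges leave in direction
      \<open>s e\<^sub>1\<close> and \<open>t e\<^sub>2\<close>\<close>
  define G where "G = (\<lambda>s t k x. \<bar>u (x + (s * h k) *\<^sub>R e1) - u x\<bar> powr \<tau>1 * \<bar>u (x + (t * h k) *\<^sub>R e2) - u x\<bar> powr \<tau>2)"
  have Gb[bdd_borel_intros]: "bdd_borel (G s t k)" for s t k
    unfolding G_def using \<tau> by (intro bdd_borel_intros u) auto
  have Gn: "G s t k x \<ge> 0" for s t k x unfolding G_def by simp
  have lim: "(\<lambda>k. ball_int p R (G s t k) / h k powr m) \<longlonglongrightarrow> 0" if "s \<in> {- 1, 1}" "t \<in> {- 1, 1}" for s t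
    using bd that unfolding box_decay_def G_def m_def by blast
  have "(\<lambda>k. K * (ball_int p R (G 1 1 k) / h k powr m + ball_int p R (G (- 1) 1 k) / h k powr m
       + ball_int p R (G 1 (- 1) k) / h k powr m + ball_int p R (G (- 1) (- 1) k) / h k powr m)) \<longlonglongrightarrow> K * (0 + 0 + 0 + 0)"
    by (intro tendsto_intros lim) auto
  then have ev1: "\<forall>\<^sub>F k in sequentially. K * (ball_int p R (G 1 1 k) / h k powr m + ball_int p R (G (- 1) 1 k) / h k powr m
       + ball_int p R (G 1 (- 1) k) / h k powr m + ball_int p R (G (- 1) (- 1) k) / h k powr m) < \<eta> / 2"
    using \<eta> by (intro order_tendstoD(2)) auto
  have "(\<lambda>k. r + (h k * norm e1 + h k * norm e2)) \<longlonglongrightarrow> r + (0 * norm e1 + 0 * norm e2)"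
    by (intro tendsto_intros h)
  then have ev2: "\<forall>\<^sub>F k in sequentially. r + (h k * norm e1 + h k * norm e2) < R"
    using r by (intro order_tendstoD(2)) auto
  from ev1 ev2 show ?thesis
  proof eventually_elim
    case (elim k)
    define y1 where "y1 = h k *\<^sub>R e1"
    define y2 where "y2 = h k *\<^sub>R e2"
    have hk: "h k > 0" by (rule h)
    define V where "V = (\<lambda>x. soft (c * h k) (u (x + y1) - u x))"
    have Vb[bdd_borel_intros]: "bdd_borel V" unfolding V_def using c hk by (intro bdd_borel_intros u) auto
    define S where "S = (\<lambda>x. G 1 1 k x + G (- 1) 1 k (x + y1) + G 1 (- 1) k (x + y2) + G (- 1) (- 1) k (x + (y1 + y2)))"
    have Sb[bdd_borel_intros]: "bdd_borel S" unfolding S_def by (intro bdd_borel_intros)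
    have pt: "\<bar>V (x + y2) - V x\<bar> \<le> (h k)\<^sup>2 * (d + K / h k powr m * S x)" for x
    proof -
      define D where "D = \<bar>V (x + y2) - V x\<bar>"
      define b where "b = u (x + y2) - u x"
      define b' where "b' = u (x + y1 + y2) - u (x + y1)"
      define a where "a = u (x + y1) - u x"
      define a' where "a' = u (x + y1 + y2) - u (x + y2)"
      have D': "D = \<bar>soft (c * h k) a' - soft (c * h k) a\<bar>"
        unfolding D_def V_def a_def a'_def by (simp add: algebra_simps)
      have "D powr q \<le> 2 powr q * c powr (- (\<tau>1 + \<tau>2)) * h k powr (q - (\<tau>1 + \<tau>2)) *
     (\<bar>a\<bar> powr \<tau>1 * \<bar>b\<bar> powr \<tau>2 + \<bar>a\<bar> powr \<tau>1 * \<bar>b'\<bar> powr \<tau>2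
      + \<bar>a'\<bar> powr \<tau>1 * \<bar>b\<bar> powr \<tau>2 + \<bar>a'\<bar> powr \<tau>1 * \<bar>b'\<bar> powr \<tau>2)"
        unfolding D' by (intro soft_mixed_difference_le hk c \<tau>) (auto simp: a_def a'_def b_def b'_def)
      also have "\<bar>a\<bar> powr \<tau>1 * \<bar>b\<bar> powr \<tau>2 + \<bar>a\<bar> powr \<tau>1 * \<bar>b'\<bar> powr \<tau>2
      + \<bar>a'\<bar> powr \<tau>1 * \<bar>b\<bar> powr \<tau>2 + \<bar>a'\<bar> powr \<tau>1 * \<bar>b'\<bar> powr \<tau>2 = S x"
        unfolding S_def G_def a_def a'_def b_def b'_def y1_def[symmetric] y2_def[symmetric]
        by (simp add: algebra_simps abs_minus_commute y1_def y2_def)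
      finally have Dq: "D powr q \<le> 2 powr q * c powr (- (\<tau>1 + \<tau>2)) * h k powr (q - (\<tau>1 + \<tau>2)) * S x" .
      have "D / (h k)\<^sup>2 \<le> d + d powr (1 - q) * (D / (h k)\<^sup>2) powr q"
        using d \<tau> by (intro le_add_powr) (auto simp: D_def)
      also have "(D / (h k)\<^sup>2) powr q = D powr q / h k powr (2 * q)"
        using hk by (simp add: powr_divide D_def powr_powr[symmetric] powr_numeral)
      also have "D powr q / h k powr (2 * q) \<le> 2 powr q * c powr (- (\<tau>1 + \<tau>2)) * h k powr (q - (\<tau>1 + \<tau>2)) * S x / h k powr (2 * q)"
        by (intro divide_right_mono Dq) auto
      also have "\<dots> = 2 powr q * c powr (- (\<tau>1 + \<tau>2)) * S x / h k powr m"
      proof -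
        have "h k powr (q - (\<tau>1 + \<tau>2)) / h k powr (2 * q) = 1 / h k powr m"
          using hk by (simp add: powr_diff[symmetric] m_def powr_minus_divide[symmetric] algebra_simps)
        moreover have "P * X * S / Y = P * S / Z" if "X / Y = 1 / Z" for P X Y S Z :: real
        proof -
          have "P * X * S / Y = P * S * (X / Y)" by simp
          then show ?thesis using that by simp
        qed
        ultimately show ?thesis by blast
      qed
      finally have "D / (h k)\<^sup>2 \<le> d + K / h k powr m * S x"
        by (simp add: K_def mult.assoc mult_left_mono)
      then show ?thesis using hk by (simp add: D_def field_simps)
    qed
    have "ball_int p r (\<lambda>x. \<bar>V (x + y2) - V x\<bar>) \<le> ball_int p r (\<lambda>x. (h k)\<^sup>2 * (d + K / h k powr m * S x))"
      by (intro ball_int_mono bdd_borel_intros pt)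
    also have "\<dots> = (h k)\<^sup>2 * (d * vol + K / h k powr m * ball_int p r S)"
      unfolding ball_int_cmult
      by (subst ball_int_add, (intro bdd_borel_intros)+) (simp only: ball_int_cmult ball_int_const[of p r d] vol_def)
    also have "\<dots> \<le> (h k)\<^sup>2 * \<eta>"
    proof (intro mult_left_mono)
      have "ball_int p r S = ball_int p r (G 1 1 k) + ball_int p r (\<lambda>x. G (- 1) 1 k (x + y1))
         + ball_int p r (\<lambda>x. G 1 (- 1) k (x + y2)) + ball_int p r (\<lambda>x. G (- 1) (- 1) k (x + (y1 + y2)))"
        unfolding S_def by (simp add: ball_int_add bdd_borel_intros)
      also have "\<dots> \<le> ball_int p R (G 1 1 k) + ball_int p R (G (- 1) 1 k)
         + ball_int p R (G 1 (- 1) k) + ball_int p R (G (- 1) (- 1) k)"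
      proof -
        have n1: "norm y1 = h k * norm e1" and n2: "norm y2 = h k * norm e2"
          using hk by (auto simp: y1_def y2_def)
        have n12: "norm (y1 + y2) \<le> h k * norm e1 + h k * norm e2"
          using norm_triangle_ineq[of y1 y2] n1 n2 by simp
        have nn: "norm y1 \<ge> 0" "norm y2 \<ge> 0" by auto
        have "ball_int p r (G 1 1 k) \<le> ball_int p R (G 1 1 k)"
          using r by (intro ball_int_enlarge Gb Gn subset_ball) auto
        moreover have "ball_int p r (\<lambda>x. G (- 1) 1 k (x + y1)) \<le> ball_int p R (G (- 1) 1 k)"
          using elim(2) n1 n2 nn by (intro ball_int_translate_le Gb Gn) linarith
        moreover have "ball_int p r (\<lambda>x. G 1 (- 1) k (x + y2)) \<le> ball_int p R (G 1 (- 1) k)"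
          using elim(2) n1 n2 nn by (intro ball_int_translate_le Gb Gn) linarith
        moreover have "ball_int p r (\<lambda>x. G (- 1) (- 1) k (x + (y1 + y2))) \<le> ball_int p R (G (- 1) (- 1) k)"
          using elim(2) n12 by (intro ball_int_translate_le Gb Gn) linarith
        ultimately show ?thesis by linarith
      qed
      finally have SS: "K / h k powr m * ball_int p r S \<le> K / h k powr m * (ball_int p R (G 1 1 k) + ball_int p R (G (- 1) 1 k)
         + ball_int p R (G 1 (- 1) k) + ball_int p R (G (- 1) (- 1) k))"
        using K by (intro mult_left_mono) auto
      also have "\<dots> = K * (ball_int p R (G 1 1 k) / h k powr m + ball_int p R (G (- 1) 1 k) / h k powr m
       + ball_int p R (G 1 (- 1) k) / h k powr m + ball_int p R (G (- 1) (- 1) k) / h k powr m)"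
        by (simp add: distrib_left add_divide_distrib)
      also have "\<dots> < \<eta> / 2" by (rule elim(1))
      finally have "K / h k powr m * ball_int p r S < \<eta> / 2" .
      moreover have "d * vol \<le> \<eta> / 2"
        using vol \<eta> by (simp add: d_def field_simps)
      ultimately show "d * vol + K / h k powr m * ball_int p r S \<le> \<eta>" by linarith
    qed auto
    finally show ?case
      unfolding V_def y1_def y2_def by (simp add: mult.commute)
  qed
qed

lemma floor_multiple_tendsto:
  fixes h :: "nat \<Rightarrow> real"
  assumes h: "\<And>k. h k > 0" "h \<longlonglongrightarrow> 0" and t: "t \<ge> 0"
  shows "(\<lambda>k. real (nat \<lfloor>t / h k\<rfloor>) * h k) \<longlonglongrightarrow> t"
    and "real (nat \<lfloor>t / h k\<rfloor>) * h k \<le> t"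
proof -
  have le: "real (nat \<lfloor>t / h k\<rfloor>) * h k \<le> t" and ge: "t - h k \<le> real (nat \<lfloor>t / h k\<rfloor>) * h k" for k
  proof -
    have hk: "h k > 0" by (rule h)
    have "t / h k \<ge> 0" using t hk by simp
    then have *: "real (nat \<lfloor>t / h k\<rfloor>) = of_int \<lfloor>t / h k\<rfloor>" by simp
    have "of_int \<lfloor>t / h k\<rfloor> * h k \<le> t / h k * h k" using hk by (intro mult_right_mono) auto
    then show "real (nat \<lfloor>t / h k\<rfloor>) * h k \<le> t" using hk * by simp
    have "t / h k - 1 \<le> of_int \<lfloor>t / h k\<rfloor>" by linarith
    then have "(t / h k - 1) * h k \<le> of_int \<lfloor>t / h k\<rfloor> * h k" using hk by (intro mult_right_mono) auto
    then show "t - h k \<le> real (nat \<lfloor>t / h k\<rfloor>) * h k" using hk * by (simp add: left_diff_distrib)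
  qed
  have low: "(\<lambda>k. t - h k) \<longlonglongrightarrow> t" using tendsto_diff[OF tendsto_const h(2), of t] by simp
  show "(\<lambda>k. real (nat \<lfloor>t / h k\<rfloor>) * h k) \<longlonglongrightarrow> t"
  proof (rule real_tendsto_sandwich[OF _ _ low tendsto_const])
    show "\<forall>\<^sub>F k in sequentially. t - h k \<le> real (nat \<lfloor>t / h k\<rfloor>) * h k"
      by (rule always_eventually, rule allI, rule ge)
    show "\<forall>\<^sub>F k in sequentially. real (nat \<lfloor>t / h k\<rfloor>) * h k \<le> t"
      by (rule always_eventually, rule allI, rule le)
  qed
  show "real (nat \<lfloor>t / h k\<rfloor>) * h k \<le> t" by (rule le)
qed

text \<open>About \<open>t / h\<close> translations by \<open>h e\<^sub>2\<close> add up to one by \<open>t e\<^sub>2\<close>. The changes of \<open>V\<close> then sum to \<open>o(h)\<close>, and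
  removing the threshold costs at most \<open>2 c h\<close> with \<open>c\<close> arbitrarily small.\<close>

lemma increment_along_multiple_small:
  fixes u :: "'a::euclidean_space \<Rightarrow> real"
  assumes u: "bdd_borel u" and h: "\<And>k. h k > 0" "h \<longlonglongrightarrow> 0"
    and \<tau>: "0 < \<tau>1" "0 < \<tau>2" "\<tau>2 \<le> q" "q \<le> \<tau>1 + \<tau>2" "1 \<le> q"
    and bd: "box_decay u e1 e2 \<tau>1 \<tau>2 (\<tau>1 + \<tau>2 + q) h p R"
    and t: "t \<ge> 0" and r: "r + t * norm e2 < R" and \<eta>: "\<eta> > 0"
  defines "y \<equiv> \<lambda>k. (real (nat \<lfloor>t / h k\<rfloor>) * h k) *\<^sub>R e2"
  shows "\<forall>\<^sub>F k in sequentially. ball_int p r (\<lambda>x.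
     \<bar>(u (x + h k *\<^sub>R e1 + y k) - u (x + h k *\<^sub>R e1)) - (u (x + y k) - u x)\<bar>) \<le> \<eta> * h k"
proof -
  define vol where "vol = ball_int p r (\<lambda>x. 1)"
  have vol: "vol \<ge> 0" unfolding vol_def by (intro ball_int_nonneg) auto
  \<comment> \<open>half of \<open>\<eta>\<close> pays for the threshold, half for the increments of the thresholded function\<close>
  define c where "c = min 1 (\<eta> / (4 * (vol + 1)))"
  have c: "0 < c" "c \<le> 1" using vol \<eta> by (auto simp: c_def)
  have cvol: "2 * c * vol \<le> \<eta> / 2"
  proof -
    have "c * vol \<le> \<eta> / (4 * (vol + 1)) * vol" using vol by (intro mult_right_mono) (auto simp: c_def)
    also have "\<dots> \<le> \<eta> / 4" using vol \<eta> by (simp add: field_simps)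
    finally show ?thesis by simp
  qed
  define \<eta>' where "\<eta>' = \<eta> / (2 * (t + 1))"
  have \<eta>': "\<eta>' > 0" using t \<eta> by (simp add: \<eta>'_def)
  show ?thesis
    using soft_increment_small[OF u h \<tau> bd c r \<eta>']
  proof eventually_elim
    case (elim k)
    define N where "N = nat \<lfloor>t / h k\<rfloor>"
    have hk: "h k > 0" by (rule h)
    have N: "real N * h k \<le> t" unfolding N_def by (rule floor_multiple_tendsto(2)[OF h t])
    define y1 where "y1 = h k *\<^sub>R e1"
    define y2 where "y2 = h k *\<^sub>R e2"
    have yk: "y k = real N *\<^sub>R y2" by (simp add: y_def N_def y2_def)
    define V where "V = (\<lambda>x. soft (c * h k) (u (x + y1) - u x))"
    have Vb[bdd_borel_intros]: "bdd_borel V" unfolding V_def using c hk by (intro bdd_borel_intros u) auto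
    have small: "ball_int p (r + t * norm e2) (\<lambda>x. \<bar>V (x + y2) - V x\<bar>) \<le> \<eta>' * (h k)\<^sup>2"
      using elim unfolding V_def y1_def y2_def .
    have pt: "\<bar>(u (x + y1 + y k) - u (x + y1)) - (u (x + y k) - u x)\<bar> \<le> 2 * c * h k + \<bar>V (x + y k) - V x\<bar>" for x
    proof -
      have ch: "c * h k \<ge> 0" using c hk by simp
      have "\<bar>B - A\<bar> \<le> 2 * e + \<bar>sB - sA\<bar>" if "\<bar>A - sA\<bar> \<le> e" "\<bar>B - sB\<bar> \<le> e" for A B sA sB e :: real
        using that by linarith
      from this[OF soft_close[OF ch] soft_close[OF ch]]
      have "\<bar>(u (x + y k + y1) - u (x + y k)) - (u (x + y1) - u x)\<bar> \<le> 2 * (c * h k) + \<bar>V (x + y k) - V x\<bar>"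
        unfolding V_def .
      moreover have "x + y k + y1 = x + y1 + y k" by simp
      ultimately show ?thesis by (simp only:)
    qed
    have "ball_int p r (\<lambda>x. \<bar>(u (x + y1 + y k) - u (x + y1)) - (u (x + y k) - u x)\<bar>)
       \<le> ball_int p r (\<lambda>x. 2 * c * h k + \<bar>V (x + y k) - V x\<bar>)"
      unfolding add.assoc[of _ y1 "y k"] by (intro ball_int_mono bdd_borel_intros u) (use pt in \<open>simp_all add: add.assoc\<close>)
    also have "\<dots> = 2 * c * h k * vol + ball_int p r (\<lambda>x. \<bar>V (x + y k) - V x\<bar>)"
      by (subst ball_int_add, (intro bdd_borel_intros)+) (simp only: ball_int_const[of p r "2 * c * h k"] vol_def)
    also have "ball_int p r (\<lambda>x. \<bar>V (x + y k) - V x\<bar>) \<le> real N * ball_int p (r + t * norm e2) (\<lambda>x. \<bar>V (x + y2) - V x\<bar>)"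
      unfolding yk
    proof (rule ball_int_telescope[OF Vb])
      have "real N * norm y2 = real N * h k * norm e2" using hk by (simp add: y2_def)
      also have "\<dots> \<le> t * norm e2" using N by (intro mult_right_mono) auto
      finally show "r + real N * norm y2 \<le> r + t * norm e2" by simp
    qed
    also have "\<dots> \<le> real N * (\<eta>' * (h k)\<^sup>2)" by (intro mult_left_mono small) auto
    also have "\<dots> = real N * h k * (\<eta>' * h k)" by (simp add: power2_eq_square)
    also have "\<dots> \<le> t * (\<eta>' * h k)" using N \<eta>' hk by (intro mult_right_mono) auto
    also have "\<dots> \<le> \<eta> / 2 * h k"
      using t \<eta> hk by (simp add: \<eta>'_def field_simps)
    finally have "ball_int p r (\<lambda>x. \<bar>(u (x + y1 + y k) - u (x + y1)) - (u (x + y k) - u x)\<bar>)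
        \<le> 2 * c * vol * h k + \<eta> / 2 * h k" by (simp add: mult_ac)
    also have "\<dots> \<le> \<eta> / 2 * h k + \<eta> / 2 * h k"
      using cvol hk by (intro add_right_mono mult_right_mono) auto
    finally show ?case by (simp add: y1_def)
  qed
qed

text \<open>Adding up about \<open>s / h\<close> translations by \<open>h e\<^sub>1\<close> as well, the mixed difference at the fixed increments
  \<open>s e\<^sub>1\<close>, \<open>t e\<^sub>2\<close> is a limit of quantities that are arbitrarily small in the mean.\<close>

lemma mixed_difference_zero_nonneg:
  fixes u :: "'a::euclidean_space \<Rightarrow> real"
  assumes u: "bdd_borel u" and h: "\<And>k. h k > 0" "h \<longlonglongrightarrow> 0"
    and \<tau>: "0 < \<tau>1" "0 < \<tau>2" "\<tau>2 \<le> q" "q \<le> \<tau>1 + \<tau>2" "1 \<le> q"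
    and bd: "box_decay u e1 e2 \<tau>1 \<tau>2 (\<tau>1 + \<tau>2 + q) h p R"
    and s: "s \<ge> 0" and t: "t \<ge> 0" and r: "r + s * norm e1 + t * norm e2 < R"
  shows "AE x in lborel. x \<in> ball p r \<longrightarrow> u (x + s *\<^sub>R e1 + t *\<^sub>R e2) - u (x + s *\<^sub>R e1) = u (x + t *\<^sub>R e2) - u x"
proof -
  define y where "y = (\<lambda>k. (real (nat \<lfloor>t / h k\<rfloor>) * h k) *\<^sub>R e2)"
  define z where "z = (\<lambda>k. (real (nat \<lfloor>s / h k\<rfloor>) * h k) *\<^sub>R e1)"
  define W where "W = (\<lambda>y z x. (u (x + (z + y)) - u (x + z)) - (u (x + y) - u x))"
  have Wb[bdd_borel_intros]: "bdd_borel (W y z)" for y z unfolding W_def by (intro bdd_borel_intros u)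
  have y: "y \<longlonglongrightarrow> t *\<^sub>R e2" unfolding y_def by (intro tendsto_intros floor_multiple_tendsto h t)
  have z: "z \<longlonglongrightarrow> s *\<^sub>R e1" unfolding z_def by (intro tendsto_intros floor_multiple_tendsto h s)
  have zy: "(\<lambda>k. z k + y k) \<longlonglongrightarrow> s *\<^sub>R e1 + t *\<^sub>R e2" by (intro tendsto_add y z)
  let ?Y = "t *\<^sub>R e2" and ?Z = "s *\<^sub>R e1"
  have Wk: "\<forall>\<^sub>F k in sequentially. ball_int p r (\<lambda>x. \<bar>W (y k) (z k) x\<bar>) \<le> s * \<eta>" if \<eta>: "\<eta> > 0" for \<eta>
    using increment_along_multiple_small[OF u h \<tau> bd t _ \<eta>, of "r + s * norm e1", OF r]
  proof eventually_elim
    case (elim k)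
    define M where "M = nat \<lfloor>s / h k\<rfloor>"
    have hk: "h k > 0" by (rule h)
    have M: "real M * h k \<le> s" unfolding M_def by (rule floor_multiple_tendsto(2)[OF h s])
    have zk: "z k = real M *\<^sub>R (h k *\<^sub>R e1)" by (simp add: z_def M_def)
    define f where "f = (\<lambda>x. u (x + y k) - u x)"
    have fb: "bdd_borel f" unfolding f_def by (intro bdd_borel_intros u)
    have "ball_int p r (\<lambda>x. \<bar>W (y k) (z k) x\<bar>) = ball_int p r (\<lambda>x. \<bar>f (x + real M *\<^sub>R (h k *\<^sub>R e1)) - f x\<bar>)"
      unfolding W_def f_def zk[symmetric] by (simp add: add.assoc)
    also have "\<dots> \<le> real M * ball_int p (r + s * norm e1) (\<lambda>x. \<bar>f (x + h k *\<^sub>R e1) - f x\<bar>)"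
    proof (rule ball_int_telescope[OF fb])
      have "real M * norm (h k *\<^sub>R e1) = real M * h k * norm e1" using hk by simp
      also have "\<dots> \<le> s * norm e1" using M by (intro mult_right_mono) auto
      finally show "r + real M * norm (h k *\<^sub>R e1) \<le> r + s * norm e1" by simp
    qed
    also have "\<dots> \<le> real M * (\<eta> * h k)"
      using elim by (intro mult_left_mono) (auto simp: f_def y_def)
    also have "\<dots> = real M * h k * \<eta>" by simp
    also have "\<dots> \<le> s * \<eta>" using M \<eta> by (intro mult_right_mono) auto
    finally show ?case .
  qed
  have "ball_int p r (\<lambda>x. \<bar>W ?Y ?Z x\<bar>) \<le> 0 + \<epsilon>" if "\<epsilon> > 0" for \<epsilon>
  proof -
    define \<eta> where "\<eta> = \<epsilon> / (2 * (s + 1))"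
    have \<eta>: "\<eta> > 0" using that s by (simp add: \<eta>_def)
    have s\<eta>: "s * \<eta> \<le> \<epsilon> / 2" using s that by (simp add: \<eta>_def field_simps)
    define E where "E = (\<lambda>k. ball_int p r (\<lambda>x. \<bar>u (x + (z k + y k)) - u (x + (?Z + ?Y))\<bar>)
       + ball_int p r (\<lambda>x. \<bar>u (x + z k) - u (x + ?Z)\<bar>) + ball_int p r (\<lambda>x. \<bar>u (x + y k) - u (x + ?Y)\<bar>))"
    have "E \<longlonglongrightarrow> 0 + 0 + 0"
      unfolding E_def by (intro tendsto_add ball_int_translation_tendsto u y z zy)
    then have "\<forall>\<^sub>F k in sequentially. E k < \<epsilon> / 2"
      using that by (intro order_tendstoD(2)) auto
    with Wk[OF \<eta>] have "\<forall>\<^sub>F k in sequentially. E k < \<epsilon> / 2 \<and> ball_int p r (\<lambda>x. \<bar>W (y k) (z k) x\<bar>) \<le> s * \<eta>"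
      by eventually_elim auto
    then obtain k where k: "E k < \<epsilon> / 2" "ball_int p r (\<lambda>x. \<bar>W (y k) (z k) x\<bar>) \<le> s * \<eta>"
      using eventually_happens by force
    have "ball_int p r (\<lambda>x. \<bar>W ?Y ?Z x\<bar>) \<le> ball_int p r (\<lambda>x. \<bar>W (y k) (z k) x\<bar> + (\<bar>u (x + (z k + y k)) - u (x + (?Z + ?Y))\<bar>
       + \<bar>u (x + z k) - u (x + ?Z)\<bar> + \<bar>u (x + y k) - u (x + ?Y)\<bar>))"
      by (intro ball_int_mono bdd_borel_intros u) (auto simp: W_def)
    also have "\<dots> = ball_int p r (\<lambda>x. \<bar>W (y k) (z k) x\<bar>) + E k"
      unfolding E_def by (simp add: ball_int_add bdd_borel_intros u)
    finally show ?thesis using k s\<eta> by linarith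
  qed
  then have "ball_int p r (\<lambda>x. \<bar>W ?Y ?Z x\<bar>) \<le> 0" by (rule field_le_epsilon)
  then have "ball_int p r (\<lambda>x. \<bar>W ?Y ?Z x\<bar>) = 0"
    by (intro antisym ball_int_nonneg) auto
  then have "AE x in lborel. x \<in> ball p r \<longrightarrow> \<bar>W ?Y ?Z x\<bar> = 0"
    by (subst (asm) ball_int_eq_0_iff) (auto intro!: bdd_borel_intros)
  then show ?thesis
    by eventually_elim (simp add: W_def add.assoc)
qed

text \<open>The mixed difference is symmetric in the two directions, so it suffices that the smaller of the
  two exponents is at most \<open>q\<close>; negative \<open>s\<close> and \<open>t\<close> are covered by changing signs of \<open>e\<^sub>1\<close> and \<open>e\<^sub>2\<close>.\<close>

lemma mixed_difference_zero:
  fixes u :: "'a::euclidean_space \<Rightarrow> real"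
  assumes u: "bdd_borel u" and h: "\<And>k. h k > 0" "h \<longlonglongrightarrow> 0"
    and \<tau>: "0 < \<tau>1" "0 < \<tau>2" "min \<tau>1 \<tau>2 \<le> q" "q \<le> \<tau>1 + \<tau>2" "1 \<le> q"
    and bd: "box_decay u e1 e2 \<tau>1 \<tau>2 (\<tau>1 + \<tau>2 + q) h p R"
    and r: "r + \<bar>s\<bar> * norm e1 + \<bar>t\<bar> * norm e2 < R"
  shows "AE x in lborel. x \<in> ball p r \<longrightarrow> u (x + s *\<^sub>R e1 + t *\<^sub>R e2) - u (x + s *\<^sub>R e1) = u (x + t *\<^sub>R e2) - u x"
proof -
  define f1 where "f1 = sgn s *\<^sub>R e1"
  define f2 where "f2 = sgn t *\<^sub>R e2"
  have s: "s *\<^sub>R e1 = \<bar>s\<bar> *\<^sub>R f1" and t: "t *\<^sub>R e2 = \<bar>t\<bar> *\<^sub>R f2"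
    by (simp_all add: f1_def f2_def abs_mult_sgn)
  consider "s = 0" | "t = 0" | "s \<noteq> 0" "t \<noteq> 0" by auto
  then show ?thesis
  proof cases
    case 3
    have bd': "box_decay u f1 f2 \<tau>1 \<tau>2 (\<tau>1 + \<tau>2 + q) h p R"
      using bd box_decay_uminus1[OF bd] box_decay_uminus2[OF bd] box_decay_uminus2[OF box_decay_uminus1[OF bd]]
      using 3 by (auto simp: f1_def f2_def sgn_if)
    have n: "norm f1 = norm e1" "norm f2 = norm e2" using 3 by (auto simp: f1_def f2_def sgn_if)
    show ?thesis
    proof (cases "\<tau>2 \<le> q")
      case True
      show ?thesis unfolding s t
        by (intro mixed_difference_zero_nonneg[OF u h \<tau>(1,2) True \<tau>(4,5) bd']) (use r n in auto)
    next
      case False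
      then have 1: "\<tau>1 \<le> q" using \<tau> by auto
      have 2: "q \<le> \<tau>2 + \<tau>1" using \<tau> by auto
      have bd'': "box_decay u f2 f1 \<tau>2 \<tau>1 (\<tau>2 + \<tau>1 + q) h p R"
        using box_decay_swap[OF bd'] by (simp add: add.commute)
      have "AE x in lborel. x \<in> ball p r \<longrightarrow> u (x + \<bar>t\<bar> *\<^sub>R f2 + \<bar>s\<bar> *\<^sub>R f1) - u (x + \<bar>t\<bar> *\<^sub>R f2) = u (x + \<bar>s\<bar> *\<^sub>R f1) - u x"
        by (intro mixed_difference_zero_nonneg[OF u h \<tau>(2,1) 1 2 \<tau>(5) bd'']) (use r n in auto)
      then show ?thesis unfolding s t
        by eventually_elim (auto simp: add_ac)
    qed
  qed auto
qed

section \<open>One of the two increments vanishes\<close>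

text \<open>If \<open>u\<close> is not invariant in direction \<open>e\<close>, its increments at scale \<open>h\<close> are in the mean at least of
  order \<open>h\<close>, since about \<open>s / h\<close> of them add up to a fixed increment. The bound on \<open>u\<close> makes increments
  at most \<open>1\<close>, so that the exponent \<open>\<tau>\<close> may be replaced by the larger \<open>q\<close>.\<close>

lemma increment_lower_bound:
  fixes u :: "'a::euclidean_space \<Rightarrow> real"
  assumes u: "bdd_borel u" and u1: "\<And>x. \<bar>u x\<bar> \<le> 1 / 2" and h: "\<And>k. h k > 0" "h \<longlonglongrightarrow> 0"
    and \<tau>: "0 < \<tau>" "\<tau> \<le> q" "1 \<le> q"
    and s: "s \<ge> 0" "s * norm e < r"
    and ne: "\<not> (AE x in lborel. x \<in> ball p r \<longrightarrow> u (x + s *\<^sub>R e) = u x)"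
  shows "\<exists>c>0. \<forall>\<^sub>F k in sequentially. c * h k powr q \<le> ball_int p (2 * r) (\<lambda>x. \<bar>u (x + h k *\<^sub>R e) - u x\<bar> powr \<tau>)"
proof -
  define \<alpha> where "\<alpha> = ball_int p r (\<lambda>x. \<bar>u (x + s *\<^sub>R e) - u x\<bar>)"
  have "\<alpha> \<noteq> 0"
    unfolding \<alpha>_def using ne by (subst ball_int_eq_0_iff) (auto intro!: bdd_borel_intros u)
  moreover have "\<alpha> \<ge> 0" unfolding \<alpha>_def by (intro ball_int_nonneg) auto
  ultimately have \<alpha>: "\<alpha> > 0" by simp
  have s0: "s > 0" using s(1) ne by (cases "s = 0") auto
  define vol where "vol = ball_int p (2 * r) (\<lambda>x. 1)"
  have vol: "vol \<ge> 0" unfolding vol_def by (intro ball_int_nonneg) auto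
  \<comment> \<open>\<open>\<kappa> h\<close> is the lower bound for the integral of the increments; \<open>\<mu> h\<close> is the additive error in the
      inequality \<open>t \<le> d + d\<^bsup>1-q\<^esup> t\<^sup>q\<close>, small enough to be absorbed\<close>
  define \<kappa> where "\<kappa> = \<alpha> / (2 * s)"
  have \<kappa>: "\<kappa> > 0" using \<alpha> s0 by (simp add: \<kappa>_def)
  define \<mu> where "\<mu> = \<kappa> / (2 * (vol + 1))"
  have \<mu>: "\<mu> > 0" using \<kappa> vol by (simp add: \<mu>_def)
  have \<mu>vol: "\<mu> * vol \<le> \<kappa> / 2" using \<kappa> vol by (simp add: \<mu>_def field_simps)
  define z where "z = (\<lambda>k. (real (nat \<lfloor>s / h k\<rfloor>) * h k) *\<^sub>R e)"
  have z: "z \<longlonglongrightarrow> s *\<^sub>R e" unfolding z_def by (intro tendsto_intros floor_multiple_tendsto h s)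
  have "\<forall>\<^sub>F k in sequentially. ball_int p r (\<lambda>x. \<bar>u (x + z k) - u (x + s *\<^sub>R e)\<bar>) < \<alpha> / 2"
    using \<alpha> by (intro order_tendstoD(2)[OF ball_int_translation_tendsto[OF u z]]) auto
  then have "\<forall>\<^sub>F k in sequentially. \<mu> powr (q - 1) * (\<kappa> / 2) * h k powr q \<le> ball_int p (2 * r) (\<lambda>x. \<bar>u (x + h k *\<^sub>R e) - u x\<bar> powr \<tau>)"
  proof eventually_elim
    case (elim k)
    define M where "M = nat \<lfloor>s / h k\<rfloor>"
    have hk: "h k > 0" by (rule h)
    have M: "real M * h k \<le> s" unfolding M_def by (rule floor_multiple_tendsto(2)[OF h s(1)])
    have zk: "z k = real M *\<^sub>R (h k *\<^sub>R e)" by (simp add: z_def M_def)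
    define I where "I = ball_int p (2 * r) (\<lambda>x. \<bar>u (x + h k *\<^sub>R e) - u x\<bar>)"
    define J where "J = ball_int p (2 * r) (\<lambda>x. \<bar>u (x + h k *\<^sub>R e) - u x\<bar> powr q)"
    have I0: "I \<ge> 0" unfolding I_def by (intro ball_int_nonneg) auto
    have "\<alpha> \<le> ball_int p r (\<lambda>x. \<bar>u (x + z k) - u (x + s *\<^sub>R e)\<bar> + \<bar>u (x + z k) - u x\<bar>)"
      unfolding \<alpha>_def by (intro ball_int_mono bdd_borel_intros u) auto
    also have "\<dots> = ball_int p r (\<lambda>x. \<bar>u (x + z k) - u (x + s *\<^sub>R e)\<bar>) + ball_int p r (\<lambda>x. \<bar>u (x + z k) - u x\<bar>)"
      by (intro ball_int_add bdd_borel_intros u)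
    also have "ball_int p r (\<lambda>x. \<bar>u (x + z k) - u x\<bar>) \<le> real M * I"
      unfolding I_def zk
    proof (rule ball_int_telescope[OF u])
      have "real M * norm (h k *\<^sub>R e) = real M * h k * norm e" using hk by simp
      also have "\<dots> \<le> s * norm e" using M by (intro mult_right_mono) auto
      finally show "r + real M * norm (h k *\<^sub>R e) \<le> 2 * r" using s by simp
    qed
    finally have "\<alpha> / 2 \<le> real M * I" using elim by linarith
    then have "\<alpha> / 2 * h k \<le> real M * I * h k" using hk by (intro mult_right_mono) auto
    also have "\<dots> = real M * h k * I" by simp
    also have "\<dots> \<le> s * I" using M I0 by (intro mult_right_mono) auto
    finally have Ilow: "\<kappa> * h k \<le> I" using s0 by (simp add: \<kappa>_def field_simps)
    have d: "\<mu> * h k > 0" using \<mu> hk by simp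
    have "I \<le> ball_int p (2 * r) (\<lambda>x. \<mu> * h k + (\<mu> * h k) powr (1 - q) * \<bar>u (x + h k *\<^sub>R e) - u x\<bar> powr q)"
      unfolding I_def using \<tau> d by (intro ball_int_mono bdd_borel_intros u le_add_powr) auto
    also have "\<dots> = \<mu> * h k * vol + (\<mu> * h k) powr (1 - q) * J"
      unfolding J_def vol_def ball_int_const[of p "2 * r" "\<mu> * h k", symmetric]
        ball_int_cmult[of p "2 * r" "(\<mu> * h k) powr (1 - q)", symmetric]
      using \<tau> by (intro ball_int_add bdd_borel_intros u) auto
    also have "\<mu> * h k * vol = \<mu> * vol * h k" by simp
    also have "\<mu> * vol * h k \<le> \<kappa> / 2 * h k"
      using \<mu>vol hk by (intro mult_right_mono) auto
    finally have "\<kappa> / 2 * h k \<le> (\<mu> * h k) powr (1 - q) * J" using Ilow by simp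
    then have "(\<mu> * h k) powr (q - 1) * (\<kappa> / 2 * h k) \<le> (\<mu> * h k) powr (q - 1) * ((\<mu> * h k) powr (1 - q) * J)"
      by (intro mult_left_mono) auto
    also have "\<dots> = J" using \<mu> hk by (simp add: mult.assoc[symmetric] powr_add[symmetric])
    also have "(\<mu> * h k) powr (q - 1) * (\<kappa> / 2 * h k) = \<mu> powr (q - 1) * (\<kappa> / 2) * (h k powr (q - 1) * h k)"
      using \<mu> hk by (simp add: powr_mult)
    also have "h k powr (q - 1) * h k = h k powr q" using hk by (simp add: powr_diff)
    also have "J \<le> ball_int p (2 * r) (\<lambda>x. \<bar>u (x + h k *\<^sub>R e) - u x\<bar> powr \<tau>)"
      unfolding J_def
    proof (intro ball_int_mono bdd_borel_intros u)
      fix x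
      have "\<bar>u (x + h k *\<^sub>R e) - u x\<bar> \<le> 1" using u1[of x] u1[of "x + h k *\<^sub>R e"] by linarith
      then show "\<bar>u (x + h k *\<^sub>R e) - u x\<bar> powr q \<le> \<bar>u (x + h k *\<^sub>R e) - u x\<bar> powr \<tau>"
        using \<tau> by (cases "u (x + h k *\<^sub>R e) - u x = 0") (auto intro!: powr_mono')
    qed (use \<tau> in auto)
    finally show ?case .
  qed
  moreover have "\<mu> powr (q - 1) * (\<kappa> / 2) > 0" using \<mu> \<kappa> by simp
  ultimately show ?thesis by blast
qed

text \<open>If \<open>\<phi>\<close> does not change under translations by \<open>P d\<close> and \<open>\<psi>\<close> does not change under translations by
  \<open>d - P d\<close>, the integral of \<open>\<phi> \<psi>\<close> dominates the product of the integrals: substitute \<open>d = y - x\<close> in the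
  double integral and move both factors to the point \<open>x + P d\<close>.\<close>

lemma product_of_integrals_le:
  fixes \<phi> \<psi> :: "'a::euclidean_space \<Rightarrow> real"
  assumes \<phi>: "bdd_borel \<phi>" "\<And>x. \<phi> x \<ge> 0" and \<psi>: "bdd_borel \<psi>" "\<And>x. \<psi> x \<ge> 0"
    and P: "\<And>d. norm (P d) \<le> norm d"
    and inv1: "\<And>d. norm d < 2 * r \<Longrightarrow> AE x in lborel. x \<in> ball p r \<longrightarrow> \<phi> (x + P d) = \<phi> x"
    and inv2: "\<And>d. norm d < 2 * r \<Longrightarrow> AE x in lborel. x \<in> ball p r \<longrightarrow> x + d \<in> ball p r \<longrightarrow> \<psi> (x + d) = \<psi> (x + P d)"
  shows "ball_int p r \<phi> * ball_int p r \<psi> \<le> ball_int 0 (2 * r) (\<lambda>x::'a. 1) * ball_int p (3 * r) (\<lambda>x. \<phi> x * \<psi> x)"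
proof -
  have [measurable]: "\<phi> \<in> borel_measurable borel" "\<psi> \<in> borel_measurable borel"
    using \<phi> \<psi> by (auto simp: bdd_borel_def)
  have [measurable]: "ball p r \<in> sets borel" "ball p (3 * r) \<in> sets borel" "ball (0::'a) (2 * r) \<in> sets borel" by simp_all
  define f where "f = (\<lambda>x. indicator (ball p r) x * ennreal (\<phi> x))"
  define g where "g = (\<lambda>x. indicator (ball p r) x * ennreal (\<psi> x))"
  define w where "w = (\<lambda>x. indicator (ball p (3 * r)) x * ennreal (\<phi> x * \<psi> x))"
  have [measurable]: "f \<in> borel_measurable borel" "g \<in> borel_measurable borel" "w \<in> borel_measurable borel"
    by (auto simp: f_def g_def w_def)
  have inner: "(\<integral>\<^sup>+x. f x * g (x + d) \<partial>lborel) \<le> indicator (ball 0 (2 * r)) d * (\<integral>\<^sup>+x. w x \<partial>lborel)" for d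
  proof (cases "norm d < 2 * r")
    case True
    have "(\<integral>\<^sup>+x. f x * g (x + d) \<partial>lborel) \<le> (\<integral>\<^sup>+x. w (x + P d) \<partial>lborel)"
    proof (rule nn_integral_mono_AE)
      from inv1[OF True] inv2[OF True] show "AE x in lborel. f x * g (x + d) \<le> w (x + P d)"
      proof eventually_elim
        case (elim x)
        show ?case
        proof (cases "x \<in> ball p r \<and> x + d \<in> ball p r")
          case in_ball: True
          have "dist p (x + P d) \<le> dist p x + norm (P d)"
            using dist_triangle[of p "x + P d" x] by (simp add: dist_norm)
          then have "x + P d \<in> ball p (3 * r)" using in_ball True P[of d] by auto
          then show ?thesis using elim in_ball \<phi> \<psi> by (simp add: f_def g_def w_def ennreal_mult)
        qed (auto simp: f_def g_def)
      qed
    qed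
    also have "\<dots> = (\<integral>\<^sup>+x. w x \<partial>lborel)" by (rule nn_integral_lborel_translate) auto
    finally show ?thesis using True by simp
  next
    case False
    have "f x * g (x + d) = 0" for x
    proof (cases "x \<in> ball p r \<and> x + d \<in> ball p r")
      case True
      have "norm d \<le> dist p x + dist p (x + d)"
        using dist_triangle3[of x "x + d" p] by (simp add: dist_norm)
      then show ?thesis using True False by auto
    qed (auto simp: f_def g_def)
    then have "(\<integral>\<^sup>+x. f x * g (x + d) \<partial>lborel) = 0" by (simp only: nn_integral_const) simp
    then show ?thesis by simp
  qed
  have "ennreal (ball_int p r \<phi> * ball_int p r \<psi>) = (\<integral>\<^sup>+x. f x \<partial>lborel) * (\<integral>\<^sup>+y. g y \<partial>lborel)"
    using \<phi> \<psi> by (simp add: ennreal_mult ball_int_nonneg ball_int_eq_nn_integral f_def g_def)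
  also have "\<dots> = (\<integral>\<^sup>+x. f x * (\<integral>\<^sup>+y. g y \<partial>lborel) \<partial>lborel)" by (simp add: nn_integral_multc)
  also have "\<dots> = (\<integral>\<^sup>+x. (\<integral>\<^sup>+d. f x * g (x + d) \<partial>lborel) \<partial>lborel)"
  proof (intro nn_integral_cong)
    fix x
    have "(\<integral>\<^sup>+d. g (d + x) \<partial>lborel) = (\<integral>\<^sup>+y. g y \<partial>lborel)" by (rule nn_integral_lborel_translate) auto
    then show "f x * (\<integral>\<^sup>+y. g y \<partial>lborel) = (\<integral>\<^sup>+d. f x * g (x + d) \<partial>lborel)"
      by (subst nn_integral_cmult) (auto simp: add.commute)
  qed
  also have "\<dots> = (\<integral>\<^sup>+d. (\<integral>\<^sup>+x. f x * g (x + d) \<partial>lborel) \<partial>lborel)"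
    by (rule lborel_pair.Fubini'[symmetric]) measurable
  also have "\<dots> \<le> (\<integral>\<^sup>+d. indicator (ball 0 (2 * r)) d * (\<integral>\<^sup>+x. w x \<partial>lborel) \<partial>(lborel :: 'a measure))"
    by (intro nn_integral_mono inner)
  also have "\<dots> = (\<integral>\<^sup>+d. indicator (ball 0 (2 * r)) d \<partial>(lborel :: 'a measure)) * (\<integral>\<^sup>+x. w x \<partial>lborel)"
    by (rule nn_integral_multc) measurable
  also have "\<dots> = ennreal (ball_int 0 (2 * r) (\<lambda>x::'a. 1) * ball_int p (3 * r) (\<lambda>x. \<phi> x * \<psi> x))"
    using \<phi> \<psi> by (simp add: ennreal_mult ball_int_nonneg ball_int_eq_nn_integral w_def bdd_borel_intros)
  finally show ?thesis
    using \<phi> \<psi> by (subst (asm) ennreal_le_iff) (auto intro!: mult_nonneg_nonneg ball_int_nonneg)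
qed

text \<open>If \<open>u\<close> varied in both directions, the two lower bounds and the product inequality would give an
  integral of order \<open>h\<^sup>m\<close> with \<open>m = \<tau>1 + \<tau>2 + q\<close>, against the assumed decay. The vanishing mixed
  differences provide the invariances that the product inequality needs.\<close>

lemma increment_dichotomy_nonneg:
  fixes u :: "'a::euclidean_space \<Rightarrow> real"
  assumes u: "bdd_borel u" and u1: "\<And>x. \<bar>u x\<bar> \<le> 1 / 2" and h: "\<And>k. h k > 0" "h \<longlonglongrightarrow> 0"
    and \<tau>: "0 < \<tau>1" "0 < \<tau>2" "min \<tau>1 \<tau>2 \<le> q" "q \<le> \<tau>1 + \<tau>2" "1 \<le> q"
    and bd: "box_decay u e1 e2 \<tau>1 \<tau>2 (\<tau>1 + \<tau>2 + q) h p (6 * r)" and r: "r > 0"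
    and X: "subspace X1" "subspace X2" "e1 \<in> X1" "e2 \<in> X2"
    and P: "\<And>d. P1 d \<in> X1" "\<And>d. P2 d \<in> X2" "\<And>d. P1 d + P2 d = d" "\<And>d. norm (P1 d) \<le> norm d" "\<And>d. norm (P2 d) \<le> norm d"
    and mixed: "\<And>y1 y2. y1 \<in> X1 \<Longrightarrow> y2 \<in> X2 \<Longrightarrow> norm y1 < 4 * r \<Longrightarrow> norm y2 < 4 * r \<Longrightarrow>
        AE x in lborel. x \<in> ball p (6 * r) \<longrightarrow> u (x + y1 + y2) - u (x + y1) = u (x + y2) - u x"
    and s: "s \<ge> 0" "s * norm e1 < r" and t: "t \<ge> 0" "t * norm e2 < r"
  shows "(AE x in lborel. x \<in> ball p r \<longrightarrow> u (x + s *\<^sub>R e1) = u x) \<or> (AE x in lborel. x \<in> ball p r \<longrightarrow> u (x + t *\<^sub>R e2) = u x)"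
proof (rule ccontr)
  assume "\<not> ?thesis"
  then have n1: "\<not> (AE x in lborel. x \<in> ball p r \<longrightarrow> u (x + s *\<^sub>R e1) = u x)"
    and n2: "\<not> (AE x in lborel. x \<in> ball p r \<longrightarrow> u (x + t *\<^sub>R e2) = u x)" by auto
  \<comment> \<open>give \<open>q\<close> to one of \<open>\<tau>1\<close>, \<open>\<tau>2\<close> that is at most \<open>q\<close>, and \<open>\<tau>1 + \<tau>2\<close> to the other\<close>
  obtain q1 q2 where q: "\<tau>1 \<le> q1" "1 \<le> q1" "\<tau>2 \<le> q2" "1 \<le> q2" "q1 + q2 = \<tau>1 + \<tau>2 + q"
  proof (cases "\<tau>2 \<le> q")
    case True
    then show ?thesis using \<tau> by (intro that[of "\<tau>1 + \<tau>2" q]) auto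
  next
    case False
    then show ?thesis using \<tau> by (intro that[of q "\<tau>1 + \<tau>2"]) auto
  qed
  define m where "m = \<tau>1 + \<tau>2 + q"
  define \<phi> where "\<phi> = (\<lambda>k x. \<bar>u (x + h k *\<^sub>R e1) - u x\<bar> powr \<tau>1)"
  define \<psi> where "\<psi> = (\<lambda>k x. \<bar>u (x + h k *\<^sub>R e2) - u x\<bar> powr \<tau>2)"
  obtain c1 where c1: "c1 > 0" and ev1: "\<forall>\<^sub>F k in sequentially. c1 * h k powr q1 \<le> ball_int p (2 * r) (\<phi> k)"
    using increment_lower_bound[OF u u1 h \<tau>(1) q(1,2) s n1] unfolding \<phi>_def by blast
  obtain c2 where c2: "c2 > 0" and ev2: "\<forall>\<^sub>F k in sequentially. c2 * h k powr q2 \<le> ball_int p (2 * r) (\<psi> k)"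
    using increment_lower_bound[OF u u1 h \<tau>(2) q(3,4) t n2] unfolding \<psi>_def by blast
  define vol where "vol = ball_int 0 (4 * r) (\<lambda>x::'a. 1)"
  have "(\<lambda>k. vol * (ball_int p (6 * r) (\<lambda>x. \<phi> k x * \<psi> k x) / h k powr m)) \<longlonglongrightarrow> vol * 0"
    unfolding \<phi>_def \<psi>_def m_def by (intro tendsto_intros box_decayD bd)
  then have ev3: "\<forall>\<^sub>F k in sequentially. vol * (ball_int p (6 * r) (\<lambda>x. \<phi> k x * \<psi> k x) / h k powr m) < c1 * c2"
    using c1 c2 by (intro order_tendstoD(2)) auto
  have "(\<lambda>k. h k * norm e1) \<longlonglongrightarrow> 0 * norm e1" "(\<lambda>k. h k * norm e2) \<longlonglongrightarrow> 0 * norm e2"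
    by (intro tendsto_intros h)+
  then have ev4: "\<forall>\<^sub>F k in sequentially. h k * norm e1 < r" "\<forall>\<^sub>F k in sequentially. h k * norm e2 < r"
    using r by (auto intro: order_tendstoD(2))
  from ev1 ev2 ev3 ev4 have "\<forall>\<^sub>F k in sequentially. False"
  proof eventually_elim
    case (elim k)
    have hk: "h k > 0" by (rule h)
    have hn: "norm (h k *\<^sub>R e1) < 4 * r" "norm (h k *\<^sub>R e2) < 4 * r" using elim(4,5) hk r by auto
    have e: "h k *\<^sub>R e1 \<in> X1" "h k *\<^sub>R e2 \<in> X2" using X by (auto intro: subspace_scale)
    have "c1 * c2 * h k powr m = (c1 * h k powr q1) * (c2 * h k powr q2)"
      unfolding m_def q(5)[symmetric] by (simp add: powr_add)
    also have "\<dots> \<le> ball_int p (2 * r) (\<phi> k) * ball_int p (2 * r) (\<psi> k)"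
      using elim c1 c2 by (intro mult_mono ball_int_nonneg) (auto simp: \<phi>_def)
    also have "\<dots> \<le> ball_int 0 (2 * (2 * r)) (\<lambda>x::'a. 1) * ball_int p (3 * (2 * r)) (\<lambda>x. \<phi> k x * \<psi> k x)"
    proof (rule product_of_integrals_le[where P = P2])
      show "bdd_borel (\<phi> k)" "bdd_borel (\<psi> k)" unfolding \<phi>_def \<psi>_def using \<tau> by (auto intro!: bdd_borel_intros u)
      show "norm (P2 d) \<le> norm d" for d by (rule P)
      fix d :: 'a assume d: "norm d < 2 * (2 * r)"
      have Pd: "norm (P1 d) < 4 * r" "norm (P2 d) < 4 * r" using P(4,5)[of d] d by linarith+
      have "AE x in lborel. x \<in> ball p (6 * r) \<longrightarrow> u (x + h k *\<^sub>R e1 + P2 d) - u (x + h k *\<^sub>R e1) = u (x + P2 d) - u x"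
        by (intro mixed e P hn Pd)
      then show "AE x in lborel. x \<in> ball p (2 * r) \<longrightarrow> \<phi> k (x + P2 d) = \<phi> k x"
      proof eventually_elim
        case (elim x)
        have comm: "x + h k *\<^sub>R e1 + P2 d = x + P2 d + h k *\<^sub>R e1" by simp
        show ?case
        proof
          assume "x \<in> ball p (2 * r)"
          then have "u (x + P2 d + h k *\<^sub>R e1) - u (x + P2 d) = u (x + h k *\<^sub>R e1) - u x"
            using elim r unfolding comm by (simp add: algebra_simps)
          then show "\<phi> k (x + P2 d) = \<phi> k x" by (simp only: \<phi>_def)
        qed
      qed
      have "AE x in lborel. x \<in> ball p (6 * r) \<longrightarrow> u (x + P1 d + h k *\<^sub>R e2) - u (x + P1 d) = u (x + h k *\<^sub>R e2) - u x"
        by (intro mixed e P hn Pd)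
      from AE_lborel_translate[OF this, of "P2 d"]
      show "AE x in lborel. x \<in> ball p (2 * r) \<longrightarrow> x + d \<in> ball p (2 * r) \<longrightarrow> \<psi> k (x + d) = \<psi> k (x + P2 d)"
      proof eventually_elim
        case (elim x)
        have comm: "x + P2 d + P1 d = x + d" using P(3)[of d] by (simp add: add.assoc add.commute)
        show ?case
        proof (intro impI)
          assume "x \<in> ball p (2 * r)"
          moreover have "dist p (x + P2 d) \<le> dist p x + norm (P2 d)"
            using dist_triangle[of p "x + P2 d" x] by (simp add: dist_norm)
          ultimately have "x + P2 d \<in> ball p (6 * r)" using Pd by auto
          then have "u (x + d + h k *\<^sub>R e2) - u (x + d) = u (x + P2 d + h k *\<^sub>R e2) - u (x + P2 d)"
            using elim unfolding comm by simp
          then show "\<psi> k (x + d) = \<psi> k (x + P2 d)" by (simp only: \<psi>_def)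
        qed
      qed
    qed (auto simp: \<phi>_def \<psi>_def)
    also have "\<dots> = vol * ball_int p (6 * r) (\<lambda>x. \<phi> k x * \<psi> k x)" by (simp add: vol_def)
    finally have "c1 * c2 \<le> vol * (ball_int p (6 * r) (\<lambda>x. \<phi> k x * \<psi> k x) / h k powr m)"
      using hk by (simp add: field_simps)
    then show False using elim(3) by linarith
  qed
  then show False by simp
qed

lemma increment_dichotomy:
  fixes u :: "'a::euclidean_space \<Rightarrow> real"
  assumes u: "bdd_borel u" and u1: "\<And>x. \<bar>u x\<bar> \<le> 1 / 2" and h: "\<And>k. h k > 0" "h \<longlonglongrightarrow> 0"
    and \<tau>: "0 < \<tau>1" "0 < \<tau>2" "min \<tau>1 \<tau>2 \<le> q" "q \<le> \<tau>1 + \<tau>2" "1 \<le> q"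
    and bd: "box_decay u e1 e2 \<tau>1 \<tau>2 (\<tau>1 + \<tau>2 + q) h p (6 * r)" and r: "r > 0"
    and X: "subspace X1" "subspace X2" "e1 \<in> X1" "e2 \<in> X2"
    and P: "\<And>d. P1 d \<in> X1" "\<And>d. P2 d \<in> X2" "\<And>d. P1 d + P2 d = d" "\<And>d. norm (P1 d) \<le> norm d" "\<And>d. norm (P2 d) \<le> norm d"
    and mixed: "\<And>y1 y2. y1 \<in> X1 \<Longrightarrow> y2 \<in> X2 \<Longrightarrow> norm y1 < 4 * r \<Longrightarrow> norm y2 < 4 * r \<Longrightarrow>
        AE x in lborel. x \<in> ball p (6 * r) \<longrightarrow> u (x + y1 + y2) - u (x + y1) = u (x + y2) - u x"
  shows "(\<forall>s. \<bar>s\<bar> * norm e1 < r \<longrightarrow> (AE x in lborel. x \<in> ball p r \<longrightarrow> u (x + s *\<^sub>R e1) = u x)) \<or>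
         (\<forall>t. \<bar>t\<bar> * norm e2 < r \<longrightarrow> (AE x in lborel. x \<in> ball p r \<longrightarrow> u (x + t *\<^sub>R e2) = u x))"
proof -
  have "(AE x in lborel. x \<in> ball p r \<longrightarrow> u (x + s *\<^sub>R e1) = u x) \<or> (AE x in lborel. x \<in> ball p r \<longrightarrow> u (x + t *\<^sub>R e2) = u x)"
    if st: "\<bar>s\<bar> * norm e1 < r" "\<bar>t\<bar> * norm e2 < r" for s t
  proof -
    define f1 where "f1 = sgn s *\<^sub>R e1"
    define f2 where "f2 = sgn t *\<^sub>R e2"
    have s: "s *\<^sub>R e1 = \<bar>s\<bar> *\<^sub>R f1" and t: "t *\<^sub>R e2 = \<bar>t\<bar> *\<^sub>R f2"
      by (simp_all add: f1_def f2_def abs_mult_sgn)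
    consider "s = 0" | "t = 0" | "s \<noteq> 0" "t \<noteq> 0" by auto
    then show ?thesis
    proof cases
      case 3
      have bd': "box_decay u f1 f2 \<tau>1 \<tau>2 (\<tau>1 + \<tau>2 + q) h p (6 * r)"
        using bd box_decay_uminus1[OF bd] box_decay_uminus2[OF bd] box_decay_uminus2[OF box_decay_uminus1[OF bd]]
        using 3 by (auto simp: f1_def f2_def sgn_if)
      have n: "norm f1 = norm e1" "norm f2 = norm e2" using 3 by (auto simp: f1_def f2_def sgn_if)
      have f: "f1 \<in> X1" "f2 \<in> X2" using X by (auto simp: f1_def f2_def intro: subspace_scale)
      show ?thesis unfolding s t
        by (rule increment_dichotomy_nonneg[OF u u1 h \<tau> bd' r X(1,2) f P mixed]) (use st n in auto)
    qed auto
  qed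
  then show ?thesis by blast
qed

section \<open>Local invariance under translations\<close>

lemma AE_lborel_iff_negligible: "(AE x in lborel. P x) \<longleftrightarrow> negligible {x::'a::euclidean_space. \<not> P x}"
proof -
  have "(AE x in lborel. P x) \<longleftrightarrow> (AE x in lebesgue. P x)" by (simp add: AE_completion_iff)
  also have "\<dots> \<longleftrightarrow> {x. \<not> P x} \<in> null_sets lebesgue"
    by (simp add: completion.AE_iff_null_sets)
  finally show ?thesis by (simp add: negligible_iff_null_sets)
qed

lemma AE_lborel_locally:
  fixes P :: "'a::euclidean_space \<Rightarrow> bool"
  assumes "\<And>p. p \<in> S \<Longrightarrow> \<exists>r>0. AE x in lborel. x \<in> ball p r \<longrightarrow> P x"
  shows "AE x in lborel. x \<in> S \<longrightarrow> P x"
  unfolding AE_lborel_iff_negligible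
proof (subst locally_negligible_alt, intro ballI)
  let ?N = "{x. \<not> (x \<in> S \<longrightarrow> P x)}"
  fix p assume "p \<in> ?N"
  then obtain r where r: "r > 0" "negligible {x. \<not> (x \<in> ball p r \<longrightarrow> P x)}"
    using assms[of p] by (auto simp: AE_lborel_iff_negligible)
  have "negligible (?N \<inter> ball p r)" by (rule negligible_subset[OF r(2)]) auto
  then show "\<exists>U. openin (top_of_set ?N) U \<and> p \<in> U \<and> negligible U"
    using r(1) \<open>p \<in> ?N\<close> by (intro exI[of _ "?N \<inter> ball p r"]) (auto simp: openin_open)
qed

lemma subspace_not_negligible:
  fixes S :: "'a::euclidean_space set"
  assumes "subspace S" "\<not> negligible S"
  shows "S = UNIV"
proof -
  have "\<not> dim S < DIM('a)" using assms(2) negligible_lowdim by blast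
  then have "dim S = DIM('a)" using dim_subset_UNIV[of S] by simp
  then have "span S = UNIV" by (simp add: dim_eq_full)
  then show ?thesis using assms(1) by (metis span_eq_iff)
qed

text \<open>The functions \<open>v i\<close> with small index \<open>i\<close> are, near \<open>p\<close>, invariant under small translations in
  direction \<open>y\<close>; the radius is the same for all of them.\<close>

definition inv_dir ::
  "'i::real_normed_vector set \<Rightarrow> ('i \<Rightarrow> 'a::euclidean_space \<Rightarrow> real) \<Rightarrow> 'a \<Rightarrow> 'a \<Rightarrow> bool" where
  "inv_dir I v p y \<longleftrightarrow> (\<exists>\<delta>>0. \<forall>i\<in>I. norm i < \<delta> \<longrightarrow>
     (\<forall>s. \<bar>s\<bar> < \<delta> \<longrightarrow> (AE x in lborel. x \<in> ball p \<delta> \<longrightarrow> v i (x + s *\<^sub>R y) = v i x)))"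

lemma dist_add_le: "dist p (x + y) \<le> dist p x + norm (y::'a::real_normed_vector)"
  using dist_triangle[of p "x + y" x] by (simp add: dist_norm)

lemma inv_dir_scale:
  assumes "inv_dir I v p y" shows "inv_dir I v p (c *\<^sub>R y)"
proof -
  obtain \<delta> where \<delta>: "\<delta> > 0" and inv: "\<And>i s. i \<in> I \<Longrightarrow> norm i < \<delta> \<Longrightarrow> \<bar>s\<bar> < \<delta> \<Longrightarrow>
      AE x in lborel. x \<in> ball p \<delta> \<longrightarrow> v i (x + s *\<^sub>R y) = v i x"
    using assms unfolding inv_dir_def by metis
  define \<epsilon> where "\<epsilon> = \<delta> / (1 + \<bar>c\<bar>)"
  have \<epsilon>: "\<epsilon> > 0" "\<epsilon> \<le> \<delta>" using \<delta> by (auto simp: \<epsilon>_def field_simps)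
  show ?thesis unfolding inv_dir_def
  proof (intro exI[of _ \<epsilon>] conjI \<epsilon> ballI impI allI)
    fix i s assume i: "i \<in> I" "norm i < \<epsilon>" and s: "\<bar>s\<bar> < \<epsilon>"
    have "\<bar>s * c\<bar> \<le> \<bar>s\<bar> * (1 + \<bar>c\<bar>)" by (simp add: abs_mult algebra_simps)
    also have "\<dots> < \<delta>" using s by (simp add: \<epsilon>_def field_simps)
    finally have "AE x in lborel. x \<in> ball p \<delta> \<longrightarrow> v i (x + (s * c) *\<^sub>R y) = v i x"
      using i \<epsilon> by (intro inv) auto
    then show "AE x in lborel. x \<in> ball p \<epsilon> \<longrightarrow> v i (x + s *\<^sub>R c *\<^sub>R y) = v i x"
      by eventually_elim (use \<epsilon> in auto)
  qed
qed

lemma inv_dir_add: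
  assumes "inv_dir I v p y" "inv_dir I v p z" shows "inv_dir I v p (y + z)"
proof -
  obtain \<delta>1 where \<delta>1: "\<delta>1 > 0" and inv1: "\<And>i s. i \<in> I \<Longrightarrow> norm i < \<delta>1 \<Longrightarrow> \<bar>s\<bar> < \<delta>1 \<Longrightarrow>
      AE x in lborel. x \<in> ball p \<delta>1 \<longrightarrow> v i (x + s *\<^sub>R y) = v i x"
    using assms(1) unfolding inv_dir_def by metis
  obtain \<delta>2 where \<delta>2: "\<delta>2 > 0" and inv2: "\<And>i s. i \<in> I \<Longrightarrow> norm i < \<delta>2 \<Longrightarrow> \<bar>s\<bar> < \<delta>2 \<Longrightarrow>
      AE x in lborel. x \<in> ball p \<delta>2 \<longrightarrow> v i (x + s *\<^sub>R z) = v i x"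
    using assms(2) unfolding inv_dir_def by metis
  define \<epsilon> where "\<epsilon> = min \<delta>1 \<delta>2 / (1 + norm y)"
  have n: "1 + norm y \<ge> 1" by simp
  have npos: "1 + norm y > 0" using norm_ge_zero[of y] by linarith
  then have e: "\<epsilon> * (1 + norm y) = min \<delta>1 \<delta>2" using npos by (simp add: \<epsilon>_def)
  have \<epsilon>0: "\<epsilon> > 0" using \<delta>1 \<delta>2 npos unfolding \<epsilon>_def by (intro divide_pos_pos) auto
  have "\<epsilon> * 1 \<le> \<epsilon> * (1 + norm y)" using n \<epsilon>0 by (intro mult_left_mono) auto
  then have \<epsilon>: "\<epsilon> \<le> \<delta>1" "\<epsilon> \<le> \<delta>2" using e by auto
  show ?thesis unfolding inv_dir_def
  proof (intro exI[of _ \<epsilon>] conjI \<epsilon>0 ballI impI allI)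
    fix i s assume i: "i \<in> I" "norm i < \<epsilon>" and s: "\<bar>s\<bar> < \<epsilon>"
    have a1: "AE x in lborel. x \<in> ball p \<delta>1 \<longrightarrow> v i (x + s *\<^sub>R y) = v i x"
      using i s \<epsilon> by (intro inv1) auto
    have "AE x in lborel. x \<in> ball p \<delta>2 \<longrightarrow> v i (x + s *\<^sub>R z) = v i x"
      using i s \<epsilon> by (intro inv2) auto
    from AE_lborel_translate[OF this, of "s *\<^sub>R y"] a1
    show "AE x in lborel. x \<in> ball p \<epsilon> \<longrightarrow> v i (x + s *\<^sub>R (y + z)) = v i x"
    proof eventually_elim
      case (elim x)
      show ?case
      proof
        assume x: "x \<in> ball p \<epsilon>"
        have "norm (s *\<^sub>R y) \<le> \<epsilon> * norm y" using s by (simp add: mult_right_mono)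
        then have "dist p (x + s *\<^sub>R y) < \<epsilon> + \<epsilon> * norm y" using x dist_add_le[of p x "s *\<^sub>R y"] by simp
        then have "x + s *\<^sub>R y \<in> ball p \<delta>2" using e by (simp add: distrib_left)
        then show "v i (x + s *\<^sub>R (y + z)) = v i x" using elim x \<epsilon> by (simp add: algebra_simps)
      qed
    qed
  qed
qed

lemma subspace_inv_dir: "subspace {y. inv_dir I v p y}"
  unfolding subspace_def
proof (intro conjI ballI allI; (unfold mem_Collect_eq)?)
  show "inv_dir I v p 0" unfolding inv_dir_def by (intro exI[of _ 1]) auto
qed (auto intro: inv_dir_add inv_dir_scale)

lemma orthonormal_expansion:
  fixes B :: "'a::euclidean_space set"
  assumes B: "pairwise orthogonal B" "\<And>b. b \<in> B \<Longrightarrow> norm b = 1" "finite B" and y: "y \<in> span B"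
  shows "y = (\<Sum>b\<in>B. (y \<bullet> b) *\<^sub>R b)"
proof -
  obtain c where c: "y = (\<Sum>b\<in>B. c b *\<^sub>R b)" using y B(3) by (auto simp: span_finite)
  have "y \<bullet> b = c b" if "b \<in> B" for b
  proof -
    have "y \<bullet> b = (\<Sum>a\<in>B. c a * (a \<bullet> b))" by (simp add: c inner_sum_left)
    also have "\<dots> = (\<Sum>a\<in>B. if a = b then c b else 0)"
      using B that by (intro sum.cong) (auto simp: pairwise_def orthogonal_def norm_eq_1)
    finally show ?thesis using B(3) that by simp
  qed
  then show ?thesis using c by simp
qed

text \<open>Invariance in the directions of an orthonormal basis gives invariance under all small
  translations in the subspace, with a uniform radius.\<close>

lemma inv_dir_uniform:
  fixes v :: "'i::real_normed_vector \<Rightarrow> 'a::euclidean_space \<Rightarrow> real"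
  assumes X: "subspace X" and inv: "\<And>y. y \<in> X \<Longrightarrow> inv_dir I v p y"
  shows "\<exists>\<delta>>0. \<forall>i\<in>I. norm i < \<delta> \<longrightarrow> (\<forall>y\<in>X. norm y < \<delta> \<longrightarrow> (AE x in lborel. x \<in> ball p \<delta> \<longrightarrow> v i (x + y) = v i x))"
proof -
  obtain B where B: "B \<subseteq> X" "pairwise orthogonal B" "\<And>b. b \<in> B \<Longrightarrow> norm b = 1" "independent B" "span B = X"
    using orthonormal_basis_subspace[OF X] by metis
  have fin: "finite B" using B(4) independent_imp_finite by blast
  have "\<exists>\<delta>>0. \<forall>i\<in>I. norm i < \<delta> \<longrightarrow> (\<forall>c. (\<forall>b\<in>F. \<bar>c b\<bar> < \<delta>) \<longrightarrow>
      (AE x in lborel. x \<in> ball p \<delta> \<longrightarrow> v i (x + (\<Sum>b\<in>F. c b *\<^sub>R b)) = v i x))"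
    if "finite F" "F \<subseteq> B" for F
    using that
  proof (induction F)
    case empty
    show ?case by (intro exI[of _ 1]) auto
  next
    case (insert a F)
    obtain \<delta>1 where \<delta>1: "\<delta>1 > 0" and inv1: "\<And>i c. i \<in> I \<Longrightarrow> norm i < \<delta>1 \<Longrightarrow> (\<And>b. b \<in> F \<Longrightarrow> \<bar>c b\<bar> < \<delta>1) \<Longrightarrow>
        AE x in lborel. x \<in> ball p \<delta>1 \<longrightarrow> v i (x + (\<Sum>b\<in>F. c b *\<^sub>R b)) = v i x"
      using insert.IH insert.prems by (auto simp: Ball_def)
    have a: "a \<in> X" "norm a = 1" using insert.prems B by auto
    obtain \<delta>2 where \<delta>2: "\<delta>2 > 0" and inv2: "\<And>i s. i \<in> I \<Longrightarrow> norm i < \<delta>2 \<Longrightarrow> \<bar>s\<bar> < \<delta>2 \<Longrightarrow>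
        AE x in lborel. x \<in> ball p \<delta>2 \<longrightarrow> v i (x + s *\<^sub>R a) = v i x"
      using inv[OF a(1)] unfolding inv_dir_def by metis
    define \<epsilon> where "\<epsilon> = min \<delta>1 \<delta>2 / 2"
    have \<epsilon>: "\<epsilon> > 0" "2 * \<epsilon> \<le> \<delta>1" "2 * \<epsilon> \<le> \<delta>2" using \<delta>1 \<delta>2 by (auto simp: \<epsilon>_def)
    show ?case
    proof (intro exI[of _ \<epsilon>] conjI \<epsilon> ballI impI allI)
      fix i c assume i: "i \<in> I" "norm i < \<epsilon>" and c: "\<forall>b\<in>insert a F. \<bar>c b\<bar> < \<epsilon>"
      have c1: "\<bar>c b\<bar> < \<delta>1" if "b \<in> F" for b
      proof -
        have "\<bar>c b\<bar> < \<epsilon>" using c that by blast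
        then show ?thesis using \<epsilon> by linarith
      qed
      have c2: "\<bar>c a\<bar> < \<epsilon>" using c by blast
      have "AE x in lborel. x \<in> ball p \<delta>1 \<longrightarrow> v i (x + (\<Sum>b\<in>F. c b *\<^sub>R b)) = v i x"
        using i \<epsilon> c1 by (intro inv1) auto
      from AE_lborel_translate[OF this, of "c a *\<^sub>R a"]
      have a1: "AE x in lborel. x + c a *\<^sub>R a \<in> ball p \<delta>1 \<longrightarrow> v i (x + c a *\<^sub>R a + (\<Sum>b\<in>F. c b *\<^sub>R b)) = v i (x + c a *\<^sub>R a)" .
      have a2: "AE x in lborel. x \<in> ball p \<delta>2 \<longrightarrow> v i (x + c a *\<^sub>R a) = v i x"
        using i \<epsilon> c2 by (intro inv2) auto
      from a1 a2 show "AE x in lborel. x \<in> ball p \<epsilon> \<longrightarrow> v i (x + (\<Sum>b\<in>insert a F. c b *\<^sub>R b)) = v i x"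
      proof eventually_elim
        case (elim x)
        show ?case
        proof
          assume x: "x \<in> ball p \<epsilon>"
          have "dist p (x + c a *\<^sub>R a) < 2 * \<epsilon>" using x dist_add_le[of p x "c a *\<^sub>R a"] a c2 by simp
          then show "v i (x + (\<Sum>b\<in>insert a F. c b *\<^sub>R b)) = v i x"
            using elim x \<epsilon> insert.hyps by (simp add: add.assoc)
        qed
      qed
    qed
  qed
  from this[OF fin order_refl] obtain \<delta> where \<delta>: "\<delta> > 0" and inv': "\<And>i c. i \<in> I \<Longrightarrow> norm i < \<delta> \<Longrightarrow> (\<And>b. b \<in> B \<Longrightarrow> \<bar>c b\<bar> < \<delta>) \<Longrightarrow>
        AE x in lborel. x \<in> ball p \<delta> \<longrightarrow> v i (x + (\<Sum>b\<in>B. c b *\<^sub>R b)) = v i x"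
    by (auto simp: Ball_def)
  show ?thesis
  proof (intro exI[of _ \<delta>] conjI \<delta> ballI impI)
    fix i y assume i: "i \<in> I" "norm i < \<delta>" and y: "y \<in> X" "norm y < \<delta>"
    have ex: "y = (\<Sum>b\<in>B. (y \<bullet> b) *\<^sub>R b)" using B y fin by (intro orthonormal_expansion) auto
    have "\<bar>y \<bullet> b\<bar> < \<delta>" if "b \<in> B" for b
      using Cauchy_Schwarz_ineq2[of y b] B(3)[OF that] y by simp
    then have "AE x in lborel. x \<in> ball p \<delta> \<longrightarrow> v i (x + (\<Sum>b\<in>B. (y \<bullet> b) *\<^sub>R b)) = v i x"
      using i by (intro inv') auto
    then show "AE x in lborel. x \<in> ball p \<delta> \<longrightarrow> v i (x + y) = v i x" using ex by simp
  qed
qed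

text \<open>Along a connected set, local invariance propagates.\<close>

lemma invariance_along_connected:
  fixes v :: "'i::real_normed_vector \<Rightarrow> 'a::euclidean_space \<Rightarrow> real"
  assumes S: "connected S" "a \<in> S" "b \<in> S"
    and loc: "\<And>a. a \<in> S \<Longrightarrow> \<exists>\<delta>>0. \<forall>i\<in>I. norm i < \<delta> \<longrightarrow>
      (\<forall>b\<in>S. dist a b < \<delta> \<longrightarrow> (AE x in lborel. x \<in> ball a \<delta> \<longrightarrow> v i (x + (b - a)) = v i x))"
  shows "\<exists>r>0. \<forall>i\<in>I. norm i < r \<longrightarrow> (AE x in lborel. x \<in> ball a r \<longrightarrow> v i (x + (b - a)) = v i x)"
proof -
  define R where "R = (\<lambda>a b. \<exists>r>0. \<forall>i\<in>I. norm i < r \<longrightarrow> (AE x in lborel. x \<in> ball a r \<longrightarrow> v i (x + (b - a)) = v i x))"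
  have "R a b"
  proof (rule connected_equivalence_relation[OF S])
    fix a b assume "R a b"
    then obtain r where r: "r > 0" and inv: "\<And>i. i \<in> I \<Longrightarrow> norm i < r \<Longrightarrow> AE x in lborel. x \<in> ball a r \<longrightarrow> v i (x + (b - a)) = v i x"
      unfolding R_def by auto
    show "R b a" unfolding R_def
    proof (intro exI[of _ r] conjI r ballI impI)
      fix i assume "i \<in> I" "norm i < r"
      from AE_lborel_translate[OF inv[OF this], of "a - b"]
      show "AE x in lborel. x \<in> ball b r \<longrightarrow> v i (x + (a - b)) = v i x"
        by eventually_elim (auto simp: dist_norm algebra_simps)
    qed
  next
    fix a b c assume "R a b" "R b c"
    then obtain r1 r2 where r: "r1 > 0" "r2 > 0" and
      inv1: "\<And>i. i \<in> I \<Longrightarrow> norm i < r1 \<Longrightarrow> AE x in lborel. x \<in> ball a r1 \<longrightarrow> v i (x + (b - a)) = v i x"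
      and inv2: "\<And>i. i \<in> I \<Longrightarrow> norm i < r2 \<Longrightarrow> AE x in lborel. x \<in> ball b r2 \<longrightarrow> v i (x + (c - b)) = v i x"
      unfolding R_def by auto
    show "R a c" unfolding R_def
    proof (intro exI[of _ "min r1 r2"] conjI ballI impI)
      show "min r1 r2 > 0" using r by simp
      fix i assume i: "i \<in> I" "norm i < min r1 r2"
      have i': "norm i < r1" "norm i < r2" using i by auto
      from AE_lborel_translate[OF inv2[OF i(1) i'(2)], of "b - a"] inv1[OF i(1) i'(1)]
      show "AE x in lborel. x \<in> ball a (min r1 r2) \<longrightarrow> v i (x + (c - a)) = v i x"
        by eventually_elim (auto simp: dist_norm algebra_simps)
    qed
  next
    fix a assume a: "a \<in> S"
    from loc[OF a] obtain \<delta> where \<delta>: "\<delta> > 0" "\<And>i b. i \<in> I \<Longrightarrow> norm i < \<delta> \<Longrightarrow> b \<in> S \<Longrightarrow> dist a b < \<delta> \<Longrightarrow>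
        AE x in lborel. x \<in> ball a \<delta> \<longrightarrow> v i (x + (b - a)) = v i x" by metis
    show "\<exists>T. openin (top_of_set S) T \<and> a \<in> T \<and> (\<forall>x\<in>T. R a x)"
      using \<delta> a by (intro exI[of _ "S \<inter> ball a \<delta>"]) (auto simp: R_def openin_open intro!: exI[of _ \<delta>])
  qed
  then show ?thesis unfolding R_def .
qed

text \<open>Almost every point of a Borel set \<open>W\<close> has another point of \<open>W\<close> on the line through it in
  direction \<open>e\<close>.\<close>

lemma AE_rational_shift:
  fixes W :: "'a::euclidean_space set"
  assumes W[measurable]: "W \<in> sets borel" and e: "e \<noteq> 0"
  shows "AE w in lborel. w \<in> W \<longrightarrow> (\<exists>t. t \<noteq> 0 \<and> w + t *\<^sub>R e \<in> W)"
proof -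
  \<comment> \<open>The points for which no rational \<open>t\<close> works have pairwise disjoint translates by \<open>e / (k + 1)\<close>;
      within a ball there is no room for infinitely many of them.\<close>
  define Z where "Z = {w \<in> W. \<forall>t\<in>\<rat> - {0::real}. w + t *\<^sub>R e \<notin> W}"
  have [measurable]: "Z \<in> sets borel"
  proof -
    have "Z = W \<inter> (\<Inter>t\<in>\<rat> - {0}. {w. w + t *\<^sub>R e \<notin> W})" by (auto simp: Z_def)
    also have "\<dots> \<in> sets borel"
      by (intro sets.Int W sets.countable_INT'') (auto simp: countable_rat)
    finally show ?thesis .
  qed
  have Zn: "emeasure lborel (Z \<inter> ball 0 R) = 0" for R
  proof -
    define T where "T = (\<lambda>k::nat. {x. x - (1 / real (Suc k)) *\<^sub>R e \<in> Z \<inter> ball 0 R})"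
    have [measurable]: "ball (0::'a) R \<in> sets borel" by simp
    have T[measurable]: "T k \<in> sets borel" for k unfolding T_def by measurable
    have disj: "disjoint_family T"
      unfolding disjoint_family_on_def
    proof (intro ballI impI)
      fix j k :: nat assume "j \<noteq> k"
      show "T j \<inter> T k = {}"
      proof (rule ccontr)
        assume "T j \<inter> T k \<noteq> {}"
        then obtain x where x: "x - (1 / real (Suc j)) *\<^sub>R e \<in> Z" "x - (1 / real (Suc k)) *\<^sub>R e \<in> Z"
          by (auto simp: T_def)
        define t where "t = 1 / real (Suc j) - 1 / real (Suc k)"
        have "t \<in> \<rat> - {0}" using \<open>j \<noteq> k\<close> by (auto simp: t_def)
        moreover have "x - (1 / real (Suc j)) *\<^sub>R e + t *\<^sub>R e \<in> W"
          using x(2) by (simp add: t_def Z_def algebra_simps)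
        ultimately show False using x(1) by (auto simp: Z_def)
      qed
    qed
    have Te: "emeasure lborel (T k) = emeasure lborel (Z \<inter> ball 0 R)" for k
    proof -
      have "emeasure lborel (T k) = (\<integral>\<^sup>+x. indicator (T k) x \<partial>lborel)" by simp
      also have "\<dots> = (\<integral>\<^sup>+x. indicator (Z \<inter> ball 0 R) (x + - ((1 / real (Suc k)) *\<^sub>R e)) \<partial>lborel)"
        by (intro nn_integral_cong) (simp add: T_def indicator_def)
      also have "\<dots> = (\<integral>\<^sup>+x. indicator (Z \<inter> ball 0 R) x \<partial>lborel)"
        by (rule nn_integral_lborel_translate) measurable
      finally show ?thesis by simp
    qed
    have sub: "(\<Union>k. T k) \<subseteq> ball 0 (R + norm e)"
    proof
      fix x assume "x \<in> (\<Union>k. T k)"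
      then obtain k where k: "norm (x - (1 / real (Suc k)) *\<^sub>R e) < R" by (auto simp: T_def)
      have "norm ((1 / real (Suc k)) *\<^sub>R e) \<le> norm e" by (simp add: divide_le_eq mult_le_cancel_left1)
      then have "norm x < R + norm e"
        using k norm_triangle_ineq[of "x - (1 / real (Suc k)) *\<^sub>R e" "(1 / real (Suc k)) *\<^sub>R e"] by simp
      then show "x \<in> ball 0 (R + norm e)" by simp
    qed
    have "(\<Sum>k. emeasure lborel (Z \<inter> ball 0 R)) = emeasure lborel (\<Union>k. T k)"
      using disj by (subst suminf_emeasure[symmetric]) (auto simp: Te)
    also have "\<dots> \<le> emeasure lborel (ball (0::'a) (R + norm e))"
      by (intro emeasure_mono sub) auto
    also have "\<dots> < \<infinity>" by (intro emeasure_bounded_finite) auto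
    also have "(\<Sum>k::nat. emeasure lborel (Z \<inter> ball 0 R)) = emeasure lborel (Z \<inter> ball 0 R) * \<infinity>"
      by (subst nn_integral_count_space_nat[symmetric]) simp
    finally show ?thesis by (auto simp: ennreal_mult_top split: if_splits)
  qed
  have "Z = (\<Union>n. Z \<inter> ball 0 (real n))" using reals_Archimedean2 by fastforce
  also have "\<dots> \<in> null_sets lborel"
    using Zn by (intro null_sets_UN) (auto simp: null_sets_def)
  finally have "AE w in lborel. w \<notin> Z" by (rule AE_not_in)
  then show ?thesis
    by eventually_elim (auto simp: Z_def)
qed

section \<open>The orthogonal decomposition\<close>

text \<open>A space split into two orthogonal subspaces; \<open>P1\<close> and \<open>P2\<close> are the orthogonal projections.\<close>

locale orth_split =
  fixes X1 X2 :: "'a::euclidean_space set"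
  assumes sub1: "subspace X1" and sub2: "subspace X2"
    and orth: "\<And>x y. x \<in> X1 \<Longrightarrow> y \<in> X2 \<Longrightarrow> orthogonal x y"
    and sum_UNIV: "X1 + X2 = UNIV"
begin

abbreviation "P1 \<equiv> component X1 X2"
abbreviation "P2 \<equiv> component X2 X1"

lemma inter_zero: "x \<in> X1 \<Longrightarrow> x \<in> X2 \<Longrightarrow> x = 0"
  using orth[of x x] by (simp add: orthogonal_def)

lemma P1_eq: "a \<in> X1 \<Longrightarrow> b \<in> X2 \<Longrightarrow> P1 (a + b) = a"
  unfolding component_def
proof (rule the_equality)
  fix y assume ab: "a \<in> X1" "b \<in> X2" and y: "y \<in> X1 \<and> a + b - y \<in> X2"
  have "a - y = (a + b - y) - b" by simp
  then have "a - y \<in> X2" using subspace_diff[OF sub2] y ab by metis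
  moreover have "a - y \<in> X1" using subspace_diff[OF sub1] y ab by metis
  ultimately show "y = a" using inter_zero[of "a - y"] by simp
qed simp

lemma P2_eq: "a \<in> X1 \<Longrightarrow> b \<in> X2 \<Longrightarrow> P2 (a + b) = b"
  unfolding component_def
proof (rule the_equality)
  fix y assume ab: "a \<in> X1" "b \<in> X2" and y: "y \<in> X2 \<and> a + b - y \<in> X1"
  have "b - y = (a + b - y) - a" by simp
  then have "b - y \<in> X1" using subspace_diff[OF sub1] y ab by metis
  moreover have "b - y \<in> X2" using subspace_diff[OF sub2] y ab by metis
  ultimately show "y = b" using inter_zero[of "b - y"] by simp
qed simp

lemma decompE: obtains a b where "a \<in> X1" "b \<in> X2" "x = a + b"
proof -
  have "x \<in> X1 + X2" by (simp add: sum_UNIV)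
  then show ?thesis using that by (auto elim: set_plus_elim)
qed

lemma P_sum: "P1 x + P2 x = x" and P1_in: "P1 x \<in> X1" and P2_in: "P2 x \<in> X2"
  by (rule decompE[of x]; simp add: P1_eq P2_eq)+

lemma P1_id: "a \<in> X1 \<Longrightarrow> P1 a = a" and P1_zero: "b \<in> X2 \<Longrightarrow> P1 b = 0"
  and P2_id: "b \<in> X2 \<Longrightarrow> P2 b = b" and P2_zero: "a \<in> X1 \<Longrightarrow> P2 a = 0"
  using P1_eq[of a 0] P1_eq[of 0 b] P2_eq[of 0 b] P2_eq[of a 0] subspace_0[OF sub1] subspace_0[OF sub2] by auto

lemma linear_P1: "linear P1"
proof
  fix x y :: 'a and c :: real
  have "x + y = (P1 x + P1 y) + (P2 x + P2 y)" using P_sum[of x] P_sum[of y] by (metis add.assoc add.left_commute)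
  then show "P1 (x + y) = P1 x + P1 y"
    using P1_eq[of "P1 x + P1 y" "P2 x + P2 y"] P1_in P2_in sub1 sub2 by (simp add: subspace_add)
  have "c *\<^sub>R x = c *\<^sub>R P1 x + c *\<^sub>R P2 x" using P_sum[of x] by (metis scaleR_right_distrib)
  then show "P1 (c *\<^sub>R x) = c *\<^sub>R P1 x"
    using P1_eq[of "c *\<^sub>R P1 x" "c *\<^sub>R P2 x"] P1_in P2_in sub1 sub2 by (simp add: subspace_scale)
qed

lemma P2_def': "P2 x = x - P1 x"
  using P_sum[of x] by (simp add: algebra_simps)

lemma linear_P2: "linear P2"
  unfolding P2_def'[abs_def] using linear_P1 by (intro linear_compose_sub linear_id[unfolded id_def])

lemmas P1_simps = linear_add[OF linear_P1] linear_diff[OF linear_P1] linear_scale[OF linear_P1] linear_neg[OF linear_P1]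
lemmas P2_simps = linear_add[OF linear_P2] linear_diff[OF linear_P2] linear_scale[OF linear_P2] linear_neg[OF linear_P2]

lemma norm_P: "norm x ^ 2 = norm (P1 x) ^ 2 + norm (P2 x) ^ 2"
proof -
  have "orthogonal (P1 x) (P2 x)" by (intro orth P1_in P2_in)
  then have "norm (P1 x + P2 x) ^ 2 = norm (P1 x) ^ 2 + norm (P2 x) ^ 2"
    by (rule norm_add_Pythagorean)
  then show ?thesis by (simp add: P_sum)
qed

lemma norm_P1_le: "norm (P1 x) \<le> norm x" and norm_P2_le: "norm (P2 x) \<le> norm x"
proof -
  have "norm (P1 x) ^ 2 \<le> norm x ^ 2" "norm (P2 x) ^ 2 \<le> norm x ^ 2" using norm_P[of x] by simp_all
  then show "norm (P1 x) \<le> norm x" "norm (P2 x) \<le> norm x" by (auto dest: power2_le_imp_le)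
qed

lemma P1_measurable[measurable]: "P1 \<in> borel_measurable borel"
  and P2_measurable[measurable]: "P2 \<in> borel_measurable borel"
  by (rule borel_measurable_continuous_onI, rule linear_continuous_on, rule linear_conv_bounded_linear[THEN iffD1],
      rule linear_P1 linear_P2)+

text \<open>If a relation \<open>Q y\<^sub>1 y\<^sub>2\<close> is linear in each argument and holds at the two components of every point
  of a set that is not negligible, it holds for all \<open>y\<^sub>1 \<in> X\<^sub>1\<close> and \<open>y\<^sub>2 \<in> X\<^sub>2\<close>.\<close>

lemma bilinear_relation_extend:
  assumes Q1: "\<And>z. subspace {y. Q y z}" and Q2: "\<And>y. subspace {z. Q y z}"
    and W: "W \<in> sets borel" "\<not> negligible W" and Q: "\<And>w. w \<in> W \<Longrightarrow> Q (P1 w) (P2 w)"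
    and y: "y1 \<in> X1" "y2 \<in> X2"
  shows "Q y1 y2"
proof (cases "y1 = 0")
  case True
  then show ?thesis using subspace_0[OF Q1[of y2]] by simp
next
  case False
  have "AE w in lborel. w \<in> W \<longrightarrow> Q y1 (P2 w)"
    using AE_rational_shift[OF W(1) False]
  proof eventually_elim
    case (elim w)
    show ?case
    proof
      assume w: "w \<in> W"
      then obtain t where t: "t \<noteq> 0" "w + t *\<^sub>R y1 \<in> W" using elim by blast
      have "Q (P1 w + t *\<^sub>R y1) (P2 w)"
        using Q[OF t(2)] y by (simp add: P1_simps P2_simps P1_id P2_zero)
      then have "Q (P1 w + t *\<^sub>R y1 - P1 w) (P2 w)"
        using subspace_diff[OF Q1[of "P2 w"], of "P1 w + t *\<^sub>R y1" "P1 w"] Q[OF w] by simp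
      then have "Q ((1 / t) *\<^sub>R (t *\<^sub>R y1)) (P2 w)"
        using subspace_scale[OF Q1[of "P2 w"], of "t *\<^sub>R y1" "1 / t"] by simp
      then show "Q y1 (P2 w)" using t by simp
    qed
  qed
  then have neg: "negligible {w. \<not> (w \<in> W \<longrightarrow> Q y1 (P2 w))}" by (simp add: AE_lborel_iff_negligible)
  have "\<not> negligible {w. Q y1 (P2 w)}"
  proof
    assume "negligible {w. Q y1 (P2 w)}"
    then have "negligible ({w. Q y1 (P2 w)} \<union> {w. \<not> (w \<in> W \<longrightarrow> Q y1 (P2 w))})"
      using neg by (intro negligible_Un)
    moreover have "W \<subseteq> {w. Q y1 (P2 w)} \<union> {w. \<not> (w \<in> W \<longrightarrow> Q y1 (P2 w))}" by auto
    ultimately show False using W(2) negligible_subset by blast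
  qed
  moreover have "subspace {w. Q y1 (P2 w)}"
    using linear_subspace_vimage[OF linear_P2 Q2[of y1]] by (simp add: vimage_def)
  ultimately have "{w. Q y1 (P2 w)} = UNIV" by (intro subspace_not_negligible)
  then have "Q y1 (P2 y2)" by blast
  then show ?thesis using y by (simp add: P2_id)
qed

end

section \<open>From local to global structure on a product domain\<close>

text \<open>The set \<open>\<Omega> = \<Omega>\<^sub>1 + \<Omega>\<^sub>2\<close> with non-empty, connected and relatively open factors.\<close>

locale product_domain = orth_split +
  fixes \<Omega>1 \<Omega>2 :: "'a set"
  assumes open1: "openin (top_of_set X1) \<Omega>1" and open2: "openin (top_of_set X2) \<Omega>2"
    and conn1: "connected \<Omega>1" and conn2: "connected \<Omega>2"
    and ne1: "\<Omega>1 \<noteq> {}" and ne2: "\<Omega>2 \<noteq> {}"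
begin

abbreviation "\<Omega> \<equiv> \<Omega>1 + \<Omega>2"

lemma sub\<Omega>1: "a \<in> \<Omega>1 \<Longrightarrow> a \<in> X1" and sub\<Omega>2: "a \<in> \<Omega>2 \<Longrightarrow> a \<in> X2"
  using open1 open2 by (auto dest: openin_imp_subset)

lemma in_\<Omega>: "x \<in> \<Omega> \<longleftrightarrow> P1 x \<in> \<Omega>1 \<and> P2 x \<in> \<Omega>2"
proof
  assume "x \<in> \<Omega>"
  then obtain a b where "a \<in> \<Omega>1" "b \<in> \<Omega>2" "x = a + b" by (auto simp: set_plus_def)
  then show "P1 x \<in> \<Omega>1 \<and> P2 x \<in> \<Omega>2" using sub\<Omega>1 sub\<Omega>2 by (simp add: P1_eq P2_eq)
next
  assume "P1 x \<in> \<Omega>1 \<and> P2 x \<in> \<Omega>2"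
  then show "x \<in> \<Omega>" using P_sum[of x] set_plus_intro[of "P1 x" \<Omega>1 "P2 x" \<Omega>2] by simp
qed

lemma open_\<Omega>: "open \<Omega>"
proof -
  obtain T1 T2 where T: "open T1" "\<Omega>1 = X1 \<inter> T1" "open T2" "\<Omega>2 = X2 \<inter> T2"
    using open1 open2 by (auto simp: openin_open)
  have "\<Omega> = P1 -` T1 \<inter> P2 -` T2" unfolding set_eq_iff in_\<Omega> using T(2,4) P1_in P2_in by blast
  moreover have "open (P1 -` T1)" "open (P2 -` T2)"
    using T linear_P1 linear_P2 by (auto intro!: continuous_open_vimage linear_continuous_at simp: linear_conv_bounded_linear)
  ultimately show ?thesis by auto
qed

lemma \<Omega>_ne: "\<Omega> \<noteq> {}" using ne1 ne2 by (auto simp: set_plus_def)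

text \<open>Mixed differences that vanish near every point vanish globally: first propagate in \<open>\<Omega>\<^sub>1\<close>, for
  all small increments in \<open>X\<^sub>2\<close> at once, then in \<open>\<Omega>\<^sub>2\<close>.\<close>

lemma mixed_difference_global:
  fixes u :: "'a \<Rightarrow> real"
  assumes loc: "\<And>p. p \<in> \<Omega> \<Longrightarrow> \<exists>\<delta>>0. \<forall>y1\<in>X1. \<forall>y2\<in>X2. norm y1 < \<delta> \<longrightarrow> norm y2 < \<delta> \<longrightarrow>
      (AE x in lborel. x \<in> ball p \<delta> \<longrightarrow> u (x + y1 + y2) - u (x + y1) = u (x + y2) - u x)"
    and y: "y1 \<in> X1" "y2 \<in> X2"
  shows "AE x in lborel. x \<in> \<Omega> \<and> x + y1 \<in> \<Omega> \<and> x + y2 \<in> \<Omega> \<longrightarrow> u (x + y1 + y2) - u (x + y1) = u (x + y2) - u x"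
proof -
  have stage1: "\<exists>r>0. \<forall>z\<in>X2. norm z < r \<longrightarrow>
      (AE x in lborel. x \<in> ball (a + c) r \<longrightarrow> u (x + (a' - a) + z) - u (x + (a' - a)) = u (x + z) - u x)"
    if a: "a \<in> \<Omega>1" "a' \<in> \<Omega>1" and c: "c \<in> \<Omega>2" for a a' c
  proof -
    have "\<exists>r>0. \<forall>z\<in>X2. norm z < r \<longrightarrow>
      (AE x in lborel. x \<in> ball (c + a) r \<longrightarrow> (\<lambda>z x. u (x + z) - u x) z (x + ((c + a') - (c + a))) = (\<lambda>z x. u (x + z) - u x) z x)"
    proof (rule invariance_along_connected[where S = "(+) c ` \<Omega>1"])
      show "connected ((+) c ` \<Omega>1)" by (intro connected_continuous_image conn1 continuous_intros)
      fix p assume "p \<in> (+) c ` \<Omega>1"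
      then obtain b where b: "b \<in> \<Omega>1" "p = c + b" by auto
      then have "p \<in> \<Omega>" using c set_plus_intro[of b \<Omega>1 c \<Omega>2] by (simp add: add.commute)
      from loc[OF this] obtain \<delta> where \<delta>: "\<delta> > 0" "\<forall>y1\<in>X1. \<forall>y2\<in>X2. norm y1 < \<delta> \<longrightarrow> norm y2 < \<delta> \<longrightarrow>
        (AE x in lborel. x \<in> ball p \<delta> \<longrightarrow> u (x + y1 + y2) - u (x + y1) = u (x + y2) - u x)" by blast
      show "\<exists>\<delta>>0. \<forall>z\<in>X2. norm z < \<delta> \<longrightarrow> (\<forall>q\<in>(+) c ` \<Omega>1. dist p q < \<delta> \<longrightarrow>
         (AE x in lborel. x \<in> ball p \<delta> \<longrightarrow> u (x + (q - p) + z) - u (x + (q - p)) = u (x + z) - u x))"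
      proof (intro exI[of _ \<delta>] conjI \<delta>(1) ballI impI)
        fix z q assume z: "z \<in> X2" "norm z < \<delta>" and q: "q \<in> (+) c ` \<Omega>1" "dist p q < \<delta>"
        obtain x where "x \<in> \<Omega>1" "q = c + x" using q by auto
        then have "q - p \<in> X1" using b subspace_diff[OF sub1 sub\<Omega>1 sub\<Omega>1, of x b] by simp
        moreover have "norm (q - p) < \<delta>" using q by (simp add: dist_norm norm_minus_commute)
        ultimately show "AE x in lborel. x \<in> ball p \<delta> \<longrightarrow> u (x + (q - p) + z) - u (x + (q - p)) = u (x + z) - u x"
          using z by (intro \<delta>(2)[rule_format]) auto
      qed
    qed (use a in auto)
    then show ?thesis by (simp add: add.commute[of c])
  qed
  have stage2: "\<exists>r>0. AE x in lborel. x \<in> ball (a + c) r \<longrightarrow> u (x + (c' - c) + (a' - a)) - u (x + (c' - c)) = u (x + (a' - a)) - u x"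
    if a: "a \<in> \<Omega>1" "a' \<in> \<Omega>1" and c: "c \<in> \<Omega>2" "c' \<in> \<Omega>2" for a a' c c'
  proof -
    have "\<exists>r>0. \<forall>i\<in>{0::real}. norm i < r \<longrightarrow>
      (AE x in lborel. x \<in> ball (a + c) r \<longrightarrow> (\<lambda>i x. u (x + (a' - a)) - u x) i (x + ((a + c') - (a + c))) = (\<lambda>i x. u (x + (a' - a)) - u x) i x)"
    proof (rule invariance_along_connected[where S = "(+) a ` \<Omega>2"])
      show "connected ((+) a ` \<Omega>2)" by (intro connected_continuous_image conn2 continuous_intros)
      fix p assume "p \<in> (+) a ` \<Omega>2"
      then obtain b where b: "b \<in> \<Omega>2" "p = a + b" by auto
      from stage1[OF a b(1)] obtain \<delta> where \<delta>: "\<delta> > 0" "\<forall>z\<in>X2. norm z < \<delta> \<longrightarrow>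
        (AE x in lborel. x \<in> ball p \<delta> \<longrightarrow> u (x + (a' - a) + z) - u (x + (a' - a)) = u (x + z) - u x)"
        unfolding b(2) by blast
      show "\<exists>\<delta>>0. \<forall>i\<in>{0::real}. norm i < \<delta> \<longrightarrow> (\<forall>q\<in>(+) a ` \<Omega>2. dist p q < \<delta> \<longrightarrow>
         (AE x in lborel. x \<in> ball p \<delta> \<longrightarrow> u (x + (q - p) + (a' - a)) - u (x + (q - p)) = u (x + (a' - a)) - u x))"
      proof (intro exI[of _ \<delta>] conjI \<delta>(1) ballI impI)
        fix q assume q: "q \<in> (+) a ` \<Omega>2" "dist p q < \<delta>"
        obtain x where "x \<in> \<Omega>2" "q = a + x" using q by auto
        then have "q - p \<in> X2" using b subspace_diff[OF sub2 sub\<Omega>2 sub\<Omega>2, of x b] by simp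
        moreover have "norm (q - p) < \<delta>" using q by (simp add: dist_norm norm_minus_commute)
        ultimately have "AE x in lborel. x \<in> ball p \<delta> \<longrightarrow> u (x + (a' - a) + (q - p)) - u (x + (a' - a)) = u (x + (q - p)) - u x"
          by (intro \<delta>(2)[rule_format]) auto
        then show "AE x in lborel. x \<in> ball p \<delta> \<longrightarrow> u (x + (q - p) + (a' - a)) - u (x + (q - p)) = u (x + (a' - a)) - u x"
        proof eventually_elim
          case (elim x)
          have "x + (a' - a) + (q - p) = x + (q - p) + (a' - a)" by simp
          then have "u (x + (q - p) + (a' - a)) = u (x + (a' - a) + (q - p))" by metis
          then show ?case using elim by linarith
        qed
      qed
    qed (use c in auto)
    then show ?thesis by (simp cong: conj_cong)
  qed
  show ?thesis
  proof -
    have "AE x in lborel. x \<in> {x. x \<in> \<Omega> \<and> x + y1 \<in> \<Omega> \<and> x + y2 \<in> \<Omega>} \<longrightarrow> u (x + y1 + y2) - u (x + y1) = u (x + y2) - u x"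
    proof (rule AE_lborel_locally)
      fix p assume p: "p \<in> {x. x \<in> \<Omega> \<and> x + y1 \<in> \<Omega> \<and> x + y2 \<in> \<Omega>}"
      have "P1 p \<in> \<Omega>1" "P1 p + y1 \<in> \<Omega>1" "P2 p \<in> \<Omega>2" "P2 p + y2 \<in> \<Omega>2"
        using p y by (auto simp: in_\<Omega> P1_simps P2_simps P1_id P2_id)
      from stage2[OF this] obtain r where r: "r > 0" "AE x in lborel. x \<in> ball p r \<longrightarrow> u (x + y2 + y1) - u (x + y2) = u (x + y1) - u x"
        by (auto simp: P_sum)
      from r(2) have "AE x in lborel. x \<in> ball p r \<longrightarrow> u (x + y1 + y2) - u (x + y1) = u (x + y2) - u x"
      proof eventually_elim
        case (elim x)
        have "x + y2 + y1 = x + y1 + y2" by simp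
        then show ?case using elim by (auto simp: algebra_simps)
      qed
      then show "\<exists>r>0. AE x in lborel. x \<in> ball p r \<longrightarrow> u (x + y1 + y2) - u (x + y1) = u (x + y2) - u x"
        using r(1) by blast
    qed
    then show ?thesis by simp
  qed
qed

lemma invariance_global:
  fixes u :: "'a \<Rightarrow> real"
  assumes loc: "\<And>p. p \<in> \<Omega> \<Longrightarrow> \<exists>\<delta>>0. \<forall>y\<in>X1. norm y < \<delta> \<longrightarrow> (AE x in lborel. x \<in> ball p \<delta> \<longrightarrow> u (x + y) = u x)"
    and y: "y \<in> X1"
  shows "AE x in lborel. x \<in> \<Omega> \<and> x + y \<in> \<Omega> \<longrightarrow> u (x + y) = u x"
proof -
  have "AE x in lborel. x \<in> {x. x \<in> \<Omega> \<and> x + y \<in> \<Omega>} \<longrightarrow> u (x + y) = u x"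
  proof (rule AE_lborel_locally)
    fix p assume p: "p \<in> {x. x \<in> \<Omega> \<and> x + y \<in> \<Omega>}"
    define c where "c = P2 p"
    have c: "c \<in> \<Omega>2" using p by (simp add: c_def in_\<Omega>)
    have "\<exists>r>0. \<forall>i\<in>{0::real}. norm i < r \<longrightarrow>
      (AE x in lborel. x \<in> ball p r \<longrightarrow> (\<lambda>i. u) i (x + ((p + y) - p)) = (\<lambda>i. u) i x)"
    proof (rule invariance_along_connected[where S = "(+) c ` \<Omega>1"])
      show "connected ((+) c ` \<Omega>1)" by (intro connected_continuous_image conn1 continuous_intros)
      have "p = c + P1 p" using P_sum[of p] by (simp add: c_def add.commute)
      moreover have "P1 p \<in> \<Omega>1" "P1 p + y \<in> \<Omega>1" using p y by (auto simp: in_\<Omega> P1_simps P1_id)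
      ultimately show "p \<in> (+) c ` \<Omega>1" "p + y \<in> (+) c ` \<Omega>1"
        by (metis image_eqI, metis image_eqI add.assoc)
      fix q assume "q \<in> (+) c ` \<Omega>1"
      then obtain b where b: "b \<in> \<Omega>1" "q = c + b" by auto
      then have "q \<in> \<Omega>" using c set_plus_intro[of b \<Omega>1 c \<Omega>2] by (simp add: add.commute)
      from loc[OF this] obtain \<delta> where \<delta>: "\<delta> > 0" "\<forall>y\<in>X1. norm y < \<delta> \<longrightarrow> (AE x in lborel. x \<in> ball q \<delta> \<longrightarrow> u (x + y) = u x)"
        by blast
      show "\<exists>\<delta>>0. \<forall>i\<in>{0::real}. norm i < \<delta> \<longrightarrow> (\<forall>q'\<in>(+) c ` \<Omega>1. dist q q' < \<delta> \<longrightarrow>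
         (AE x in lborel. x \<in> ball q \<delta> \<longrightarrow> u (x + (q' - q)) = u x))"
      proof (intro exI[of _ \<delta>] conjI \<delta>(1) ballI impI)
        fix q' assume q: "q' \<in> (+) c ` \<Omega>1" "dist q q' < \<delta>"
        obtain x where "x \<in> \<Omega>1" "q' = c + x" using q by auto
        then have "q' - q \<in> X1" using b subspace_diff[OF sub1 sub\<Omega>1 sub\<Omega>1, of x b] by simp
        moreover have "norm (q' - q) < \<delta>" using q by (simp add: dist_norm norm_minus_commute)
        ultimately show "AE x in lborel. x \<in> ball q \<delta> \<longrightarrow> u (x + (q' - q)) = u x"
          by (intro \<delta>(2)[rule_format]) auto
      qed
    qed
    then show "\<exists>r>0. AE x in lborel. x \<in> ball p r \<longrightarrow> u (x + y) = u x" by (simp cong: conj_cong)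
  qed
  then show ?thesis by simp
qed

text \<open>By Fubini, an invariant function is almost everywhere given by its values on one slice.\<close>

lemma function_of_other_component:
  fixes u :: "'a \<Rightarrow> real"
  assumes u[measurable]: "u \<in> borel_measurable borel"
    and loc: "\<And>p. p \<in> \<Omega> \<Longrightarrow> \<exists>\<delta>>0. \<forall>y\<in>X1. norm y < \<delta> \<longrightarrow> (AE x in lborel. x \<in> ball p \<delta> \<longrightarrow> u (x + y) = u x)"
  shows "\<exists>b\<in>\<Omega>. AE x in lborel. x \<in> \<Omega> \<longrightarrow> u x = u (P1 b + P2 x)"
proof -
  have [measurable]: "\<Omega> \<in> sets borel" using open_\<Omega> by simp
  have "AE d in lborel. AE x in lborel. x \<in> \<Omega> \<and> x + P1 d \<in> \<Omega> \<longrightarrow> u (x + P1 d) = u x"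
    by (intro AE_I2 invariance_global[OF loc] P1_in) auto
  then have "AE x in lborel. AE d in lborel. x \<in> \<Omega> \<and> x + P1 d \<in> \<Omega> \<longrightarrow> u (x + P1 d) = u x"
    by (subst lborel_pair.AE_commute) measurable
  then have "AE x in lborel. AE b in lborel. x \<in> \<Omega> \<and> b \<in> \<Omega> \<longrightarrow> u x = u (P1 b + P2 x)"
  proof eventually_elim
    case (elim x)
    from AE_lborel_translate[OF elim, of "- x"] show ?case
    proof eventually_elim
      case (elim b)
      have eq: "x + P1 (b + - x) = P1 b + P2 x" using P_sum[of x] by (simp add: P1_simps P2_def')
      have "P1 b + P2 x \<in> \<Omega>" if "x \<in> \<Omega>" "b \<in> \<Omega>"
        using that P1_in P2_in by (auto simp: in_\<Omega> P1_eq P2_eq)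
      then show ?case using elim unfolding eq by auto
    qed
  qed
  then have AE: "AE b in lborel. AE x in lborel. x \<in> \<Omega> \<and> b \<in> \<Omega> \<longrightarrow> u x = u (P1 b + P2 x)"
    by (subst lborel_pair.AE_commute) measurable
  have "\<exists>b\<in>\<Omega>. AE x in lborel. x \<in> \<Omega> \<and> b \<in> \<Omega> \<longrightarrow> u x = u (P1 b + P2 x)"
  proof (rule ccontr)
    assume "\<not> ?thesis"
    then have "AE b in lborel. b \<notin> \<Omega>" using AE by (auto elim!: eventually_mono)
    then have "negligible \<Omega>" by (simp add: AE_lborel_iff_negligible)
    then show False using open_not_negligible[OF open_\<Omega> \<Omega>_ne] by blast
  qed
  then show ?thesis by (auto elim!: eventually_mono intro: bexI[rotated])
qed

end

section \<open>Functions with decaying increments depend on one component\<close>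

lemma inv_dir_mixed_iff:
  fixes u :: "'a::euclidean_space \<Rightarrow> real"
  shows "inv_dir (UNIV :: real set) (\<lambda>t x. u (x + t *\<^sub>R z) - u x) p y \<longleftrightarrow>
    (\<exists>\<delta>>0. \<forall>t s. \<bar>t\<bar> < \<delta> \<longrightarrow> \<bar>s\<bar> < \<delta> \<longrightarrow>
      (AE x in lborel. x \<in> ball p \<delta> \<longrightarrow> u (x + s *\<^sub>R y + t *\<^sub>R z) - u (x + s *\<^sub>R y) = u (x + t *\<^sub>R z) - u x))"
  unfolding inv_dir_def by auto

lemma inv_dir_mixed_commute:
  fixes u :: "'a::euclidean_space \<Rightarrow> real"
  assumes "inv_dir (UNIV :: real set) (\<lambda>t x. u (x + t *\<^sub>R z) - u x) p y"
  shows "inv_dir (UNIV :: real set) (\<lambda>t x. u (x + t *\<^sub>R y) - u x) p z"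
proof -
  obtain \<delta> where \<delta>: "\<delta> > 0" "\<forall>t s. \<bar>t\<bar> < \<delta> \<longrightarrow> \<bar>s\<bar> < \<delta> \<longrightarrow>
      (AE x in lborel. x \<in> ball p \<delta> \<longrightarrow> u (x + s *\<^sub>R y + t *\<^sub>R z) - u (x + s *\<^sub>R y) = u (x + t *\<^sub>R z) - u x)"
    using assms unfolding inv_dir_mixed_iff by blast
  show ?thesis unfolding inv_dir_mixed_iff
  proof (intro exI[of _ \<delta>] conjI \<delta>(1) allI impI)
    fix t s :: real assume "\<bar>t\<bar> < \<delta>" "\<bar>s\<bar> < \<delta>"
    then have "AE x in lborel. x \<in> ball p \<delta> \<longrightarrow> u (x + t *\<^sub>R y + s *\<^sub>R z) - u (x + t *\<^sub>R y) = u (x + s *\<^sub>R z) - u x"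
      using \<delta>(2) by blast
    then show "AE x in lborel. x \<in> ball p \<delta> \<longrightarrow> u (x + s *\<^sub>R z + t *\<^sub>R y) - u (x + s *\<^sub>R z) = u (x + t *\<^sub>R y) - u x"
    proof eventually_elim
      case (elim x)
      have "u (x + t *\<^sub>R y + s *\<^sub>R z) = u (x + s *\<^sub>R z + t *\<^sub>R y)" by (simp add: add_ac)
      then show ?case using elim by linarith
    qed
  qed
qed

text \<open>Where mixed differences vanish, invariance under small translations in \<open>X\<close> carries over from
  the point \<open>p + z\<close> to the point \<open>p\<close>.\<close>

lemma invariance_transfer:
  fixes u :: "'a::euclidean_space \<Rightarrow> real"
  assumes \<Omega>: "open \<Omega>" "p \<in> \<Omega>" "p + z \<in> \<Omega>"
    and mixed: "\<And>y. y \<in> X \<Longrightarrow> AE x in lborel. x \<in> \<Omega> \<and> x + y \<in> \<Omega> \<and> x + z \<in> \<Omega> \<longrightarrow> u (x + y + z) - u (x + y) = u (x + z) - u x"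
    and inv: "\<exists>\<delta>>0. \<forall>y\<in>X. norm y < \<delta> \<longrightarrow> (AE x in lborel. x \<in> ball (p + z) \<delta> \<longrightarrow> u (x + y) = u x)"
  shows "\<exists>\<delta>>0. \<forall>y\<in>X. norm y < \<delta> \<longrightarrow> (AE x in lborel. x \<in> ball p \<delta> \<longrightarrow> u (x + y) = u x)"
proof -
  obtain \<delta>0 where \<delta>0: "\<delta>0 > 0" "\<forall>y\<in>X. norm y < \<delta>0 \<longrightarrow> (AE x in lborel. x \<in> ball (p + z) \<delta>0 \<longrightarrow> u (x + y) = u x)"
    using inv by blast
  obtain \<delta>1 where \<delta>1: "\<delta>1 > 0" "ball p \<delta>1 \<subseteq> \<Omega>" using \<Omega> by (meson open_contains_ball)
  obtain \<delta>2 where \<delta>2: "\<delta>2 > 0" "ball (p + z) \<delta>2 \<subseteq> \<Omega>" using \<Omega> by (meson open_contains_ball)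
  define \<epsilon> where "\<epsilon> = min \<delta>0 (min \<delta>1 \<delta>2) / 2"
  have \<epsilon>: "\<epsilon> > 0" "2 * \<epsilon> \<le> \<delta>0" "2 * \<epsilon> \<le> \<delta>1" "2 * \<epsilon> \<le> \<delta>2" using \<delta>0 \<delta>1 \<delta>2 by (auto simp: \<epsilon>_def)
  show ?thesis
  proof (intro exI[of _ \<epsilon>] conjI \<epsilon>(1) ballI impI)
    fix y assume y: "y \<in> X" "norm y < \<epsilon>"
    have "norm y < \<delta>0" using y \<epsilon> by linarith
    from AE_lborel_translate[OF \<delta>0(2)[rule_format, OF y(1) this], of z] mixed[OF y(1)]
    show "AE x in lborel. x \<in> ball p \<epsilon> \<longrightarrow> u (x + y) = u x"
    proof eventually_elim
      case (elim x)
      show ?case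
      proof
        assume x: "x \<in> ball p \<epsilon>"
        have "x \<in> ball p \<delta>1" using x \<epsilon> by simp
        moreover have "x + y \<in> ball p \<delta>1" using x y \<epsilon> dist_add_le[of p x y] by simp
        moreover have xz: "dist (p + z) (x + z) < \<epsilon>" using x by (simp add: dist_norm)
        moreover have "x + z \<in> ball (p + z) \<delta>2" using xz \<epsilon> by simp
        ultimately have "x \<in> \<Omega>" "x + y \<in> \<Omega>" "x + z \<in> \<Omega>" using \<delta>1 \<delta>2 by blast+
        then have 1: "u (x + y + z) - u (x + y) = u (x + z) - u x" using elim by blast
        have "x + z \<in> ball (p + z) \<delta>0" using xz \<epsilon> by simp
        then have 2: "u (x + z + y) = u (x + z)" using elim by blast
        have "u (x + z + y) = u (x + y + z)" by (simp add: add_ac)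
        then show "u (x + y) = u x" using 1 2 by linarith
      qed
    qed
  qed
qed

context product_domain begin

lemma swap: "product_domain X2 X1 \<Omega>2 \<Omega>1"
proof unfold_locales
  show "orthogonal x y" if "x \<in> X2" "y \<in> X1" for x y using orth[OF that(2,1)] by (simp add: orthogonal_commute)
  show "X2 + X1 = UNIV" using sum_UNIV by (simp add: add.commute)
qed (rule sub1 sub2 open1 open2 conn1 conn2 ne1 ne2)+

text \<open>The decay of increments in all directions \<open>w\<close> from a set that is not negligible forces \<open>u\<close> to
  depend on one component only. Mixed differences vanish in the directions \<open>(P1 w, P2 w)\<close>, hence in
  all by bilinearity, hence globally. Near each point, \<open>u\<close> is then invariant in the directions of
  \<open>X1\<close> or in those of \<open>X2\<close>, because one of two subspaces that cover \<open>W\<close> must be everything; and the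
  alternative is the same at all points.\<close>

lemma decay_imp_one_component:
  fixes u :: "'a \<Rightarrow> real"
  assumes u: "bdd_borel u" and u1: "\<And>x. \<bar>u x\<bar> \<le> 1 / 2" and h: "\<And>k. h k > 0" "h \<longlonglongrightarrow> 0"
    and \<tau>: "0 < \<tau>1" "0 < \<tau>2" "min \<tau>1 \<tau>2 \<le> q" "q \<le> \<tau>1 + \<tau>2" "1 \<le> q"
    and W: "W \<in> sets borel" "\<not> negligible W"
    and bd: "\<And>w p R R'. w \<in> W \<Longrightarrow> R < R' \<Longrightarrow> ball p R' \<subseteq> \<Omega> \<Longrightarrow>
        box_decay u (P1 w) (P2 w) \<tau>1 \<tau>2 (\<tau>1 + \<tau>2 + q) h p R"
  shows "(\<exists>b\<in>\<Omega>. AE x in lborel. x \<in> \<Omega> \<longrightarrow> u x = u (P1 b + P2 x)) \<or> (\<exists>b\<in>\<Omega>. AE x in lborel. x \<in> \<Omega> \<longrightarrow> u x = u (P2 b + P1 x))"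
proof -
  interpret swap: product_domain X2 X1 \<Omega>2 \<Omega>1 by (rule swap)
  have loc: "\<exists>\<delta>>0. \<forall>y1\<in>X1. \<forall>y2\<in>X2. norm y1 < \<delta> \<longrightarrow> norm y2 < \<delta> \<longrightarrow>
      (AE x in lborel. x \<in> ball p \<delta> \<longrightarrow> u (x + y1 + y2) - u (x + y1) = u (x + y2) - u x)"
    if p: "p \<in> \<Omega>" for p
  proof -
    obtain R0 where R0: "R0 > 0" "ball p R0 \<subseteq> \<Omega>" using open_\<Omega> p by (meson open_contains_ball)
    define Q where "Q = (\<lambda>y z. inv_dir (UNIV :: real set) (\<lambda>t x. u (x + t *\<^sub>R z) - u x) p y)"
    have Q12: "Q y1 y2" if "y1 \<in> X1" "y2 \<in> X2" for y1 y2
    proof (rule bilinear_relation_extend[OF _ _ W _ that])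
      show "subspace {y. Q y z}" for z unfolding Q_def by (rule subspace_inv_dir)
      have "{z. Q y z} = {z. inv_dir (UNIV :: real set) (\<lambda>t x. u (x + t *\<^sub>R y) - u x) p z}" for y
        unfolding Q_def using inv_dir_mixed_commute by blast
      then show "subspace {z. Q y z}" for y by (simp add: subspace_inv_dir)
      fix w assume w: "w \<in> W"
      define e where "e = 1 + norm (P1 w) + norm (P2 w)"
      have e: "e > 0" unfolding e_def by (smt (verit) norm_ge_zero)
      define \<delta> where "\<delta> = R0 / (4 * e)"
      have \<delta>: "\<delta> > 0" "\<delta> * e < R0 / 2" using R0 e by (auto simp: \<delta>_def)
      show "Q (P1 w) (P2 w)" unfolding Q_def inv_dir_mixed_iff
      proof (intro exI[of _ \<delta>] conjI \<delta>(1) allI impI)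
        fix t s :: real assume ts: "\<bar>t\<bar> < \<delta>" "\<bar>s\<bar> < \<delta>"
        have "\<bar>s\<bar> * norm (P1 w) \<le> \<delta> * norm (P1 w)" "\<bar>t\<bar> * norm (P2 w) \<le> \<delta> * norm (P2 w)"
          using ts by (auto intro!: mult_right_mono)
        moreover have "\<delta> * e = \<delta> + \<delta> * norm (P1 w) + \<delta> * norm (P2 w)" by (simp add: e_def algebra_simps)
        ultimately have r: "\<delta> + \<bar>s\<bar> * norm (P1 w) + \<bar>t\<bar> * norm (P2 w) < R0 / 2" using \<delta> by linarith
        show "AE x in lborel. x \<in> ball p \<delta> \<longrightarrow> u (x + s *\<^sub>R P1 w + t *\<^sub>R P2 w) - u (x + s *\<^sub>R P1 w) = u (x + t *\<^sub>R P2 w) - u x"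
          by (rule mixed_difference_zero[OF u h \<tau> bd[OF w _ R0(2)] r]) (use R0 in simp)
      qed
    qed
    have "inv_dir X1 (\<lambda>y x. u (x + y) - u x) p z" if z: "z \<in> X2" for z
    proof -
      obtain \<delta> where \<delta>: "\<delta> > 0" "\<forall>t\<in>(UNIV :: real set). norm t < \<delta> \<longrightarrow> (\<forall>y\<in>X1. norm y < \<delta> \<longrightarrow>
          (AE x in lborel. x \<in> ball p \<delta> \<longrightarrow> u (x + y + t *\<^sub>R z) - u (x + y) = u (x + t *\<^sub>R z) - u x))"
        using inv_dir_uniform[OF sub1, of UNIV "\<lambda>t x. u (x + t *\<^sub>R z) - u x" p] Q12[OF _ z] unfolding Q_def by blast
      show ?thesis unfolding inv_dir_def
      proof (intro exI[of _ \<delta>] conjI \<delta>(1) ballI allI impI)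
        fix y t assume y: "y \<in> X1" "norm y < \<delta>" and t: "\<bar>t\<bar> < \<delta>"
        have "AE x in lborel. x \<in> ball p \<delta> \<longrightarrow> u (x + y + t *\<^sub>R z) - u (x + y) = u (x + t *\<^sub>R z) - u x"
          using \<delta>(2) y t by simp
        then show "AE x in lborel. x \<in> ball p \<delta> \<longrightarrow> u (x + t *\<^sub>R z + y) - u (x + t *\<^sub>R z) = u (x + y) - u x"
        proof eventually_elim
          case (elim x)
          have "u (x + y + t *\<^sub>R z) = u (x + t *\<^sub>R z + y)" by (simp add: add_ac)
          then show ?case using elim by linarith
        qed
      qed
    qed
    from inv_dir_uniform[OF sub2 this] obtain \<delta> where \<delta>: "\<delta> > 0" "\<forall>y\<in>X1. norm y < \<delta> \<longrightarrow> (\<forall>z\<in>X2. norm z < \<delta> \<longrightarrow>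
          (AE x in lborel. x \<in> ball p \<delta> \<longrightarrow> u (x + z + y) - u (x + z) = u (x + y) - u x))" by blast
    show ?thesis
    proof (intro exI[of _ \<delta>] conjI \<delta>(1) ballI impI)
      fix y z assume y: "y \<in> X1" "norm y < \<delta>" and z: "z \<in> X2" "norm z < \<delta>"
      then have "AE x in lborel. x \<in> ball p \<delta> \<longrightarrow> u (x + z + y) - u (x + z) = u (x + y) - u x"
        using \<delta>(2) by blast
      then show "AE x in lborel. x \<in> ball p \<delta> \<longrightarrow> u (x + y + z) - u (x + y) = u (x + z) - u x"
      proof eventually_elim
        case (elim x)
        have "u (x + z + y) = u (x + y + z)" by (simp add: add_ac)
        then show ?case using elim by linarith
      qed
    qed
  qed
  have mixed: "AE x in lborel. x \<in> \<Omega> \<and> x + y1 \<in> \<Omega> \<and> x + y2 \<in> \<Omega> \<longrightarrow> u (x + y1 + y2) - u (x + y1) = u (x + y2) - u x"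
    if "y1 \<in> X1" "y2 \<in> X2" for y1 y2
    by (rule mixed_difference_global[OF loc that])
  define I1 where "I1 = (\<lambda>p. \<exists>\<delta>>0. \<forall>y\<in>X1. norm y < \<delta> \<longrightarrow> (AE x in lborel. x \<in> ball p \<delta> \<longrightarrow> u (x + y) = u x))"
  define I2 where "I2 = (\<lambda>p. \<exists>\<delta>>0. \<forall>y\<in>X2. norm y < \<delta> \<longrightarrow> (AE x in lborel. x \<in> ball p \<delta> \<longrightarrow> u (x + y) = u x))"
  have dich: "I1 p \<or> I2 p" if p: "p \<in> \<Omega>" for p
  proof -
    obtain R0 where R0: "R0 > 0" "ball p R0 \<subseteq> \<Omega>" using open_\<Omega> p by (meson open_contains_ball)
    define r where "r = R0 / 20"
    have r: "r > 0" "20 * r = R0" using R0 by (auto simp: r_def)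
    define A where "A = (\<lambda>y. inv_dir {0::real} (\<lambda>_. u) p y)"
    have subA: "subspace {y. A y}" unfolding A_def by (rule subspace_inv_dir)
    have A_I: "A y" if "\<forall>s. \<bar>s\<bar> * norm y < r \<longrightarrow> (AE x in lborel. x \<in> ball p r \<longrightarrow> u (x + s *\<^sub>R y) = u x)" for y
    proof -
      define \<delta> where "\<delta> = r / (1 + norm y)"
      have n: "1 + norm y > 0" using norm_ge_zero[of y] by linarith
      have \<delta>: "\<delta> > 0" "\<delta> * (1 + norm y) = r" using r n by (auto simp: \<delta>_def)
      have "\<delta> * norm y \<ge> 0" using \<delta> by simp
      moreover have "\<delta> + \<delta> * norm y = r" using \<delta>(2) by (simp add: distrib_left)
      ultimately have \<delta>r: "\<delta> * norm y < r" "\<delta> \<le> r" using \<delta>(1) by linarith+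
      show "A y" unfolding A_def inv_dir_def
      proof (intro exI[of _ \<delta>] conjI \<delta>(1) ballI allI impI)
        fix s assume s: "\<bar>s\<bar> < \<delta>"
        have "\<bar>s\<bar> * norm y \<le> \<delta> * norm y" using s by (intro mult_right_mono) auto
        then have "AE x in lborel. x \<in> ball p r \<longrightarrow> u (x + s *\<^sub>R y) = u x" using that \<delta>r by simp
        then show "AE x in lborel. x \<in> ball p \<delta> \<longrightarrow> u (x + s *\<^sub>R y) = u x"
          by eventually_elim (use \<delta>r in auto)
      qed
    qed
    have sub: "W \<subseteq> {w. A (P1 w)} \<union> {w. A (P2 w)}"
    proof
      fix w assume w: "w \<in> W"
      have bdw: "box_decay u (P1 w) (P2 w) \<tau>1 \<tau>2 (\<tau>1 + \<tau>2 + q) h p (6 * r)"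
        by (rule bd[OF w _ R0(2)]) (use r in simp)
      have "AE x in lborel. x \<in> ball p (6 * r) \<longrightarrow> u (x + y1 + y2) - u (x + y1) = u (x + y2) - u x"
        if y: "y1 \<in> X1" "y2 \<in> X2" "norm y1 < 4 * r" "norm y2 < 4 * r" for y1 y2
        using mixed[OF y(1,2)]
      proof eventually_elim
        case (elim x)
        show ?case
        proof
          assume x: "x \<in> ball p (6 * r)"
          then have "x \<in> ball p R0" "x + y1 \<in> ball p R0" "x + y2 \<in> ball p R0"
            using y r dist_add_le[of p x y1] dist_add_le[of p x y2] by simp_all
          then show "u (x + y1 + y2) - u (x + y1) = u (x + y2) - u x" using elim R0 by blast
        qed
      qed
      from increment_dichotomy[OF u u1 h \<tau> bdw r(1) sub1 sub2 P1_in P2_in P1_in P2_in P_sum norm_P1_le norm_P2_le this]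
      show "w \<in> {w. A (P1 w)} \<union> {w. A (P2 w)}" using A_I by blast
    qed
    have sA: "subspace {w. A (P1 w)}" "subspace {w. A (P2 w)}"
      using linear_subspace_vimage[OF linear_P1 subA] linear_subspace_vimage[OF linear_P2 subA] by (simp_all add: vimage_def)
    have "\<not> negligible {w. A (P1 w)} \<or> \<not> negligible {w. A (P2 w)}"
      using sub W(2) negligible_Un negligible_subset by blast
    then have "{w. A (P1 w)} = UNIV \<or> {w. A (P2 w)} = UNIV" using subspace_not_negligible sA by blast
    then have "(\<forall>y\<in>X1. A y) \<or> (\<forall>y\<in>X2. A y)"
      by (metis (mono_tags, lifting) P1_id P2_id UNIV_I mem_Collect_eq)
    then show ?thesis
    proof
      assume "\<forall>y\<in>X1. A y"
      then show ?thesis using inv_dir_uniform[OF sub1, of "{0::real}" "\<lambda>_. u" p] unfolding A_def I1_def by auto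
    next
      assume "\<forall>y\<in>X2. A y"
      then show ?thesis using inv_dir_uniform[OF sub2, of "{0::real}" "\<lambda>_. u" p] unfolding A_def I2_def by auto
    qed
  qed
  have "(\<forall>p\<in>\<Omega>. I1 p) \<or> (\<forall>p\<in>\<Omega>. I2 p)"
  proof (rule ccontr)
    assume "\<not> ?thesis"
    then obtain p p' where p: "p \<in> \<Omega>" "\<not> I1 p" and p': "p' \<in> \<Omega>" "\<not> I2 p'" by blast
    \<comment> \<open>compare both points with the one that has a component in common with each of them\<close>
    define c where "c = P1 p + P2 p'"
    have c: "c \<in> \<Omega>" unfolding c_def using p p' P1_in P2_in by (auto simp: in_\<Omega> P1_eq P2_eq)
    have c1: "c = p + (P2 p' - P2 p)" using P_sum[of p] by (simp add: c_def algebra_simps)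
    have c2: "c = p' + (P1 p - P1 p')" using P_sum[of p'] by (simp add: c_def algebra_simps)
    have z: "P2 p' - P2 p \<in> X2" "P1 p - P1 p' \<in> X1"
      using P1_in P2_in by (auto intro: subspace_diff sub1 sub2)
    from dich[OF c] show False
    proof
      assume "I1 c"
      then have inv: "\<exists>\<delta>>0. \<forall>y\<in>X1. norm y < \<delta> \<longrightarrow> (AE x in lborel. x \<in> ball (p + (P2 p' - P2 p)) \<delta> \<longrightarrow> u (x + y) = u x)"
        unfolding I1_def c1 .
      have "I1 p" unfolding I1_def
        by (rule invariance_transfer[OF open_\<Omega> p(1) c[unfolded c1] mixed[OF _ z(1)] inv])
      then show False using p by blast
    next
      assume "I2 c"
      have mixed': "AE x in lborel. x \<in> \<Omega> \<and> x + y \<in> \<Omega> \<and> x + (P1 p - P1 p') \<in> \<Omega> \<longrightarrow>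
          u (x + y + (P1 p - P1 p')) - u (x + y) = u (x + (P1 p - P1 p')) - u x" if y: "y \<in> X2" for y
        using mixed[OF z(2) y]
      proof eventually_elim
        case (elim x)
        have "u (x + y + (P1 p - P1 p')) = u (x + (P1 p - P1 p') + y)" by (simp add: add_ac)
        then show ?case using elim by linarith
      qed
      have inv: "\<exists>\<delta>>0. \<forall>y\<in>X2. norm y < \<delta> \<longrightarrow> (AE x in lborel. x \<in> ball (p' + (P1 p - P1 p')) \<delta> \<longrightarrow> u (x + y) = u x)"
        using \<open>I2 c\<close> unfolding I2_def c2 .
      have "I2 p'" unfolding I2_def
        by (rule invariance_transfer[OF open_\<Omega> p'(1) c[unfolded c2] mixed' inv])
      then show False using p' by blast
    qed
  qed
  moreover have ub: "u \<in> borel_measurable borel" using u by (simp add: bdd_borel_def)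
  moreover have comm: "\<Omega>2 + \<Omega>1 = \<Omega>" by (simp add: add.commute)
  ultimately show ?thesis
    using function_of_other_component[OF ub] swap.function_of_other_component[OF ub] unfolding I1_def I2_def comm by blast
qed

end

section \<open>Extracting directions from the energy\<close>

lemma AE_lborel_linear:
  fixes f :: "'a::euclidean_space \<Rightarrow> 'a"
  assumes f: "linear f" "inj f" and P: "AE x in lborel. P x"
  shows "AE x in lborel. P (f x)"
proof -
  obtain g where g: "linear g" "g \<circ> f = id"
    using linear_injective_left_inverse[OF f] by blast
  have "negligible (g ` {x. \<not> P x})"
    using P g(1) unfolding AE_lborel_iff_negligible
    by (intro negligible_differentiable_image_negligible linear_imp_differentiable_on) auto
  moreover have "{x. \<not> P (f x)} \<subseteq> g ` {x. \<not> P x}"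
  proof
    fix x assume "x \<in> {x. \<not> P (f x)}"
    moreover have "x = g (f x)" using g(2) by (metis comp_apply id_apply)
    ultimately show "x \<in> g ` {x. \<not> P x}" by blast
  qed
  ultimately show ?thesis
    unfolding AE_lborel_iff_negligible by (rule negligible_subset)
qed

lemma nn_integral_lborel_scale:
  fixes f :: "'a::euclidean_space \<Rightarrow> ennreal"
  assumes [measurable]: "f \<in> borel_measurable borel" and c: "c > 0"
  shows "(\<integral>\<^sup>+x. f x \<partial>lborel) = (\<integral>\<^sup>+x. ennreal (c ^ DIM('a)) * f (c *\<^sub>R x) \<partial>lborel)"
proof -
  have "(lborel :: 'a measure) = density (distr lborel borel (\<lambda>x. 0 + c *\<^sub>R x)) (\<lambda>_. ennreal (\<bar>c\<bar> ^ DIM('a)))"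
    by (rule lborel_affine) (use c in auto)
  then have "(\<integral>\<^sup>+x. f x \<partial>lborel) = (\<integral>\<^sup>+x. f x \<partial>density (distr lborel borel (\<lambda>x. 0 + c *\<^sub>R x)) (\<lambda>_. ennreal (\<bar>c\<bar> ^ DIM('a))))"
    by simp
  also have "\<dots> = (\<integral>\<^sup>+x. ennreal (c ^ DIM('a)) * f (c *\<^sub>R x) \<partial>lborel)"
    using c by (simp add: nn_integral_density nn_integral_distr ennreal_power)
  finally show ?thesis .
qed

lemma Liminf_at_right_zero_sequence:
  fixes E :: "real \<Rightarrow> ennreal"
  assumes "Liminf (at_right 0) E = 0"
  obtains h where "\<And>k. h k > 0" "h \<longlonglongrightarrow> 0" "(\<Sum>k. E (h k)) < \<infinity>"
proof -
  have "\<exists>\<epsilon>. 0 < \<epsilon> \<and> \<epsilon> < 1 / real (Suc k) \<and> E \<epsilon> < ennreal ((1 / 2) ^ k)" for k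
  proof (rule ccontr)
    assume "\<not> ?thesis"
    then have "ennreal ((1 / 2) ^ k) \<le> E \<epsilon>" if "\<epsilon> \<in> {0<..<1 / real (Suc k)}" for \<epsilon>
      using that by (metis greaterThanLessThan_iff not_less)
    then have "\<forall>\<^sub>F \<epsilon> in at_right 0. ennreal ((1 / 2) ^ k) \<le> E \<epsilon>"
      by (rule eventually_at_rightI[of 0 "1 / real (Suc k)"]) simp_all
    then have "ennreal ((1 / 2) ^ k) \<le> Liminf (at_right 0) E" by (rule Liminf_bounded)
    then show False using assms by simp
  qed
  then obtain h where h: "\<And>k. 0 < h k" "\<And>k. h k < 1 / real (Suc k)" "\<And>k. E (h k) < ennreal ((1 / 2) ^ k)"
    by metis
  have lim: "h \<longlonglongrightarrow> 0"
  proof (rule real_tendsto_sandwich[OF _ _ tendsto_const])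
    show "\<forall>\<^sub>F k in sequentially. 0 \<le> h k" using h(1) by (simp add: less_imp_le)
    show "\<forall>\<^sub>F k in sequentially. h k \<le> inverse (real (Suc k))"
      using h(2) by (simp add: less_imp_le inverse_eq_divide)
    show "(\<lambda>k. inverse (real (Suc k))) \<longlonglongrightarrow> 0" by (rule LIMSEQ_inverse_real_of_nat)
  qed
  have "(\<Sum>k. E (h k)) \<le> (\<Sum>k. ennreal ((1 / 2) ^ k))"
    by (intro suminf_le) (use h(3) in \<open>auto intro: less_imp_le\<close>)
  also have "\<dots> = ennreal (\<Sum>k. (1 / 2) ^ k)"
    by (intro suminf_ennreal2) (auto intro: summable_geometric)
  also have "\<dots> < \<infinity>" by simp
  finally show ?thesis using that h(1) lim by blast
qed

lemma suminf_finite_tendsto_zero: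
  fixes f :: "nat \<Rightarrow> ennreal"
  assumes "(\<Sum>k. f k) < \<infinity>"
  shows "f \<longlonglongrightarrow> 0"
proof -
  have fin: "f k < \<infinity>" for k
    using assms sum_le_suminf[of f "{k}"] by (auto simp: less_top[symmetric] top_unique)
  define g where "g = (\<lambda>k. enn2real (f k))"
  have f: "f = (\<lambda>k. ennreal (g k))" using fin by (auto simp: g_def less_top)
  have "summable g"
  proof (rule summable_suminf_not_top)
    show "(\<Sum>k. ennreal (g k)) \<noteq> top" using assms unfolding f by simp
  qed (simp add: g_def)
  then have "g \<longlonglongrightarrow> 0" by (rule summable_LIMSEQ_zero)
  then show ?thesis unfolding f by (subst ennreal_0[symmetric]) (rule tendsto_ennrealI)
qed

context product_domain begin

text \<open>For \<open>\<epsilon> > 0\<close>, the points of \<open>\<Omega>\<close> at distance at least \<open>2 \<epsilon>\<close> from the complement; this set is contained in the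
  domain of integration of the energy at scale \<open>\<epsilon>\<close>.\<close>

definition deep :: "real \<Rightarrow> 'a set" where
  "deep \<epsilon> = {x. ball x (2 * \<epsilon>) \<subseteq> \<Omega>}"

text \<open>The inner integral of the energy at \<open>z\<close>, restricted to these points.\<close>

definition incr_int :: "('a \<Rightarrow> real) \<Rightarrow> real \<Rightarrow> real \<Rightarrow> real \<Rightarrow> real \<Rightarrow> 'a \<Rightarrow> ennreal" where
  "incr_int v \<tau>1 \<tau>2 m \<epsilon> z = (\<integral>\<^sup>+x. indicator (deep \<epsilon>) x *
     ennreal (\<bar>v (x + P1 z) - v x\<bar> powr \<tau>1 * \<bar>v (x + P2 z) - v x\<bar> powr \<tau>2 / norm z powr m) \<partial>lborel)"

lemma closed_deep: "closed (deep \<epsilon>)"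
proof -
  have "deep \<epsilon> = (\<Inter>y\<in>- \<Omega>. {x. 2 * \<epsilon> \<le> dist x y})" by (auto simp: deep_def subset_eq) (metis ComplI not_le)+
  also have "closed \<dots>" by (intro closed_INT ballI closed_Collect_le continuous_intros)
  finally show ?thesis .
qed

lemma deep_subset_shrink:
  assumes "\<epsilon> > 0" shows "deep \<epsilon> \<subseteq> shrink X1 \<Omega>1 \<epsilon> + shrink X2 \<Omega>2 \<epsilon>"
proof
  fix x assume "x \<in> deep \<epsilon>"
  then have x: "x + z \<in> \<Omega>" if "norm z < 2 * \<epsilon>" for z
    using that by (auto simp: deep_def subset_eq dist_norm)
  have "P1 x \<in> shrink X1 \<Omega>1 \<epsilon>"
    unfolding shrink_def
  proof (intro INT_I)
    fix z assume z: "z \<in> {z \<in> X1. norm z < \<epsilon>}"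
    then have "x + z \<in> \<Omega>" using assms by (intro x) auto
    then have "P1 x + z \<in> \<Omega>1" using z by (simp add: in_\<Omega> P1_simps P1_id)
    then show "P1 x \<in> (\<lambda>x. x - z) ` \<Omega>1" by (rule rev_image_eqI) simp
  qed
  moreover have "P2 x \<in> shrink X2 \<Omega>2 \<epsilon>"
    unfolding shrink_def
  proof (intro INT_I)
    fix z assume z: "z \<in> {z \<in> X2. norm z < \<epsilon>}"
    then have "x + z \<in> \<Omega>" using assms by (intro x) auto
    then have "P2 x + z \<in> \<Omega>2" using z by (simp add: in_\<Omega> P2_simps P2_id)
    then show "P2 x \<in> (\<lambda>x. x - z) ` \<Omega>2" by (rule rev_image_eqI) simp
  qed
  ultimately show "x \<in> shrink X1 \<Omega>1 \<epsilon> + shrink X2 \<Omega>2 \<epsilon>"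
    using set_plus_intro[of "P1 x" _ "P2 x"] by (simp add: P_sum)
qed

lemma incr_int_measurable:
  assumes [measurable]: "v \<in> borel_measurable borel"
  shows "incr_int v \<tau>1 \<tau>2 m \<epsilon> \<in> borel_measurable borel"
proof -
  have [measurable]: "deep \<epsilon> \<in> sets borel" using closed_deep by simp
  show ?thesis unfolding incr_int_def[abs_def] by measurable
qed

lemma incr_int_le:
  assumes \<epsilon>: "\<epsilon> > 0" and \<theta>: "0 < \<theta>1" "\<theta>1 \<le> \<tau>1" "0 < \<theta>2" "\<theta>2 \<le> \<tau>2"
    and v1: "\<And>x. \<bar>v x\<bar> \<le> 1 / 2" and \<phi>: "\<And>a b. \<bar>\<phi> a - \<phi> b\<bar> \<le> \<bar>a - b\<bar>"
    and vu: "AE x in lborel. x \<in> \<Omega> \<longrightarrow> v x = \<phi> (u x)" and z: "norm z \<le> \<epsilon>"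
  shows "incr_int v \<tau>1 \<tau>2 m \<epsilon> z \<le> (\<integral>\<^sup>+ x \<in> shrink X1 \<Omega>1 \<epsilon> + shrink X2 \<Omega>2 \<epsilon>.
           ennreal (\<bar>u (x + P1 z) - u x\<bar> powr \<theta>1 * \<bar>u (x + P2 z) - u x\<bar> powr \<theta>2 / norm z powr m) \<partial>lebesgue)"
  unfolding incr_int_def nn_integral_completion
proof (rule nn_integral_mono_AE)
  have pw: "\<bar>\<phi> a - \<phi> b\<bar> powr \<tau> \<le> \<bar>a - b\<bar> powr \<theta>" if "\<bar>\<phi> a - \<phi> b\<bar> \<le> 1" "0 < \<theta>" "\<theta> \<le> \<tau>" for a b \<theta> \<tau> :: real
  proof -
    have "\<bar>\<phi> a - \<phi> b\<bar> powr \<tau> \<le> \<bar>\<phi> a - \<phi> b\<bar> powr \<theta>"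
      using that by (cases "\<phi> a - \<phi> b = 0") (auto intro!: powr_mono')
    also have "\<dots> \<le> \<bar>a - b\<bar> powr \<theta>" using that \<phi>[of a b] by (intro powr_mono2) auto
    finally show ?thesis .
  qed
  from vu AE_lborel_translate[OF vu, of "P1 z"] AE_lborel_translate[OF vu, of "P2 z"]
  show "AE x in lborel. indicator (deep \<epsilon>) x *
     ennreal (\<bar>v (x + P1 z) - v x\<bar> powr \<tau>1 * \<bar>v (x + P2 z) - v x\<bar> powr \<tau>2 / norm z powr m)
     \<le> ennreal (\<bar>u (x + P1 z) - u x\<bar> powr \<theta>1 * \<bar>u (x + P2 z) - u x\<bar> powr \<theta>2 / norm z powr m)
       * indicator (shrink X1 \<Omega>1 \<epsilon> + shrink X2 \<Omega>2 \<epsilon>) x"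
  proof eventually_elim
    case (elim x)
    show ?case
    proof (cases "x \<in> deep \<epsilon>")
      case True
      have in\<Omega>: "x + y \<in> \<Omega>" if "norm y \<le> norm z" for y
        using True that z \<epsilon> by (auto simp: deep_def subset_eq dist_norm)
      have "x \<in> \<Omega>" "x + P1 z \<in> \<Omega>" "x + P2 z \<in> \<Omega>"
        using in\<Omega>[of 0] in\<Omega>[OF norm_P1_le] in\<Omega>[OF norm_P2_le] by simp_all
      then have eq: "v x = \<phi> (u x)" "v (x + P1 z) = \<phi> (u (x + P1 z))" "v (x + P2 z) = \<phi> (u (x + P2 z))"
        using elim by blast+
      have "\<bar>v a - v b\<bar> \<le> 1" for a b using v1[of a] v1[of b] by linarith
      then have "\<bar>\<phi> (u (x + P1 z)) - \<phi> (u x)\<bar> \<le> 1" "\<bar>\<phi> (u (x + P2 z)) - \<phi> (u x)\<bar> \<le> 1"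
        using eq by metis+
      then have "\<bar>v (x + P1 z) - v x\<bar> powr \<tau>1 * \<bar>v (x + P2 z) - v x\<bar> powr \<tau>2 / norm z powr m
        \<le> \<bar>u (x + P1 z) - u x\<bar> powr \<theta>1 * \<bar>u (x + P2 z) - u x\<bar> powr \<theta>2 / norm z powr m"
        unfolding eq using \<theta> by (intro divide_right_mono mult_mono pw) auto
      then show ?thesis
        using True deep_subset_shrink[OF \<epsilon>] by (auto simp: ennreal_leI)
    qed simp
  qed
qed

text \<open>The substitution \<open>z = \<epsilon> w\<close> bounds the energy below by an integral against a fixed weight. Here
  \<open>v\<close> is bounded, Borel and on \<open>\<Omega>\<close> almost everywhere the composition of \<open>u\<close> with a contraction \<open>\<phi>\<close>, and \<open>\<rho>'\<close> a Borel representative of \<open>\<rho>\<close>.\<close>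

lemma energy_eps_ge:
  assumes \<epsilon>: "\<epsilon> > 0" and \<theta>: "0 < \<theta>1" "\<theta>1 \<le> \<tau>1" "0 < \<theta>2" "\<theta>2 \<le> \<tau>2"
    and v[measurable]: "v \<in> borel_measurable borel"
    and v1: "\<And>x. \<bar>v x\<bar> \<le> 1 / 2" and \<phi>: "\<And>a b. \<bar>\<phi> a - \<phi> b\<bar> \<le> \<bar>a - b\<bar>"
    and vu: "AE x in lborel. x \<in> \<Omega> \<longrightarrow> v x = \<phi> (u x)"
    and \<rho>'[measurable]: "\<rho>' \<in> borel_measurable borel" and \<rho>'\<rho>: "AE z in lborel. \<rho> z = \<rho>' z"
  shows "(\<integral>\<^sup>+w. ennreal (\<rho>' w) * indicator (cball 0 1) w * incr_int v \<tau>1 \<tau>2 m \<epsilon> (\<epsilon> *\<^sub>R w) \<partial>lborel)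
      \<le> energy_eps X1 X2 \<Omega>1 \<Omega>2 \<rho> m \<theta>1 \<theta>2 u \<epsilon>"
proof -
  have [measurable]: "incr_int v \<tau>1 \<tau>2 m \<epsilon> \<in> borel_measurable borel" by (rule incr_int_measurable[OF v])
  have [measurable]: "cball (0::'a) \<epsilon> \<in> sets borel" by simp
  let ?n = "DIM('a)"
  define F where "F = (\<lambda>z. ennreal (\<rho>' (z /\<^sub>R \<epsilon>) / \<epsilon> ^ ?n) * indicator (cball 0 \<epsilon>) z * incr_int v \<tau>1 \<tau>2 m \<epsilon> z)"
  have [measurable]: "F \<in> borel_measurable borel" unfolding F_def by measurable
  have "(\<integral>\<^sup>+w. ennreal (\<rho>' w) * indicator (cball 0 1) w * incr_int v \<tau>1 \<tau>2 m \<epsilon> (\<epsilon> *\<^sub>R w) \<partial>lborel)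
      = (\<integral>\<^sup>+w. ennreal (\<epsilon> ^ ?n) * F (\<epsilon> *\<^sub>R w) \<partial>lborel)"
  proof (intro nn_integral_cong)
    fix w :: 'a
    have "ennreal (\<epsilon> ^ ?n) * ennreal (\<rho>' w / \<epsilon> ^ ?n) = ennreal (\<rho>' w)"
      using \<epsilon> by (cases "\<rho>' w \<ge> 0") (auto simp: ennreal_mult[symmetric] ennreal_neg divide_nonpos_nonneg)
    moreover have "indicator (cball 0 \<epsilon>) (\<epsilon> *\<^sub>R w) = (indicator (cball 0 1) w :: ennreal)"
      using \<epsilon> by (auto simp: indicator_def)
    ultimately show "ennreal (\<rho>' w) * indicator (cball 0 1) w * incr_int v \<tau>1 \<tau>2 m \<epsilon> (\<epsilon> *\<^sub>R w) = ennreal (\<epsilon> ^ ?n) * F (\<epsilon> *\<^sub>R w)"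
      using \<epsilon> unfolding F_def by (simp add: mult.assoc[symmetric])
  qed
  also have "\<dots> = (\<integral>\<^sup>+z. F z \<partial>lborel)"
    by (rule nn_integral_lborel_scale[symmetric]) (use \<epsilon> in auto)
  also have "\<dots> \<le> energy_eps X1 X2 \<Omega>1 \<Omega>2 \<rho> m \<theta>1 \<theta>2 u \<epsilon>"
    unfolding energy_eps_def nn_integral_completion[of lborel "\<lambda>z. ennreal (scaled_kernel \<rho> \<epsilon> z) * _ z"]
  proof (rule nn_integral_mono_AE)
    have "linear (\<lambda>z. z /\<^sub>R \<epsilon> :: 'a)" "inj (\<lambda>z. z /\<^sub>R \<epsilon> :: 'a)"
      using \<epsilon> by (auto intro!: linear_scaleR injI)
    from AE_lborel_linear[OF this \<rho>'\<rho>]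
    show "AE z in lborel. F z \<le> ennreal (scaled_kernel \<rho> \<epsilon> z) *
        (\<integral>\<^sup>+ x \<in> shrink X1 \<Omega>1 \<epsilon> + shrink X2 \<Omega>2 \<epsilon>.
           ennreal (\<bar>u (x + P1 z) - u x\<bar> powr \<theta>1 * \<bar>u (x + P2 z) - u x\<bar> powr \<theta>2 / norm z powr m) \<partial>lebesgue)"
    proof eventually_elim
      case (elim z)
      show ?case
      proof (cases "norm z \<le> \<epsilon>")
        case True
        show ?thesis
          using incr_int_le[OF \<epsilon> \<theta> v1 \<phi> vu True, of m] True elim
          by (auto simp: F_def scaled_kernel_def intro!: mult_left_mono)
      qed (simp add: F_def)
    qed
  qed
  finally show ?thesis .
qed

end

context product_domain begin

text \<open>For almost every direction \<open>w\<close> charged by the kernel, the inner integrals at \<open>\<epsilon> w\<close> tend to \<open>0\<close>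
  along a fixed sequence of scales. As the kernel is radial, this also holds for the reflected
  directions.\<close>

lemma good_directions:
  assumes \<theta>: "0 < \<theta>1" "\<theta>1 \<le> \<tau>1" "0 < \<theta>2" "\<theta>2 \<le> \<tau>2"
    and v: "v \<in> borel_measurable borel"
    and v1: "\<And>x. \<bar>v x\<bar> \<le> 1 / 2" and \<phi>: "\<And>a b. \<bar>\<phi> a - \<phi> b\<bar> \<le> \<bar>a - b\<bar>"
    and vu: "AE x in lborel. x \<in> \<Omega> \<longrightarrow> v x = \<phi> (u x)"
    and \<rho>: "\<And>x. \<rho> x \<ge> 0" "\<And>x y. norm x = norm y \<Longrightarrow> \<rho> x = \<rho> y" "integrable lebesgue \<rho>" "(\<integral>x. \<rho> x \<partial>lebesgue) = 1"
      "ess_support \<rho> \<subseteq> cball 0 1"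
    and en: "energy X1 X2 \<Omega>1 \<Omega>2 \<rho> m \<theta>1 \<theta>2 u = 0"
  obtains h W where "\<And>k. h k > 0" "h \<longlonglongrightarrow> 0" "W \<in> sets borel" "\<not> negligible W" "0 \<notin> W"
    "\<And>w s t. w \<in> W \<Longrightarrow> s \<in> {- 1, 1} \<Longrightarrow> t \<in> {- 1, 1} \<Longrightarrow>
       (\<lambda>k. incr_int v \<tau>1 \<tau>2 m (h k) (h k *\<^sub>R (s *\<^sub>R P1 w + t *\<^sub>R P2 w))) \<longlonglongrightarrow> 0"
proof -
  obtain h where h: "\<And>k. h k > 0" "h \<longlonglongrightarrow> 0" and
      fin: "(\<Sum>k. energy_eps X1 X2 \<Omega>1 \<Omega>2 \<rho> m \<theta>1 \<theta>2 u (h k)) < \<infinity>"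
    using Liminf_at_right_zero_sequence[OF en[unfolded energy_def]] by blast
  obtain \<rho>' where \<rho>'[measurable]: "\<rho>' \<in> borel_measurable borel" and \<rho>'\<rho>: "AE z in lborel. \<rho> z = \<rho>' z"
    using completion_ex_borel_measurable_real[of \<rho> lborel] \<rho>(3) by auto
  have [measurable]: "incr_int v \<tau>1 \<tau>2 m \<epsilon> \<in> borel_measurable borel" for \<epsilon> by (rule incr_int_measurable[OF v])
  have [measurable]: "cball (0::'a) 1 \<in> sets borel" by simp
  define F where "F = (\<lambda>k w. ennreal (\<rho>' w) * indicator (cball 0 1) w * incr_int v \<tau>1 \<tau>2 m (h k) (h k *\<^sub>R w))"
  have [measurable]: "F k \<in> borel_measurable borel" for k unfolding F_def by measurable
  have "(\<integral>\<^sup>+w. (\<Sum>k. F k w) \<partial>lborel) = (\<Sum>k. \<integral>\<^sup>+w. F k w \<partial>lborel)"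
    by (rule nn_integral_suminf) measurable
  also have "\<dots> \<le> (\<Sum>k. energy_eps X1 X2 \<Omega>1 \<Omega>2 \<rho> m \<theta>1 \<theta>2 u (h k))"
    unfolding F_def by (intro suminf_le allI energy_eps_ge[OF h(1) \<theta> v v1 \<phi> vu \<rho>' \<rho>'\<rho>]) auto
  also note fin
  finally have "AE w in lborel. (\<Sum>k. F k w) \<noteq> \<infinity>"
    by (intro nn_integral_noteq_infinite) auto
  with \<rho>'\<rho> have conv: "AE w in lborel. norm w \<le> 1 \<and> \<rho> w > 0 \<longrightarrow> (\<lambda>k. incr_int v \<tau>1 \<tau>2 m (h k) (h k *\<^sub>R w)) \<longlonglongrightarrow> 0"
  proof eventually_elim
    case (elim w)
    show ?case
    proof
      assume w: "norm w \<le> 1 \<and> \<rho> w > 0"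
      have "(\<lambda>k. F k w) \<longlonglongrightarrow> 0" using elim by (intro suminf_finite_tendsto_zero) (simp add: less_top)
      then have "(\<lambda>k. ennreal (1 / \<rho>' w) * F k w) \<longlonglongrightarrow> ennreal (1 / \<rho>' w) * 0"
        by (intro ennreal_tendsto_cmult) auto
      moreover have "ennreal (1 / \<rho>' w) * F k w = incr_int v \<tau>1 \<tau>2 m (h k) (h k *\<^sub>R w)" for k
        using w elim by (simp add: F_def mult.assoc[symmetric] ennreal_mult[symmetric])
      ultimately show "(\<lambda>k. incr_int v \<tau>1 \<tau>2 m (h k) (h k *\<^sub>R w)) \<longlonglongrightarrow> 0" by simp
    qed
  qed
  have reflected: "AE w in lborel. norm w \<le> 1 \<and> \<rho> w > 0 \<longrightarrow>
       (\<lambda>k. incr_int v \<tau>1 \<tau>2 m (h k) (h k *\<^sub>R (s *\<^sub>R P1 w + t *\<^sub>R P2 w))) \<longlonglongrightarrow> 0"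
    if st: "s \<in> {- 1, 1}" "t \<in> {- 1, 1}" for s t :: real
  proof -
    define f where "f = (\<lambda>w. s *\<^sub>R P1 w + t *\<^sub>R P2 w)"
    have P: "P1 (f w) = s *\<^sub>R P1 w" "P2 (f w) = t *\<^sub>R P2 w" for w
      using P1_in P2_in sub1 sub2 by (auto simp: f_def intro!: P1_eq P2_eq subspace_scale)
    have "norm (f w) ^ 2 = norm w ^ 2" for w
      using st by (subst (1 2) norm_P) (auto simp: P)
    then have nf: "norm (f w) = norm w" for w
      by (metis norm_ge_zero power2_eq_iff_nonneg)
    have lin: "linear f"
      unfolding f_def by (intro linear_compose_add linear_compose_scale_right linear_P1 linear_P2)
    have "inj f" unfolding linear_injective_0[OF lin] by (metis nf norm_eq_zero)
    from AE_lborel_linear[OF lin this conv] show ?thesis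
      using nf \<rho>(2)[OF nf] by (simp add: f_def)
  qed
  have supp: "AE w in lborel. \<not> norm w \<le> 1 \<longrightarrow> \<rho> w = 0"
  proof -
    have "AE w in lborel. w \<in> - cball 0 1 \<longrightarrow> \<rho> w = 0"
    proof (rule AE_lborel_locally)
      fix p assume "p \<in> - cball (0::'a) 1"
      then have "p \<notin> ess_support \<rho>" using \<rho>(5) by blast
      then show "\<exists>r>0. AE x in lborel. x \<in> ball p r \<longrightarrow> \<rho> x = 0"
        by (auto simp: ess_support_def AE_completion_iff)
    qed
    then show ?thesis by simp
  qed
  have "AE w in lborel. w \<noteq> 0" by (rule AE_lborel_singleton)
  then have "AE w in lborel. \<rho>' w > 0 \<longrightarrow> w \<noteq> 0 \<and> (\<forall>s\<in>{- 1, 1}. \<forall>t\<in>{- 1, 1}.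
       (\<lambda>k. incr_int v \<tau>1 \<tau>2 m (h k) (h k *\<^sub>R (s *\<^sub>R P1 w + t *\<^sub>R P2 w))) \<longlonglongrightarrow> 0)"
    using \<rho>'\<rho> supp reflected[of "- 1" "- 1"] reflected[of "- 1" 1] reflected[of 1 "- 1"] reflected[of 1 1]
    by (auto elim: eventually_elim2)
  then obtain N where N: "N \<in> null_sets lborel" "{w. \<not> (\<rho>' w > 0 \<longrightarrow> w \<noteq> 0 \<and> (\<forall>s\<in>{- 1, 1}. \<forall>t\<in>{- 1, 1}.
       (\<lambda>k. incr_int v \<tau>1 \<tau>2 m (h k) (h k *\<^sub>R (s *\<^sub>R P1 w + t *\<^sub>R P2 w))) \<longlonglongrightarrow> 0))} \<subseteq> N"
    by (auto elim!: AE_E simp: null_sets_def)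
  define W where "W = {w. \<rho>' w > 0} - N"
  have "W \<in> sets borel"
    unfolding W_def using N(1) by (intro sets.Diff) (auto simp: null_sets_def)
  moreover have "\<not> negligible W"
  proof
    assume "negligible W"
    then have "AE w in lborel. w \<notin> W" by (simp add: AE_lborel_iff_negligible)
    moreover have "AE w in lborel. w \<notin> N" using N(1) by (rule AE_not_in)
    ultimately have "AE w in lborel. \<rho> w = 0"
      using \<rho>'\<rho>
    proof eventually_elim
      case (elim w)
      then show ?case using \<rho>(1)[of w] by (auto simp: W_def not_less)
    qed
    then have "AE w in lebesgue. \<rho> w = 0" by (simp add: AE_completion_iff)
    then have "(\<integral>x. \<rho> x \<partial>lebesgue) = 0" by (rule integral_eq_zero_AE)
    then show False using \<rho>(4) by simp
  qed
  moreover have "0 \<notin> W" using N(2) by (auto simp: W_def)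
  moreover have "(\<lambda>k. incr_int v \<tau>1 \<tau>2 m (h k) (h k *\<^sub>R (s *\<^sub>R P1 w + t *\<^sub>R P2 w))) \<longlonglongrightarrow> 0"
    if "w \<in> W" "s \<in> {- 1, 1}" "t \<in> {- 1, 1}" for w s t
    using that N(2) unfolding W_def by blast
  ultimately show ?thesis using that h by blast
qed

lemma box_decay_of_incr_int:
  assumes v: "bdd_borel v" and \<tau>: "0 < \<tau>1" "0 < \<tau>2" and h: "\<And>k. h k > 0" "h \<longlonglongrightarrow> 0" and w: "w \<noteq> 0"
    and lim: "\<And>s t. s \<in> {- 1, 1} \<Longrightarrow> t \<in> {- 1, 1} \<Longrightarrow>
       (\<lambda>k. incr_int v \<tau>1 \<tau>2 m (h k) (h k *\<^sub>R (s *\<^sub>R P1 w + t *\<^sub>R P2 w))) \<longlonglongrightarrow> 0"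
    and R: "R < R'" "ball p R' \<subseteq> \<Omega>"
  shows "box_decay v (P1 w) (P2 w) \<tau>1 \<tau>2 m h p R"
  unfolding box_decay_def
proof (intro ballI)
  fix s t :: real assume st: "s \<in> {- 1, 1}" "t \<in> {- 1, 1}"
  define f where "f = (\<lambda>k x. \<bar>v (x + (s * h k) *\<^sub>R P1 w) - v x\<bar> powr \<tau>1 * \<bar>v (x + (t * h k) *\<^sub>R P2 w) - v x\<bar> powr \<tau>2)"
  have fb: "bdd_borel (f k)" for k unfolding f_def using \<tau> by (intro bdd_borel_intros v) auto
  have f0: "f k x \<ge> 0" for k x unfolding f_def by simp
  define y where "y = s *\<^sub>R P1 w + t *\<^sub>R P2 w"
  have P: "P1 y = s *\<^sub>R P1 w" "P2 y = t *\<^sub>R P2 w"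
    using P1_in P2_in sub1 sub2 by (auto simp: y_def intro!: P1_eq P2_eq subspace_scale)
  have "norm y ^ 2 = norm w ^ 2" using st by (subst (1 2) norm_P) (auto simp: P)
  then have ny: "norm y = norm w" by (metis norm_ge_zero power2_eq_iff_nonneg)
  define c where "c = norm w powr m"
  have c: "c > 0" using w by (simp add: c_def)
  have "(\<lambda>k. R + 2 * h k) \<longlonglongrightarrow> R + 2 * 0" by (intro tendsto_intros h)
  then have ev: "\<forall>\<^sub>F k in sequentially. R + 2 * h k < R'" using R by (intro order_tendstoD(2)) auto
  have "(\<lambda>k. ennreal (ball_int p R (f k) / h k powr m / c)) \<longlonglongrightarrow> 0"
  proof (rule tendsto_sandwich[OF _ _ tendsto_const lim[OF st, folded y_def]])
    show "\<forall>\<^sub>F k in sequentially. ennreal (ball_int p R (f k) / h k powr m / c) \<le> incr_int v \<tau>1 \<tau>2 m (h k) (h k *\<^sub>R y)"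
      using ev
    proof eventually_elim
      case (elim k)
      have hk: "h k > 0" by (rule h)
      define d where "d = h k powr m * c"
      have d: "d > 0" using c hk by (simp add: d_def)
      have sub: "ball p R \<subseteq> deep (h k)"
      proof
        fix x assume "x \<in> ball p R"
        have "ball x (2 * h k) \<subseteq> ball p R'"
        proof
          fix z assume "z \<in> ball x (2 * h k)"
          then show "z \<in> ball p R'" using \<open>x \<in> ball p R\<close> elim dist_triangle[of p z x] by simp
        qed
        then show "x \<in> deep (h k)" using R(2) by (auto simp: deep_def)
      qed
      have "ennreal (ball_int p R (f k) / h k powr m / c) = ennreal (ball_int p R (\<lambda>x. (1 / d) * f k x))"
        by (simp only: ball_int_cmult) (simp add: d_def)
      also have "\<dots> = (\<integral>\<^sup>+x. indicator (ball p R) x * ennreal ((1 / d) * f k x) \<partial>lborel)"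
        using d f0 by (intro ball_int_eq_nn_integral bdd_borel_intros fb) auto
      also have "\<dots> \<le> incr_int v \<tau>1 \<tau>2 m (h k) (h k *\<^sub>R y)"
        unfolding incr_int_def
      proof (intro nn_integral_mono mult_mono)
        fix x
        have "norm (h k *\<^sub>R y) powr m = d" using hk by (simp add: d_def c_def ny powr_mult)
        moreover have "P1 (h k *\<^sub>R y) = (s * h k) *\<^sub>R P1 w" "P2 (h k *\<^sub>R y) = (t * h k) *\<^sub>R P2 w"
          by (simp_all add: P1_simps P2_simps P mult.commute)
        ultimately show "ennreal ((1 / d) * f k x) \<le> ennreal (\<bar>v (x + P1 (h k *\<^sub>R y)) - v x\<bar> powr \<tau>1 *
            \<bar>v (x + P2 (h k *\<^sub>R y)) - v x\<bar> powr \<tau>2 / norm (h k *\<^sub>R y) powr m)"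
          by (simp add: f_def)
        show "indicator (ball p R) x \<le> (indicator (deep (h k)) x :: ennreal)"
          using sub by (auto simp: indicator_def)
      qed auto
      finally show ?case .
    qed
  qed auto
  moreover have "\<forall>\<^sub>F k in sequentially. 0 \<le> ball_int p R (f k) / h k powr m / c"
    using c by (intro always_eventually allI divide_nonneg_nonneg ball_int_nonneg f0) auto
  ultimately have "(\<lambda>k. ball_int p R (f k) / h k powr m / c) \<longlonglongrightarrow> 0"
    using tendsto_ennreal_iff[of "\<lambda>k. ball_int p R (f k) / h k powr m / c" sequentially 0] by simp
  then have "(\<lambda>k. c * (ball_int p R (f k) / h k powr m / c)) \<longlonglongrightarrow> c * 0" by (intro tendsto_intros)
  then show "(\<lambda>k. ball_int p R (\<lambda>x. \<bar>v (x + (s * h k) *\<^sub>R P1 w) - v x\<bar> powr \<tau>1 *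
      \<bar>v (x + (t * h k) *\<^sub>R P2 w) - v x\<bar> powr \<tau>2) / h k powr m) \<longlonglongrightarrow> 0"
    using c by (simp add: f_def)
qed

end

section \<open>Reduction to bounded functions\<close>

lemma abs_arctan_diff_le: "\<bar>arctan a - arctan b\<bar> \<le> \<bar>a - b\<bar>"
proof -
  have "norm (arctan a - arctan b) \<le> 1 * norm (a - b)"
  proof (rule field_differentiable_bound[of UNIV])
    show "(arctan has_field_derivative inverse (1 + z\<^sup>2)) (at z within UNIV)" for z :: real
      by (auto intro!: DERIV_arctan)
    show "norm (inverse (1 + z\<^sup>2)) \<le> 1" for z :: real
      by (simp add: abs_inverse abs_of_pos add_pos_nonneg inverse_le_1_iff)
  qed auto
  then show ?thesis by simp
qed

text \<open>For bounded functions the exponents may be enlarged, which reduces the three cases of the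
  critical exponent to one.\<close>

lemma exponents:
  assumes "0 < \<theta>1" "0 < \<theta>2"
  obtains \<tau>1 \<tau>2 q :: real where "\<theta>1 \<le> \<tau>1" "\<theta>2 \<le> \<tau>2" "min \<tau>1 \<tau>2 \<le> q" "q \<le> \<tau>1 + \<tau>2" "1 \<le> q"
    "crit_exponent \<theta>1 \<theta>2 = \<tau>1 + \<tau>2 + q"
proof -
  consider "\<theta>1 + \<theta>2 \<le> 1" | "\<theta>1 + \<theta>2 > 1" "min \<theta>1 \<theta>2 \<le> 1" | "\<theta>1 + \<theta>2 > 1" "min \<theta>1 \<theta>2 > 1" by linarith
  then show ?thesis
  proof cases
    case 1
    then show ?thesis using assms by (intro that[of \<theta>1 "1 - \<theta>1" 1]) (auto simp: crit_exponent_def Let_def)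
  next
    case 2
    then show ?thesis using assms by (intro that[of \<theta>1 \<theta>2 1]) (auto simp: crit_exponent_def Let_def)
  next
    case 3
    then show ?thesis using assms by (intro that[of \<theta>1 \<theta>2 "min \<theta>1 \<theta>2"]) (auto simp: crit_exponent_def Let_def)
  qed
qed

lemma borel_imp_Lfun_subspace:
  fixes f :: "'a::euclidean_space \<Rightarrow> real"
  assumes [measurable]: "f \<in> borel_measurable borel"
  shows "f \<in> Lfun (lebesgue_subspace X) U"
proof -
  have "f \<in> borel_measurable (distr M (restrict_space borel X) g)" for M and g :: "('a \<Rightarrow> real) \<Rightarrow> 'a"
    by (simp add: measurable_restrict_space1)
  then show ?thesis
    unfolding Lfun_def lebesgue_subspace_def Let_def
    by (intro measurable_restrict_space1 measurable_completion)
qed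

theorem theorem9:
  fixes X1 X2 \<Omega>1 \<Omega>2 :: "'a::euclidean_space set"
    and \<rho> :: "'a \<Rightarrow> real"
    and \<theta>1 \<theta>2 :: real
    and u :: "'a \<Rightarrow> real"
  assumes "subspace X1" and "subspace X2"
    and "dim X1 \<ge> 1" and "dim X2 \<ge> 1"
    and "\<forall>x\<in>X1. \<forall>y\<in>X2. orthogonal x y"
    and "X1 + X2 = UNIV"
    and "openin (top_of_set X1) \<Omega>1" and "\<Omega>1 \<noteq> {}" and "bounded \<Omega>1" and "connected \<Omega>1"
    and "openin (top_of_set X2) \<Omega>2" and "\<Omega>2 \<noteq> {}" and "bounded \<Omega>2" and "connected \<Omega>2"
    and "\<forall>x. \<rho> x \<ge> 0"
    and "\<forall>x y. norm x = norm y \<longrightarrow> \<rho> x = \<rho> y"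
    and "integrable lebesgue \<rho>" and "(\<integral>x. \<rho> x \<partial>lebesgue) = 1"
    and "ess_support \<rho> \<subseteq> cball 0 1"
    and "\<theta>1 > 0" and "\<theta>2 > 0"
    and "u \<in> Lfun lebesgue (\<Omega>1 + \<Omega>2)"
    and "energy X1 X2 \<Omega>1 \<Omega>2 \<rho> (crit_exponent \<theta>1 \<theta>2) \<theta>1 \<theta>2 u = 0"
  shows "u \<in> Sfun X1 X2 \<Omega>1 \<Omega>2"
proof -
  interpret product_domain X1 X2 \<Omega>1 \<Omega>2
  proof unfold_locales
    show "orthogonal x y" if "x \<in> X1" "y \<in> X2" for x y using assms(5) that by blast
  qed (rule assms(1,2,6,7,8,10,11,12,14))+
  have \<Omega>_sets: "\<Omega> \<in> sets lebesgue" using open_\<Omega> by simp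
  \<comment> \<open>an injective contraction with values in \<open>[-1/2, 1/2]\<close>, so that increments are at most \<open>1\<close>\<close>
  define \<phi> where "\<phi> = (\<lambda>a::real. arctan a / 4)"
  have \<phi>_lip: "\<bar>\<phi> a - \<phi> b\<bar> \<le> \<bar>a - b\<bar>" for a b
    using abs_arctan_diff_le[of a b] unfolding \<phi>_def by linarith
  have \<phi>_bound: "\<bar>\<phi> a\<bar> \<le> 1 / 2" for a
  proof -
    have "\<bar>arctan a\<bar> < pi / 2" using arctan_bounded[of a] by auto
    then show ?thesis using pi_less_4 unfolding \<phi>_def by linarith
  qed
  have um: "u \<in> borel_measurable (restrict_space lebesgue \<Omega>)" using assms(22) by (simp add: Lfun_def)
  have "(\<lambda>x. \<phi> (u x)) \<in> borel_measurable (restrict_space lebesgue \<Omega>)"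
    unfolding \<phi>_def using um by measurable
  then have "(\<lambda>x. indicator \<Omega> x *\<^sub>R \<phi> (u x)) \<in> borel_measurable lebesgue"
    using \<Omega>_sets by (subst (asm) borel_measurable_restrict_space_iff) auto
  then obtain v0 where v0[measurable]: "v0 \<in> borel_measurable borel" and v0u: "AE x in lborel. indicator \<Omega> x *\<^sub>R \<phi> (u x) = v0 x"
    using completion_ex_borel_measurable_real by fastforce
  \<comment> \<open>\<open>v0\<close> has the right bounds only almost everywhere\<close>
  define v where "v = (\<lambda>x. max (- 1 / 2) (min (1 / 2) (v0 x)))"
  have vm[measurable]: "v \<in> borel_measurable borel" unfolding v_def by measurable
  have v1: "\<bar>v x\<bar> \<le> 1 / 2" for x unfolding v_def by auto
  have vb: "bdd_borel v" by (rule bdd_borelI[OF vm v1])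
  have vu: "AE x in lborel. x \<in> \<Omega> \<longrightarrow> v x = \<phi> (u x)"
    using v0u
  proof eventually_elim
    case (elim x)
    show ?case
    proof
      assume "x \<in> \<Omega>"
      then have "v0 x = \<phi> (u x)" using elim by simp
      then show "v x = \<phi> (u x)" using \<phi>_bound[of "u x"] unfolding v_def by auto
    qed
  qed
  obtain \<tau>1 \<tau>2 q where \<tau>: "\<theta>1 \<le> \<tau>1" "\<theta>2 \<le> \<tau>2" "min \<tau>1 \<tau>2 \<le> q" "q \<le> \<tau>1 + \<tau>2" "1 \<le> q"
    and crit: "crit_exponent \<theta>1 \<theta>2 = \<tau>1 + \<tau>2 + q"
    using exponents[OF assms(20,21)] by blast
  have \<tau>0: "0 < \<tau>1" "0 < \<tau>2" using \<tau> assms(20,21) by auto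
  obtain h W where h: "\<And>k. h k > 0" "h \<longlonglongrightarrow> 0" and W: "W \<in> sets borel" "\<not> negligible W" "0 \<notin> W"
    and lim: "\<And>w s t. w \<in> W \<Longrightarrow> s \<in> {- 1, 1} \<Longrightarrow> t \<in> {- 1, 1} \<Longrightarrow>
       (\<lambda>k. incr_int v \<tau>1 \<tau>2 (\<tau>1 + \<tau>2 + q) (h k) (h k *\<^sub>R (s *\<^sub>R P1 w + t *\<^sub>R P2 w))) \<longlonglongrightarrow> 0"
  proof (rule good_directions[OF assms(20) \<tau>(1) assms(21) \<tau>(2) vm v1 \<phi>_lip vu _ _ assms(17,18,19) assms(23)[unfolded crit]])
    show "\<rho> x \<ge> 0" for x using assms(15) by blast
    show "\<rho> x = \<rho> y" if "norm x = norm y" for x y using assms(16) that by blast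
  qed blast
  have one: "(\<exists>b\<in>\<Omega>. AE x in lborel. x \<in> \<Omega> \<longrightarrow> v x = v (P1 b + P2 x)) \<or> (\<exists>b\<in>\<Omega>. AE x in lborel. x \<in> \<Omega> \<longrightarrow> v x = v (P2 b + P1 x))"
  proof (rule decay_imp_one_component[OF vb v1 h \<tau>0 \<tau>(3,4,5) W(1,2)])
    fix w p R R' assume w: "w \<in> W" and R: "R < R'" "ball p R' \<subseteq> \<Omega>"
    have "w \<noteq> 0" using w W(3) by blast
    then show "box_decay v (P1 w) (P2 w) \<tau>1 \<tau>2 (\<tau>1 + \<tau>2 + q) h p R"
      by (rule box_decay_of_incr_int[OF vb \<tau>0 h _ lim[OF w] R])
  qed
  have recover: "AE x in lebesgue_on \<Omega>. u x = tan (4 * v (a + g x))"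
    if "AE x in lborel. x \<in> \<Omega> \<longrightarrow> v x = v (a + g x)" for a and g :: "'a \<Rightarrow> 'a"
  proof -
    from that vu have "AE x in lborel. x \<in> \<Omega> \<longrightarrow> u x = tan (4 * v (a + g x))"
    proof eventually_elim
      case (elim x)
      show ?case
      proof
        assume "x \<in> \<Omega>"
        then have "4 * v (a + g x) = arctan (u x)" using elim by (simp add: \<phi>_def)
        then show "u x = tan (4 * v (a + g x))" by (simp only: tan_arctan)
      qed
    qed
    then have "AE x in lebesgue. x \<in> \<Omega> \<longrightarrow> u x = tan (4 * v (a + g x))" by (simp add: AE_completion_iff)
    then show ?thesis using \<Omega>_sets by (subst AE_restrict_space_iff) auto
  qed
  have slice: "(\<lambda>x. tan (4 * v (a + x))) \<in> Lfun (lebesgue_subspace X) U" for a X U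
    unfolding tan_def by (intro borel_imp_Lfun_subspace) measurable
  from one show ?thesis
  proof
    assume "\<exists>b\<in>\<Omega>. AE x in lborel. x \<in> \<Omega> \<longrightarrow> v x = v (P1 b + P2 x)"
    then obtain b where b: "AE x in lborel. x \<in> \<Omega> \<longrightarrow> v x = v (P1 b + P2 x)" by blast
    have "\<exists>u2\<in>Lfun (lebesgue_subspace X2) \<Omega>2. AE x in lebesgue_on \<Omega>. u x = u2 (P2 x)"
      using recover[OF b] slice[of "P1 b" X2 \<Omega>2] by (rule bexI)
    then show ?thesis using assms(22) by (simp add: Sfun_def)
  next
    assume "\<exists>b\<in>\<Omega>. AE x in lborel. x \<in> \<Omega> \<longrightarrow> v x = v (P2 b + P1 x)"
    then obtain b where b: "AE x in lborel. x \<in> \<Omega> \<longrightarrow> v x = v (P2 b + P1 x)" by blast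
    have "\<exists>u1\<in>Lfun (lebesgue_subspace X1) \<Omega>1. AE x in lebesgue_on \<Omega>. u x = u1 (P1 x)"
      using recover[OF b] slice[of "P2 b" X1 \<Omega>1] by (rule bexI)
    then show ?thesis using assms(22) by (simp add: Sfun_def)
  qed
qed

end
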